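(* Let $\mathbf M = \langle Q \cup \Sigma \cup \{0\}; \cdot\rangle$ be a finite automatic algebra with $|Q| = 2$. Then the following are equivalent: \begin{enumerate} \item $\mathbf M$ is dualizable; \item $\mathbf M$ satisfies the equations $xy \approx xyyy$ and $wxyz \approx wyxz$; \item none of the six automatic algebras $\mathbf N_0,\mathbf N_1,\mathbf N_2,\mathbf N_3,\mathbf N_4,\mathbf N_5$ embeds into $\mathbf M$. \end{enumerate}
   Context: **Automatic algebras.** An automatic algebra is an algebra with a single binary operation $\mathbf M = \langle Q \cup \Sigma \cup \{0\}; \cdot\rangle$, where $Q$ (states) and $\Sigma$ (letters) are disjoint sets and $0 \notin Q\cup\Sigma$, that encodes a partial (deterministic) automaton: each letter $a \in \Sigma$ acts as a partial map $Q \to Q$; for $q,r\in Q$ and $a \in \Sigma$ we have $q\cdot a = r$ iff $a$ sends $q$ to $r$; all other products are $0$. Products are bracketed from the left: $uv_1v_2\cdots v_n := (\cdots((u\cdot v_1)\cdot v_2)\cdots)\cdot v_n$. **The algebras $\mathbf N_i$.** Each has state set $\{q,r\}$; all products not listed are $0$. - $\mathbf N_0$: letter $a$; $qa=r$. - $\mathbf N_1$: letters $a,b$; $qa=r$, $ra=r$, $rb=r$. - $\mathbf N_2$: letters $a,b$; $qa=r$, $ra=q$, $rb=r$. - $\mathbf N_3$: letters $a,b$; $qa=r$, $ra=r$, $qb=q$. - $\mathbf N_4$: letters $a,b$; $qa=r$, $ra=r$, $qb=r$, $rb=q$. - $\mathbf N_5$: letters $a,b,c$; $qa=r$, $ra=r$,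 $qb=q$, $rb=q$, $qc=q$, $rc=r$. **Dualizability.** Let $\mathbf M$ be a finite algebra with universe $M$. A $k$-ary relation on $M$ ($k\ge 1$) is compatible with $\mathbf M$ if it is a subuniverse of $\mathbf M^k$. For $\mathbf A \in \mathbb{ISP}(\mathbf M)$ (isomorphic copies of subalgebras of powers of $\mathbf M$), view $\hom(\mathbf A,\mathbf M)\subseteq M^A$ with the subspace topology of the product topology ($M$ discrete), and with relations on $M$ interpreted pointwise. A map $f\colon \hom(\mathbf A,\mathbf M)\to M$ is an evaluation if there is $a\in A$ with $f(x)=x(a)$ for all $x$. The algebra $\mathbf M$ is dualizable if, for every $\mathbf A\in\mathbb{ISP}(\mathbf M)$, every continuous map $f\colon\hom(\mathbf A,\mathbf M)\to M$ that preserves all finitary compatible relations on $\mathbf M$ is an evaluation. *)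

theory Defs
  imports "HOL-Analysis.Function_Topology"
begin

record 'a magma =
  univ :: "'a set"
  mult :: "'a \<Rightarrow> 'a \<Rightarrow> 'a" (infixl "\<cdot>\<index>" 70)

definition subuniverse :: "('a, 'm) magma_scheme \<Rightarrow> 'a set \<Rightarrow> bool" where
  "subuniverse M B \<longleftrightarrow> B \<subseteq> univ M \<and> (\<forall>x\<in>B. \<forall>y\<in>B. x \<cdot>\<^bsub>M\<^esub> y \<in> B)"

definition algebra :: "('a, 'm) magma_scheme \<Rightarrow> bool" where
  "algebra M \<longleftrightarrow> subuniverse M (univ M)"

text \<open>Homomorphisms are extensional on the domain, so that this set is literally
  a subset of the power of \<open>univ M\<close> indexed by \<open>univ A\<close>.\<close>

definition hom :: "('b, 'n) magma_scheme \<Rightarrow> ('a, 'm) magma_scheme \<Rightarrow> ('b \<Rightarrow> 'a) set" where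
  "hom A M = {h \<in> univ A \<rightarrow>\<^sub>E univ M.
     \<forall>x\<in>univ A. \<forall>y\<in>univ A. h (x \<cdot>\<^bsub>A\<^esub> y) = h x \<cdot>\<^bsub>M\<^esub> h y}"

definition embeds :: "('b, 'n) magma_scheme \<Rightarrow> ('a, 'm) magma_scheme \<Rightarrow> bool" where
  "embeds A M \<longleftrightarrow> (\<exists>h\<in>hom A M. inj_on h (univ A))"

definition isomorphic :: "('b, 'n) magma_scheme \<Rightarrow> ('a, 'm) magma_scheme \<Rightarrow> bool" where
  "isomorphic A M \<longleftrightarrow> (\<exists>h\<in>hom A M. bij_betw h (univ A) (univ M))"

definition power_alg :: "'a magma \<Rightarrow> 'i set \<Rightarrow> ('i \<Rightarrow> 'a) magma" where
  "power_alg M I = \<lparr>univ = I \<rightarrow>\<^sub>E univ M, mult = (\<lambda>x y. \<lambda>i\<in>I. x i \<cdot>\<^bsub>M\<^esub> y i)\<rparr>"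

text \<open>An algebra on a subset of \<open>'b\<close> that embeds into any power of \<open>M\<close> embeds into a
  power whose index set is a set of homomorphisms into \<open>M\<close>, so index sets inside
  \<open>'b \<Rightarrow> 'a\<close> are enough; see \<open>in_ISP_arbitrary_index\<close> below.\<close>

definition in_ISP :: "'b magma \<Rightarrow> 'a magma \<Rightarrow> bool" where
  "in_ISP A M \<longleftrightarrow> algebra A \<and>
     (\<exists>(I :: ('b \<Rightarrow> 'a) set) B. subuniverse (power_alg M I) B \<and>
        isomorphic A ((power_alg M I)\<lparr>univ := B\<rparr>))"

definition compatible_relation :: "'a magma \<Rightarrow> nat \<Rightarrow> (nat \<Rightarrow> 'a) set \<Rightarrow> bool" where
  "compatible_relation M k R \<longleftrightarrow> subuniverse (power_alg M {..<k}) R"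

definition preserves ::
  "'b magma \<Rightarrow> 'a magma \<Rightarrow> nat \<Rightarrow> (nat \<Rightarrow> 'a) set \<Rightarrow> (('b \<Rightarrow> 'a) \<Rightarrow> 'a) \<Rightarrow> bool" where
  "preserves A M k R f \<longleftrightarrow>
     (\<forall>x. (\<forall>i<k. x i \<in> hom A M) \<and> (\<forall>a\<in>univ A. (\<lambda>i\<in>{..<k}. x i a) \<in> R)
        \<longrightarrow> (\<lambda>i\<in>{..<k}. f (x i)) \<in> R)"

definition hom_topology :: "'b magma \<Rightarrow> 'a magma \<Rightarrow> ('b \<Rightarrow> 'a) topology" where
  "hom_topology A M =
     subtopology (product_topology (\<lambda>_. discrete_topology (univ M)) (univ A)) (hom A M)"

definition is_evaluation :: "'b magma \<Rightarrow> 'a magma \<Rightarrow> (('b \<Rightarrow> 'a) \<Rightarrow> 'a) \<Rightarrow> bool" where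
  "is_evaluation A M f \<longleftrightarrow> (\<exists>a\<in>univ A. \<forall>x\<in>hom A M. f x = x a)"

text \<open>HOL cannot quantify over all types inside a formula, so the type \<open>'b\<close> that hosts the
  universes of the algebras \<open>A\<close> is a parameter. The unrestricted notion is dualizability
  for every \<open>'b\<close>. If \<open>'b\<close> is finite the condition is vacuous: it only concerns finite \<open>A\<close>,
  and then the image of \<open>A\<close> under the evaluation map is itself a compatible relation.\<close>

definition dualizable :: "'b itself \<Rightarrow> 'a magma \<Rightarrow> bool" where
  "dualizable (_ :: 'b itself) M \<longleftrightarrow>
     (\<forall>(A :: 'b magma) f. in_ISP A M
        \<and> continuous_map (hom_topology A M) (discrete_topology (univ M)) f
        \<and> (\<forall>k\<ge>1. \<forall>R. compatible_relation M k R \<longrightarrow> preserves A M k R f)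
        \<longrightarrow> is_evaluation A M f)"

text \<open>\<open>\<delta> a\<close> is the partial map on the states \<open>Q\<close> by which the letter \<open>a\<close> acts.\<close>

definition partial_automaton :: "'a set \<Rightarrow> 'a set \<Rightarrow> ('a \<Rightarrow> 'a \<rightharpoonup> 'a) \<Rightarrow> bool" where
  "partial_automaton Q \<Sigma> \<delta> \<longleftrightarrow> (\<forall>a\<in>\<Sigma>. dom (\<delta> a) \<subseteq> Q \<and> ran (\<delta> a) \<subseteq> Q)"

definition automatic_algebra ::
  "'a set \<Rightarrow> 'a set \<Rightarrow> 'a \<Rightarrow> ('a \<Rightarrow> 'a \<rightharpoonup> 'a) \<Rightarrow> 'a magma" where
  "automatic_algebra Q \<Sigma> z \<delta> =
     \<lparr>univ = Q \<union> \<Sigma> \<union> {z},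
      mult = (\<lambda>x y. if x \<in> Q \<and> y \<in> \<Sigma> then (case \<delta> y x of None \<Rightarrow> z | Some r \<Rightarrow> r) else z)\<rparr>"

definition satisfies_equations :: "'a magma \<Rightarrow> bool" where
  "satisfies_equations M \<longleftrightarrow>
     (\<forall>x\<in>univ M. \<forall>y\<in>univ M. x \<cdot>\<^bsub>M\<^esub> y = x \<cdot>\<^bsub>M\<^esub> y \<cdot>\<^bsub>M\<^esub> y \<cdot>\<^bsub>M\<^esub> y) \<and>
     (\<forall>w\<in>univ M. \<forall>x\<in>univ M. \<forall>y\<in>univ M. \<forall>z\<in>univ M.
        w \<cdot>\<^bsub>M\<^esub> x \<cdot>\<^bsub>M\<^esub> y \<cdot>\<^bsub>M\<^esub> z = w \<cdot>\<^bsub>M\<^esub> y \<cdot>\<^bsub>M\<^esub> x \<cdot>\<^bsub>M\<^esub> z)"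

datatype nelem = Zero | St_q | St_r | Lt_a | Lt_b | Lt_c

definition N0 :: "nelem magma" where
  "N0 = automatic_algebra {St_q, St_r} {Lt_a} Zero
     ((\<lambda>_. Map.empty)(Lt_a := [St_q \<mapsto> St_r]))"

definition N1 :: "nelem magma" where
  "N1 = automatic_algebra {St_q, St_r} {Lt_a, Lt_b} Zero
     ((\<lambda>_. Map.empty)(Lt_a := [St_q \<mapsto> St_r, St_r \<mapsto> St_r],
                      Lt_b := [St_r \<mapsto> St_r]))"

definition N2 :: "nelem magma" where
  "N2 = automatic_algebra {St_q, St_r} {Lt_a, Lt_b} Zero
     ((\<lambda>_. Map.empty)(Lt_a := [St_q \<mapsto> St_r, St_r \<mapsto> St_q],
                      Lt_b := [St_r \<mapsto> St_r]))"

definition N3 :: "nelem magma" where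
  "N3 = automatic_algebra {St_q, St_r} {Lt_a, Lt_b} Zero
     ((\<lambda>_. Map.empty)(Lt_a := [St_q \<mapsto> St_r, St_r \<mapsto> St_r],
                      Lt_b := [St_q \<mapsto> St_q]))"

definition N4 :: "nelem magma" where
  "N4 = automatic_algebra {St_q, St_r} {Lt_a, Lt_b} Zero
     ((\<lambda>_. Map.empty)(Lt_a := [St_q \<mapsto> St_r, St_r \<mapsto> St_r],
                      Lt_b := [St_q \<mapsto> St_r, St_r \<mapsto> St_q]))"

definition N5 :: "nelem magma" where
  "N5 = automatic_algebra {St_q, St_r} {Lt_a, Lt_b, Lt_c} Zero
     ((\<lambda>_. Map.empty)(Lt_a := [St_q \<mapsto> St_r, St_r \<mapsto> St_r],
                      Lt_b := [St_q \<mapsto> St_q, St_r \<mapsto> St_q],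
                      Lt_c := [St_q \<mapsto> St_q, St_r \<mapsto> St_r]))"

lemma in_ISP_arbitrary_index:
  fixes A :: "'b magma" and M :: "'a magma" and I :: "'i set"
  assumes A: "algebra A" and emb: "embeds A (power_alg M I)"
  shows "in_ISP A M"
proof -
  obtain h where h: "h \<in> hom A (power_alg M I)" and inj: "inj_on h (univ A)"
    using emb by (auto simp: embeds_def)
  have clA: "x \<cdot>\<^bsub>A\<^esub> y \<in> univ A" if "x \<in> univ A" "y \<in> univ A" for x y
    using A that by (auto simp: algebra_def subuniverse_def)
  have hM: "h x \<in> I \<rightarrow>\<^sub>E univ M" if "x \<in> univ A" for x
    using h that by (auto simp: hom_def power_alg_def)
  have hmul: "h (x \<cdot>\<^bsub>A\<^esub> y) = (\<lambda>i\<in>I. h x i \<cdot>\<^bsub>M\<^esub> h y i)" if "x \<in> univ A" "y \<in> univ A" for x y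
    using h that by (auto simp: hom_def power_alg_def)
  define J where "J = (\<lambda>i. \<lambda>x\<in>univ A. h x i) ` I"
  define g where "g = (\<lambda>x\<in>univ A. \<lambda>e\<in>J. e x)"
  define B where "B = g ` univ A"
  have g: "g x \<in> J \<rightarrow>\<^sub>E univ M" if "x \<in> univ A" for x
    using that hM[OF that] by (auto simp: g_def J_def)
  have gmul: "g (x \<cdot>\<^bsub>A\<^esub> y) = (\<lambda>e\<in>J. g x e \<cdot>\<^bsub>M\<^esub> g y e)" if "x \<in> univ A" "y \<in> univ A" for x y
    using that clA[OF that] by (fastforce simp: g_def J_def hmul fun_eq_iff restrict_def)
  have "subuniverse (power_alg M J) B"
    using g gmul clA unfolding subuniverse_def power_alg_def B_def
    by (auto simp flip: gmul)
  moreover have "inj_on g (univ A)"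
  proof (rule inj_onI)
    fix x y assume xy: "x \<in> univ A" "y \<in> univ A" "g x = g y"
    have "h x i = h y i" if "i \<in> I" for i
    proof -
      have "(\<lambda>x\<in>univ A. h x i) \<in> J" using that by (simp add: J_def)
      moreover have "g x (\<lambda>x\<in>univ A. h x i) = g y (\<lambda>x\<in>univ A. h x i)" using xy by simp
      ultimately show ?thesis using xy(1,2) by (simp add: g_def)
    qed
    then have "h x = h y" using hM[OF xy(1)] hM[OF xy(2)] by (meson PiE_ext)
    then show "x = y" using inj xy by (auto dest: inj_onD)
  qed
  moreover have "g \<in> hom A ((power_alg M J)\<lparr>univ := B\<rparr>)"
    using gmul by (auto simp: hom_def power_alg_def B_def g_def)
  ultimately show ?thesis
    using A unfolding in_ISP_def isomorphic_def
    by (intro conjI exI[of _ J] exI[of _ B] bexI[of _ g]) (auto simp: bij_betw_def B_def)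
qed

end

theory Submission
  imports Defs
begin

text \<open>
On two states, conditions (2) and (3) both say that the letters, except those acting by the nowhere
defined map, act all by permutations, or all by restrictions of the identity, or all by constant
maps, or all by the identity or one fixed constant map.

If this fails, then \<open>M\<close> is not dualizable by the ghost element method: inside the eventually
constant sequences over \<open>M\<close> one finds a subalgebra and elements \<open>w n\<close> in it that
converge to a missing sequence \<open>g\<close>, such that every homomorphism to \<open>M\<close> takes one value at
almost all \<open>w n\<close>, with a bound on the number of exceptions.

Conversely, let \<open>f\<close> on \<open>hom(A, M)\<close> be continuous and preserve the compatible relations, that is,
agree with an evaluation on every finite set of homomorphisms. Evaluations at elements that are not
products are handled by one homomorphism vanishing on all products, so assume that the elements can
be taken to be products. For a suitable set \<open>K\<close> of states, a homomorphism \<open>x\<close> is described up to its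
values by the pair of preimages of \<open>K\<close> and of the letters mapping \<open>K\<close> into itself. The pairs of
those \<open>x\<close> with \<open>f x \<in> K\<close> have a least one, and it is generated by a single product \<open>w\<close>, whence
\<open>f x \<in> K \<longleftrightarrow> x w \<in> K\<close>. The values of \<open>f\<close> are then corrected by multiplying \<open>w\<close> with letters,
using linear algebra over the field with two elements in the case of permutations.
\<close>

section \<open>Homomorphisms into a finite algebra\<close>

text \<open>The local evaluations only give an element for each finite set of homomorphisms; the
  obstacle is to find one element for all of them. Compactness of the hom space turns continuity
  into a finite set \<open>F\<close> such that \<open>f x\<close> depends only on the values of
  \<open>x\<close> on \<open>F\<close>. This is exploited by building two homomorphisms that agree
  on \<open>F\<close> and evaluating \<open>f\<close> at both. The supply of homomorphisms comes
  from gluing: states and letters are prescribed on a pair of sets closed under the relevant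
  products, and everything else goes to zero. If the letters with nonempty action all act alike, the
  candidates for the evaluating element essentially coincide. If they act differently, there is
  enough freedom to prescribe values, and continuity confines the candidates to finitely many, or to
  sums of finitely many coordinates. In the six ghost constructions the sequences \<open>w n\<close>
  are so linked by products that two different values, each taken twice, would require too many
  states or contradictory actions of one letter. Two repetitions of each value supply the auxiliary
  indices outside a given pair.\<close>

lemma mem_hom_iff:
  "x \<in> hom A M \<longleftrightarrow> x \<in> univ A \<rightarrow>\<^sub>E univ M \<and>
     (\<forall>a\<in>univ A. \<forall>b\<in>univ A. x (a \<cdot>\<^bsub>A\<^esub> b) = x a \<cdot>\<^bsub>M\<^esub> x b)"
  by (auto simp: hom_def)

lemma algebra_mult: "algebra A \<Longrightarrow> a \<in> univ A \<Longrightarrow> b \<in> univ A \<Longrightarrow> a \<cdot>\<^bsub>A\<^esub> b \<in> univ A"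
  by (auto simp: algebra_def subuniverse_def)

lemma topspace_hom_topology [simp]: "topspace (hom_topology A M) = hom A M"
proof -
  have "hom A M \<subseteq> univ A \<rightarrow>\<^sub>E univ M" by (auto simp: mem_hom_iff)
  then show ?thesis by (simp add: hom_topology_def inf.absorb2)
qed

section \<open>Topology of the hom space: continuous maps depend on finitely many
  coordinates\<close>

lemma openin_product_agree_on_finite:
  assumes "finite F" "F \<subseteq> I" "x \<in> I \<rightarrow>\<^sub>E X"
  shows "openin (product_topology (\<lambda>_. discrete_topology X) I) {y \<in> I \<rightarrow>\<^sub>E X. \<forall>a\<in>F. y a = x a}"
proof -
  let ?U = "\<lambda>a. if a \<in> F then {x a} else X"
  have "y \<in> (\<Pi>\<^sub>E a\<in>I. ?U a)" if "y \<in> I \<rightarrow>\<^sub>E X" "\<forall>a\<in>F. y a = x a" for y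
    using that by (auto simp: PiE_iff)
  moreover have "y \<in> I \<rightarrow>\<^sub>E X" "\<forall>a\<in>F. y a = x a" if y: "y \<in> (\<Pi>\<^sub>E a\<in>I. ?U a)" for y
  proof -
    have y': "y a \<in> ?U a" if "a \<in> I" for a using y that by (rule PiE_mem)
    then show "\<forall>a\<in>F. y a = x a" using assms(2) by (meson singletonD subsetD)
    have "y a \<in> X" if "a \<in> I" for a
      using y'[OF that] PiE_mem[OF assms(3) that] by (simp split: if_splits)
    then show "y \<in> I \<rightarrow>\<^sub>E X" using y by (simp add: PiE_iff)
  qed
  ultimately have "{y \<in> I \<rightarrow>\<^sub>E X. \<forall>a\<in>F. y a = x a} = (\<Pi>\<^sub>E a\<in>I. ?U a)" by blast
  moreover have "openin (product_topology (\<lambda>_. discrete_topology X) I) (\<Pi>\<^sub>E a\<in>I. ?U a)"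
  proof (rule product_topology_basis)
    show "openin (discrete_topology X) (?U a)" for a
      using PiE_mem[OF assms(3), of a] assms(2) by auto
    have "{i. ?U i \<noteq> topspace (discrete_topology X)} \<subseteq> F" by auto
    then show "finite {i. ?U i \<noteq> topspace (discrete_topology X)}"
      using assms(1) by (rule finite_subset)
  qed
  ultimately show ?thesis by simp
qed

lemma openin_agree_on_finite:
  assumes "finite F" "F \<subseteq> univ A" "x \<in> hom A M"
  shows "openin (hom_topology A M) {y \<in> hom A M. \<forall>a\<in>F. y a = x a}"
proof -
  have "{y \<in> hom A M. \<forall>a\<in>F. y a = x a} = {y \<in> univ A \<rightarrow>\<^sub>E univ M. \<forall>a\<in>F. y a = x a} \<inter> hom A M"
    by (auto simp: mem_hom_iff)
  moreover have "openin (product_topology (\<lambda>_. discrete_topology (univ M)) (univ A))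
      {y \<in> univ A \<rightarrow>\<^sub>E univ M. \<forall>a\<in>F. y a = x a}"
    using assms by (intro openin_product_agree_on_finite) (auto simp: mem_hom_iff)
  ultimately show ?thesis
    unfolding hom_topology_def openin_subtopology by blast
qed

lemma continuous_map_hom_topologyI:
  assumes "finite F" "F \<subseteq> univ A" "f \<in> hom A M \<rightarrow> univ M"
    and det: "\<And>x y. x \<in> hom A M \<Longrightarrow> y \<in> hom A M \<Longrightarrow> (\<And>a. a \<in> F \<Longrightarrow> y a = x a) \<Longrightarrow> f y = f x"
  shows "continuous_map (hom_topology A M) (discrete_topology (univ M)) f"
  unfolding continuous_map_def
proof (intro conjI allI impI)
  show "f \<in> topspace (hom_topology A M) \<rightarrow> topspace (discrete_topology (univ M))"
    using assms(3) by simp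
  fix U
  show "openin (hom_topology A M) {x \<in> topspace (hom_topology A M). f x \<in> U}"
  proof (subst openin_subopen, intro ballI)
    fix x assume x: "x \<in> {x \<in> topspace (hom_topology A M). f x \<in> U}"
    let ?V = "{y \<in> hom A M. \<forall>a\<in>F. y a = x a}"
    have "?V \<subseteq> {x \<in> topspace (hom_topology A M). f x \<in> U}"
    proof
      fix y assume y: "y \<in> ?V"
      then have "f y = f x" using x by (intro det) auto
      then show "y \<in> {x \<in> topspace (hom_topology A M). f x \<in> U}" using x y by simp
    qed
    then show
      "\<exists>T. openin (hom_topology A M) T \<and> x \<in> T \<and> T \<subseteq> {x \<in> topspace (hom_topology A M). f x \<in> U}"
      using openin_agree_on_finite[OF assms(1,2), of x M] x by (intro exI[of _ ?V]) auto
  qed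
qed

text \<open>A map that is not a homomorphism fails at some \<open>a\<close>, \<open>b\<close>, and
  all maps agreeing with it at \<open>a\<close>, \<open>b\<close> and their product fail as well; so
  the homomorphisms are closed in a compact product of finite discrete spaces.\<close>

lemma compact_space_hom_topology:
  assumes "finite (univ M)" "algebra A"
  shows "compact_space (hom_topology A M)"
proof -
  let ?P = "univ A \<rightarrow>\<^sub>E univ M"
  let ?X = "product_topology (\<lambda>_. discrete_topology (univ M)) (univ A)"
  have "openin ?X (?P - hom A M)"
  proof (subst openin_subopen, intro ballI)
    fix x assume x: "x \<in> ?P - hom A M"
    then obtain a b where ab: "a \<in> univ A" "b \<in> univ A" "x (a \<cdot>\<^bsub>A\<^esub> b) \<noteq> x a \<cdot>\<^bsub>M\<^esub> x b"
      by (auto simp: mem_hom_iff)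
    let ?F = "{a, b, a \<cdot>\<^bsub>A\<^esub> b}"
    let ?V = "{y \<in> ?P. \<forall>c\<in>?F. y c = x c}"
    have "openin ?X ?V"
      using x ab algebra_mult[OF assms(2)] by (intro openin_product_agree_on_finite) auto
    moreover have "?V \<subseteq> ?P - hom A M" using ab by (auto simp: mem_hom_iff)
    ultimately show "\<exists>T. openin ?X T \<and> x \<in> T \<and> T \<subseteq> ?P - hom A M"
      using x by (intro exI[of _ ?V]) auto
  qed
  moreover have "hom A M \<subseteq> ?P" by (auto simp: mem_hom_iff)
  ultimately have "closedin ?X (hom A M)" by (simp add: closedin_def)
  moreover have "compact_space ?X"
    using assms(1) by (simp add: compact_space_product_topology compact_space_discrete_topology)
  ultimately have "compactin ?X (hom A M)" by (rule closedin_compact_space[rotated])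
  then show ?thesis unfolding hom_topology_def by (rule compact_space_subtopology)
qed

text \<open>Around each \<open>x\<close> the map is constant on a neighbourhood given by agreement
  on a finite set \<open>G x\<close>. Finitely many such neighbourhoods cover, and the union of
  their sets \<open>G x\<close> works: agreement on it keeps two homomorphisms in a common
  neighbourhood.\<close>

lemma hom_finitely_determined:
  assumes "finite (univ M)" "algebra A"
    and cont: "continuous_map (hom_topology A M) (discrete_topology (univ M)) f"
  obtains F where "finite F" "F \<subseteq> univ A"
    "\<forall>x\<in>hom A M. \<forall>y\<in>hom A M. (\<forall>a\<in>F. x a = y a) \<longrightarrow> f x = f y"
proof -
  let ?V = "\<lambda>F x. {y \<in> hom A M. \<forall>a\<in>F. y a = x a}"
  have "\<exists>F. finite F \<and> F \<subseteq> univ A \<and> (\<forall>y\<in>?V F x. f y = f x)" if x: "x \<in> hom A M" for x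
  proof -
    have "f x \<in> univ M" using cont x by (auto simp: continuous_map_def)
    then have "openin (hom_topology A M) {y \<in> hom A M. f y \<in> {f x}}"
      using openin_continuous_map_preimage[OF cont, of "{f x}"] by simp
    then obtain U where U: "openin (product_topology (\<lambda>_. discrete_topology (univ M)) (univ A)) U"
      "{y \<in> hom A M. f y \<in> {f x}} = U \<inter> hom A M"
      by (auto simp: hom_topology_def openin_subtopology)
    then have "x \<in> U" using x by auto
    then obtain W where W: "finite {i \<in> univ A. W i \<noteq> univ M}" "x \<in> Pi\<^sub>E (univ A) W"
      "Pi\<^sub>E (univ A) W \<subseteq> U"
      using U(1) unfolding openin_product_topology_alt by auto
    have "f y = f x" if y: "y \<in> ?V {i \<in> univ A. W i \<noteq> univ M} x" for y
    proof -
      have "y i \<in> W i" if "i \<in> univ A" for i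
      proof (cases "W i = univ M")
        case True
        then show ?thesis using y that by (auto simp: mem_hom_iff)
      next
        case False
        then have "y i = x i" using y that by auto
        then show ?thesis using W(2) that by auto
      qed
      then have "y \<in> Pi\<^sub>E (univ A) W" using y by (auto simp: mem_hom_iff PiE_iff)
      then have "y \<in> {y \<in> hom A M. f y \<in> {f x}}" unfolding U(2) using W(3) y by auto
      then show ?thesis by simp
    qed
    then show ?thesis using W(1) by (intro exI[of _ "{i \<in> univ A. W i \<noteq> univ M}"]) auto
  qed
  then have "\<forall>x\<in>hom A M. \<exists>F. finite F \<and> F \<subseteq> univ A \<and> (\<forall>y\<in>?V F x. f y = f x)" by blast
  from bchoice[OF this] obtain G where
    "\<forall>x\<in>hom A M. finite (G x) \<and> G x \<subseteq> univ A \<and> (\<forall>y\<in>?V (G x) x. f y = f x)" by blast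
  then have G: "\<And>x. x \<in> hom A M \<Longrightarrow> finite (G x)" "\<And>x. x \<in> hom A M \<Longrightarrow> G x \<subseteq> univ A"
    "\<And>x y. x \<in> hom A M \<Longrightarrow> y \<in> ?V (G x) x \<Longrightarrow> f y = f x" by blast+
  let ?\<U> = "(\<lambda>x. ?V (G x) x) ` hom A M"
  have op: "\<forall>U\<in>?\<U>. openin (hom_topology A M) U"
  proof
    fix U assume "U \<in> ?\<U>"
    then obtain x where "x \<in> hom A M" "U = ?V (G x) x" by (elim imageE) simp
    then show "openin (hom_topology A M) U" using openin_agree_on_finite[OF G(1,2)] by simp
  qed
  have cov: "topspace (hom_topology A M) \<subseteq> \<Union>?\<U>" by auto
  have "\<exists>\<F>. finite \<F> \<and> \<F> \<subseteq> ?\<U> \<and> topspace (hom_topology A M) \<subseteq> \<Union>\<F>"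
    by (rule compact_space_hom_topology[OF assms(1,2), unfolded compact_space_alt,
          THEN spec, THEN mp, OF conjI[OF op cov]])
  then obtain \<F> where \<F>: "finite \<F>" "\<F> \<subseteq> ?\<U>" "hom A M \<subseteq> \<Union>\<F>"
    unfolding topspace_hom_topology by blast
  then obtain H where H: "H \<subseteq> hom A M" "finite H" "\<F> = (\<lambda>x. ?V (G x) x) ` H"
    by (meson finite_subset_image)
  let ?F = "\<Union>x\<in>H. G x"
  show ?thesis
  proof (rule that[of ?F])
    show "finite ?F" "?F \<subseteq> univ A" using H G(1,2) by blast+
    show "\<forall>x\<in>hom A M. \<forall>y\<in>hom A M. (\<forall>a\<in>?F. x a = y a) \<longrightarrow> f x = f y"
    proof (intro ballI impI)
      fix x y assume xy: "x \<in> hom A M" "y \<in> hom A M" "\<forall>a\<in>?F. x a = y a"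
      obtain u where u: "u \<in> H" "x \<in> ?V (G u) u" using \<F>(3) H(3) xy(1) by blast
      then have "y \<in> ?V (G u) u" using xy(2,3) by force
      then show "f x = f y" using G(3)[of u x] G(3)[of u y] u H(1) by auto
    qed
  qed
qed

section \<open>Separation by homomorphisms and local evaluations\<close>

lemma in_ISP_algebra: "in_ISP A M \<Longrightarrow> algebra A"
  by (auto simp: in_ISP_def)

text \<open>The coordinates of an embedding into a power are homomorphisms to
  \<open>M\<close>.\<close>

lemma in_ISP_separating:
  fixes A :: "'b magma" and M :: "'a magma"
  assumes "in_ISP A M" "a \<in> univ A" "b \<in> univ A" and eq: "\<And>x. x \<in> hom A M \<Longrightarrow> x a = x b"
  shows "a = b"
proof -
  obtain I :: "('b \<Rightarrow> 'a) set" and B h where B: "subuniverse (power_alg M I) B"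
    and h: "h \<in> hom A ((power_alg M I)\<lparr>univ := B\<rparr>)" "bij_betw h (univ A) B"
    using assms(1) unfolding in_ISP_def isomorphic_def by (elim conjE exE bexE) simp
  have alg: "algebra A" using assms(1) by (rule in_ISP_algebra)
  have hB: "h c \<in> I \<rightarrow>\<^sub>E univ M" if "c \<in> univ A" for c
    using h(1) B that by (auto simp: mem_hom_iff subuniverse_def power_alg_def)
  have "h a i = h b i" if i: "i \<in> I" for i
  proof -
    have "(\<lambda>c\<in>univ A. h c i) \<in> hom A M"
      using h(1) i hB algebra_mult[OF alg] by (auto simp: mem_hom_iff power_alg_def)
    from eq[OF this] show ?thesis using assms(2,3) by simp
  qed
  then have "h a = h b" using hB assms(2,3) by (meson PiE_ext)
  then show ?thesis using h(2) assms(2,3) by (auto simp: bij_betw_def dest: inj_onD)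
qed

text \<open>The tuples of values on \<open>X\<close> of all elements of \<open>A\<close> form a
  compatible relation, and preserving this one relation already says that the values of
  \<open>f\<close> on \<open>X\<close> come from an element. \<open>X\<close> must be nonempty
  because relations have positive arity.\<close>

lemma preserves_imp_locally_evaluation:
  assumes pres: "\<And>k R. k \<ge> 1 \<Longrightarrow> compatible_relation M k R \<Longrightarrow> preserves A M k R f"
    and A: "algebra A" and X: "finite X" "X \<subseteq> hom A M" "X \<noteq> {}"
  shows "\<exists>a\<in>univ A. \<forall>x\<in>X. f x = x a"
proof -
  obtain k and x :: "nat \<Rightarrow> _" where x: "X = x ` {..<k}"
    using finite_imp_nat_seg_image_inj_on[OF X(1)] by (auto simp: lessThan_def)
  define R where "R = (\<lambda>a. \<lambda>i\<in>{..<k}. x i a) ` univ A"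
  have xh: "x i \<in> hom A M" if "i < k" for i using x X(2) that by auto
  have mult: "(\<lambda>i\<in>{..<k}. x i (a \<cdot>\<^bsub>A\<^esub> b)) = (\<lambda>i\<in>{..<k}. x i a \<cdot>\<^bsub>M\<^esub> x i b)"
    if "a \<in> univ A" "b \<in> univ A" for a b
    using xh that by (auto simp: mem_hom_iff fun_eq_iff restrict_def)
  have "compatible_relation M k R"
    unfolding compatible_relation_def subuniverse_def
  proof (intro conjI ballI)
    show "R \<subseteq> univ (power_alg M {..<k})"
    proof
      fix u assume "u \<in> R"
      then obtain a where a: "a \<in> univ A" "u = (\<lambda>i\<in>{..<k}. x i a)" by (auto simp: R_def)
      have "x i a \<in> univ M" if "i < k" for i using xh[OF that] a(1) by (auto simp: mem_hom_iff)
      then show "u \<in> univ (power_alg M {..<k})" by (simp add: a(2) power_alg_def)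
    qed
    fix u v assume "u \<in> R" "v \<in> R"
    then obtain a b where ab: "a \<in> univ A" "b \<in> univ A"
      and uv: "u = (\<lambda>i\<in>{..<k}. x i a)" "v = (\<lambda>i\<in>{..<k}. x i b)" by (auto simp: R_def)
    have "u \<cdot>\<^bsub>power_alg M {..<k}\<^esub> v = (\<lambda>i\<in>{..<k}. x i (a \<cdot>\<^bsub>A\<^esub> b))"
      unfolding mult[OF ab] uv power_alg_def by (auto simp: fun_eq_iff)
    then show "u \<cdot>\<^bsub>power_alg M {..<k}\<^esub> v \<in> R" using algebra_mult[OF A ab] by (simp add: R_def)
  qed
  moreover have "k \<ge> 1" using x X(3) by (cases k) auto
  ultimately have "preserves A M k R f" using pres by blast
  then have "(\<lambda>i\<in>{..<k}. f (x i)) \<in> R"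
    unfolding preserves_def using xh by (auto simp: R_def)
  then obtain a where a: "a \<in> univ A" "(\<lambda>i\<in>{..<k}. f (x i)) = (\<lambda>i\<in>{..<k}. x i a)"
    by (auto simp: R_def)
  have "f (x i) = x i a" if "i < k" for i
    using fun_cong[OF a(2), of i] that by simp
  then show ?thesis using a(1) x by auto
qed

text \<open>If every candidate in \<open>E\<close> failed at some homomorphism, these finitely many
  failures could be added to \<open>X\<close>, contradicting the local evaluation.\<close>

lemma evaluation_if_finite_candidates:
  assumes "C \<subseteq> univ A" and loc: "\<And>X. finite X \<Longrightarrow> X \<subseteq> hom A M \<Longrightarrow> \<exists>a\<in>C. \<forall>x\<in>X. f x = x a"
    and X: "finite X" "X \<subseteq> hom A M" and E: "finite E" "\<And>a. a \<in> C \<Longrightarrow> \<forall>x\<in>X. f x = x a \<Longrightarrow> a \<in> E"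
  shows "is_evaluation A M f"
proof (rule ccontr)
  assume "\<not> is_evaluation A M f"
  then have "\<forall>a\<in>C. \<exists>x\<in>hom A M. f x \<noteq> x a" using assms(1) unfolding is_evaluation_def by blast
  then obtain y where y: "\<And>a. a \<in> C \<Longrightarrow> y a \<in> hom A M \<and> f (y a) \<noteq> y a a" by metis
  obtain a where "a \<in> C" "\<forall>x\<in>X \<union> y ` (E \<inter> C). f x = x a"
    using loc[of "X \<union> y ` (E \<inter> C)"] X E(1) y by auto
  then show False using E(2)[of a] y[of a] by auto
qed

section \<open>Ghost elements\<close>

definition eventually_constant :: "(nat \<Rightarrow> 'a) \<Rightarrow> bool" where
  "eventually_constant x \<longleftrightarrow> (\<exists>n c. \<forall>i\<ge>n. x i = c)"

lemma eventually_constant_const [simp]: "eventually_constant (\<lambda>_. c)"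
  by (auto simp: eventually_constant_def)

lemma eventually_constant_upd [simp]:
  assumes "eventually_constant x"
  shows "eventually_constant (x(n := c))"
proof -
  obtain m d where "\<And>i. i \<ge> m \<Longrightarrow> x i = d" using assms by (auto simp: eventually_constant_def)
  then have "\<forall>i\<ge>max m (Suc n). (x(n := c)) i = d" by auto
  then show ?thesis unfolding eventually_constant_def by blast
qed

lemma eventually_constant_map2:
  assumes "eventually_constant x" "eventually_constant y"
  shows "eventually_constant (\<lambda>i. h (x i) (y i))"
proof -
  obtain m c n d where "\<And>i. i \<ge> m \<Longrightarrow> x i = c" "\<And>i. i \<ge> n \<Longrightarrow> y i = d"
    using assms unfolding eventually_constant_def by blast
  then have "\<forall>i\<ge>max m n. h (x i) (y i) = h c d" by simp
  then show ?thesis unfolding eventually_constant_def by blast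
qed

text \<open>Countability allows an algebra of such sequences to be copied into any infinite
  type.\<close>

lemma countable_eventually_constant:
  assumes "finite X"
  shows "countable {x. (\<forall>i. x i \<in> X) \<and> eventually_constant x}"
proof (rule countable_subset)
  let ?g = "\<lambda>(l, c) i. if i < length l then l ! i else c"
  show "countable (?g ` (lists X \<times> X))"
    using assms
      by (intro countable_image countable_SIGMA countable_lists) (auto intro: countable_finite)
  show "{x. (\<forall>i. x i \<in> X) \<and> eventually_constant x} \<subseteq> ?g ` (lists X \<times> X)"
  proof
    fix x assume "x \<in> {x. (\<forall>i. x i \<in> X) \<and> eventually_constant x}"
    then obtain n c where x: "\<And>i. x i \<in> X" "\<And>i. i \<ge> n \<Longrightarrow> x i = c"
      by (auto simp: eventually_constant_def)
    have "c \<in> X" using x(1)[of n] x(2)[of n] by simp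
    moreover have "x = ?g (map x [0..<n], c)" using x(2) by (auto simp: fun_eq_iff)
    ultimately show "x \<in> ?g ` (lists X \<times> X)"
      using x(1) by (intro image_eqI[of _ _ "(map x [0..<n], c)"]) auto
  qed
qed

text \<open>The ghost element method: the common value that a homomorphism takes at almost all \<open>w n\<close>
  depends continuously on the homomorphism and agrees with an evaluation at some \<open>w n\<close> on any
  finite set of homomorphisms, but it could only be the evaluation at the missing element \<open>g\<close>.
  The last hypothesis says that no two different values are both taken twice; since \<open>M\<close> is finite,
  this gives a common value with at most \<open>card (univ M)\<close> exceptions.\<close>

lemma ghost_element:
  fixes M :: "'a magma" and B :: "(nat \<Rightarrow> 'a) set" and w :: "nat \<Rightarrow> nat \<Rightarrow> 'a"
  assumes fin: "finite (univ M)" and inf: "infinite (UNIV :: 'b set)"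
    and B: "\<And>x. x \<in> B \<Longrightarrow> (\<forall>i. x i \<in> univ M) \<and> eventually_constant x"
    and closed: "\<And>x y. x \<in> B \<Longrightarrow> y \<in> B \<Longrightarrow> (\<lambda>i. x i \<cdot>\<^bsub>M\<^esub> y i) \<in> B"
    and w: "\<And>n. w n \<in> B" and g: "g \<notin> B" and lim: "\<And>i. finite {n. w n i \<noteq> g i}"
    and homs: "\<And>\<phi> n n' m m'. (\<And>x. x \<in> B \<Longrightarrow> \<phi> x \<in> univ M) \<Longrightarrow>
      (\<And>x y. x \<in> B \<Longrightarrow> y \<in> B \<Longrightarrow> \<phi> (\<lambda>i. x i \<cdot>\<^bsub>M\<^esub> y i) = \<phi> x \<cdot>\<^bsub>M\<^esub> \<phi> y) \<Longrightarrow>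
      n \<noteq> n' \<Longrightarrow> m \<noteq> m' \<Longrightarrow> \<phi> (w n) = \<phi> (w n') \<Longrightarrow> \<phi> (w m) = \<phi> (w m') \<Longrightarrow> \<phi> (w n) = \<phi> (w m)"
  shows "\<not> dualizable TYPE('b) M"
proof -
  have "countable B"
    using B by (intro countable_subset[OF _ countable_eventually_constant[OF fin]]) auto
  then have "inj_on (to_nat_on B) B" by (rule inj_on_to_nat_on)
  moreover obtain j :: "nat \<Rightarrow> 'b" where "inj j"
    using inf infinite_countable_subset by blast
  ultimately have "inj_on (j \<circ> to_nat_on B) B"
    by (meson comp_inj_on inj_on_subset subset_UNIV)
  then obtain e :: "_ \<Rightarrow> 'b" where e: "inj_on e B" by blast
  define d where "d = inv_into B e"
  have de [simp]: "d (e x) = x" if "x \<in> B" for x using e that by (simp add: d_def)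
  have dB [simp]: "d a \<in> B" if "a \<in> e ` B" for a using that by auto
  define A where "A = \<lparr>univ = e ` B, mult = (\<lambda>a b. e (\<lambda>i. d a i \<cdot>\<^bsub>M\<^esub> d b i))\<rparr>"
  have uA: "univ A = e ` B" and mA: "\<And>a b. a \<cdot>\<^bsub>A\<^esub> b = e (\<lambda>i. d a i \<cdot>\<^bsub>M\<^esub> d b i)"
    by (simp_all add: A_def)
  have mAe: "e x \<cdot>\<^bsub>A\<^esub> e y = e (\<lambda>i. x i \<cdot>\<^bsub>M\<^esub> y i)" if "x \<in> B" "y \<in> B" for x y
    using that by (simp add: mA)
  have algA: "algebra A"
    unfolding algebra_def subuniverse_def uA using closed by (auto simp: mAe)
  have ISP: "in_ISP A M"
  proof (rule in_ISP_arbitrary_index[OF algA, of _ "UNIV :: nat set"])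
    have "(\<lambda>a\<in>univ A. d a) \<in> hom A (power_alg M UNIV)"
      unfolding mem_hom_iff uA using B closed by (auto simp: mAe power_alg_def)
    moreover have "inj_on (\<lambda>a\<in>univ A. d a) (univ A)" unfolding uA by (auto intro!: inj_onI)
    ultimately show "embeds A (power_alg M (UNIV :: nat set))" unfolding embeds_def by blast
  qed
  have homw: "x (e (w n)) = x (e (w m))"
    if x: "x \<in> hom A M" and "n \<noteq> n'" "m \<noteq> m'"
      and "x (e (w n)) = x (e (w n'))" "x (e (w m)) = x (e (w m'))" for x n n' m m'
  proof (rule homs[of "\<lambda>y. x (e y)", OF _ _ that(2-)])
    show "\<And>y. y \<in> B \<Longrightarrow> x (e y) \<in> univ M" using x by (auto simp: mem_hom_iff uA)
    show "\<And>y y'. y \<in> B \<Longrightarrow> y' \<in> B \<Longrightarrow> x (e (\<lambda>i. y i \<cdot>\<^bsub>M\<^esub> y' i)) = x (e y) \<cdot>\<^bsub>M\<^esub> x (e y')"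
      using x by (simp add: mem_hom_iff uA mAe flip: mAe)
  qed
  have xw: "x (e (w n)) \<in> univ M" if "x \<in> hom A M" for x n
    using that w by (auto simp: mem_hom_iff uA)
  \<comment> \<open>Among \<open>w 0, ..., w K\<close> some value repeats, as there are more indices
    than values; by \<open>homw\<close> it is the only repeated one. Looking at these indices only
    makes \<open>f\<close> continuous.\<close>
  define K where "K = card (univ M)"
  define f :: "('b \<Rightarrow> 'a) \<Rightarrow> 'a" where
    "f = (\<lambda>x. SOME c. \<exists>n\<le>K. \<exists>m\<le>K. n \<noteq> m \<and> x (e (w n)) = c \<and> x (e (w m)) = c)"
  have f: "\<exists>n\<le>K. \<exists>m\<le>K. n \<noteq> m \<and> x (e (w n)) = f x \<and> x (e (w m)) = f x" if "x \<in> hom A M" for x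
  proof -
    have "\<not> inj_on (\<lambda>n. x (e (w n))) {..K}"
    proof
      assume "inj_on (\<lambda>n. x (e (w n))) {..K}"
      then have "card {..K} \<le> card (univ M)"
        using xw[OF that] fin by (intro card_inj_on_le) auto
      then show False by (simp add: K_def)
    qed
    then have "\<exists>c. \<exists>n\<le>K. \<exists>m\<le>K. n \<noteq> m \<and> x (e (w n)) = c \<and> x (e (w m)) = c"
      unfolding inj_on_def by auto
    then show ?thesis unfolding f_def by (rule someI_ex)
  qed
  have f_eq: "f x = x (e (w n))" if x: "x \<in> hom A M" "n \<noteq> m" "x (e (w n)) = x (e (w m))" for x n m
  proof -
    obtain a b where ab: "a \<noteq> b" "x (e (w a)) = f x" "x (e (w b)) = f x" using f[OF x(1)] by blast
    have "x (e (w a)) = x (e (w n))"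
      by (rule homw[OF x(1) ab(1) x(2)]) (use ab x(3) in simp_all)
    then show ?thesis using ab by simp
  qed
  \<comment> \<open>The values different from \<open>f x\<close> are pairwise distinct, so the
    finite universe bounds their number.\<close>
  have cofin: "finite {n. x (e (w n)) \<noteq> f x}" if x: "x \<in> hom A M" for x
  proof (rule inj_on_finite[OF _ _ fin])
    show "inj_on (\<lambda>n. x (e (w n))) {n. x (e (w n)) \<noteq> f x}"
      by (rule inj_onI, rule ccontr) (use f_eq[OF x] in auto)
    show "(\<lambda>n. x (e (w n))) ` {n. x (e (w n)) \<noteq> f x} \<subseteq> univ M" using xw[OF x] by auto
  qed
  have fM: "f x \<in> univ M" if x: "x \<in> hom A M" for x
  proof -
    obtain n where "x (e (w n)) = f x" using f[OF x] by blast
    then show ?thesis using xw[OF x, of n] by simp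
  qed
  have "continuous_map (hom_topology A M) (discrete_topology (univ M)) f"
  proof (rule continuous_map_hom_topologyI[of "(\<lambda>n. e (w n)) ` {..K}"])
    show "(\<lambda>n. e (w n)) ` {..K} \<subseteq> univ A" using w by (auto simp: uA)
    fix x y :: "'b \<Rightarrow> 'a" assume "\<And>a. a \<in> (\<lambda>n. e (w n)) ` {..K} \<Longrightarrow> y a = x a"
    then have "y (e (w n)) = x (e (w n))" if "n \<le> K" for n using that by auto
    then show "f y = f x" unfolding f_def by (simp cong: conj_cong)
  qed (use fM in auto)
  moreover have "preserves A M k R f" if "k \<ge> 1" for k R
    unfolding preserves_def
  proof (intro allI impI)
    fix x assume x: "(\<forall>i<k. x i \<in> hom A M) \<and> (\<forall>a\<in>univ A. (\<lambda>i\<in>{..<k}. x i a) \<in> R)"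
    have "finite (\<Union>i<k. {n. x i (e (w n)) \<noteq> f (x i)})" using cofin x by auto
    then obtain n where "n \<notin> (\<Union>i<k. {n. x i (e (w n)) \<noteq> f (x i)})"
      using ex_new_if_finite[OF infinite_UNIV_nat] by blast
    then have "(\<lambda>i\<in>{..<k}. f (x i)) = (\<lambda>i\<in>{..<k}. x i (e (w n)))" by (auto simp: fun_eq_iff)
    then show "(\<lambda>i\<in>{..<k}. f (x i)) \<in> R" using x w by (auto simp: uA)
  qed
  moreover have "\<not> is_evaluation A M f"
  proof
    assume "is_evaluation A M f"
    then obtain b where b: "b \<in> B" "\<And>x. x \<in> hom A M \<Longrightarrow> f x = x (e b)"
      by (auto simp: is_evaluation_def uA)
    \<comment> \<open>The projection to coordinate \<open>i\<close> is a homomorphism, and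
      \<open>f\<close> takes on it the eventual value of \<open>w n i\<close>, which is
      \<open>g i\<close>.\<close>
    have "b i = g i" for i
    proof -
      let ?p = "\<lambda>a\<in>univ A. d a i"
      have p: "?p \<in> hom A M" unfolding mem_hom_iff uA using B closed by (auto simp: mAe)
      have "finite ({n. ?p (e (w n)) \<noteq> f ?p} \<union> {n. w n i \<noteq> g i})" using cofin[OF p] lim by simp
      then obtain n where "n \<notin> {n. ?p (e (w n)) \<noteq> f ?p} \<union> {n. w n i \<noteq> g i}"
        using ex_new_if_finite[OF infinite_UNIV_nat] by blast
      then show "b i = g i" using b(2)[OF p] w b(1) by (simp add: uA)
    qed
    then show False using b(1) g by (metis ext)
  qed
  ultimately show ?thesis unfolding dualizable_def using ISP by blast
qed

section \<open>Non-dualizable two-state automatic algebras\<close>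

text \<open>The transition maps are left out: all that is used is that a nonzero product is a state
  obtained from a state and a letter.\<close>

locale two_state =
  fixes M :: "'a magma" and Q \<Sigma> :: "'a set" and z :: 'a
  assumes univ_eq: "univ M = Q \<union> \<Sigma> \<union> {z}" and finite_univ: "finite (univ M)"
    and card_Q: "card Q = 2" and disjoint: "Q \<inter> \<Sigma> = {}" and zero_fresh: "z \<notin> Q \<union> \<Sigma>"
    and mult_nonzero: "x \<cdot>\<^bsub>M\<^esub> y \<noteq> z \<Longrightarrow> x \<in> Q \<and> y \<in> \<Sigma> \<and> x \<cdot>\<^bsub>M\<^esub> y \<in> Q"
begin

abbreviation mult_M (infixl "\<odot>" 70) where "x \<odot> y \<equiv> x \<cdot>\<^bsub>M\<^esub> y"

lemma mult_in_univ [simp]: "x \<odot> y \<in> univ M"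
  using mult_nonzero[of x y] by (auto simp: univ_eq)

lemma mult_zero [simp]: "z \<odot> y = z" "x \<odot> z = z"
  using mult_nonzero[of z y] mult_nonzero[of x z] zero_fresh by auto

lemma mult_self [simp]: "x \<odot> x = z"
  using mult_nonzero[of x x] disjoint by auto

lemma mult_not_letter: "x \<odot> y \<notin> \<Sigma>"
  using mult_nonzero[of x y] disjoint zero_fresh by auto

lemma mult_state_iff: "x \<odot> y \<in> Q \<longleftrightarrow> x \<odot> y \<noteq> z"
  using mult_nonzero[of x y] zero_fresh by auto

text \<open>The invariants \<open>S\<close> of the sequences of states and \<open>L\<close> of the sequences of letters
  serve to keep the ghost element out of the subalgebra.\<close>

definition seq_alg :: "nat set \<Rightarrow> ((nat \<Rightarrow> 'a) \<Rightarrow> bool) \<Rightarrow> ((nat \<Rightarrow> 'a) \<Rightarrow> bool) \<Rightarrow> (nat \<Rightarrow> 'a) set" where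
  "seq_alg J S L = {x. (\<forall>i. x i \<in> univ M) \<and> eventually_constant x \<and>
     ((\<forall>i\<in>J. x i \<in> Q) \<longrightarrow> S x) \<and> ((\<forall>i\<in>J. x i \<in> \<Sigma>) \<longrightarrow> L x)}"

text \<open>A product is never a letter, so with \<open>J\<close> nonempty the condition
  \<open>L\<close> on products is void; and a product that is a state throughout \<open>J\<close>
  has a state and a letter as factors there, so \<open>S\<close> need only be checked in that case.
  Two different values are not both \<open>z\<close>, hence by symmetry \<phi> may be assumed
  nonzero at \<open>w m\<close>.\<close>

lemma ghost_state:
  fixes w :: "nat \<Rightarrow> nat \<Rightarrow> 'a"
  assumes inf: "infinite (UNIV :: 'b set)" and J: "J \<noteq> {}"
    and closed: "\<And>x y. S x \<Longrightarrow> L y \<Longrightarrow> \<forall>i\<in>J. x i \<in> Q \<Longrightarrow> \<forall>i\<in>J. y i \<in> \<Sigma> \<Longrightarrow>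
      \<forall>i\<in>J. x i \<odot> y i \<in> Q \<Longrightarrow> S (\<lambda>i. x i \<odot> y i)"
    and w: "\<And>n. w n \<in> seq_alg J S L" and g: "\<And>i. i \<in> J \<Longrightarrow> g i \<in> Q" "\<not> S g"
    and lim: "\<And>i. finite {n. w n i \<noteq> g i}"
    and homs: "\<And>\<phi> n n' m m'.
      (\<And>x y. x \<in> seq_alg J S L \<Longrightarrow> y \<in> seq_alg J S L \<Longrightarrow>
        (\<lambda>i. x i \<odot> y i) \<in> seq_alg J S L \<and> \<phi> (\<lambda>i. x i \<odot> y i) = \<phi> x \<odot> \<phi> y) \<Longrightarrow>
      n \<noteq> n' \<Longrightarrow> m \<noteq> m' \<Longrightarrow> \<phi> (w n) = \<phi> (w n') \<Longrightarrow> \<phi> (w m) = \<phi> (w m') \<Longrightarrow> \<phi> (w m) \<noteq> z \<Longrightarrow>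
      \<phi> (w n) \<noteq> \<phi> (w m) \<Longrightarrow> False"
  shows "\<not> dualizable TYPE('b) M"
proof -
  have mult: "(\<lambda>i. x i \<odot> y i) \<in> seq_alg J S L" if xy: "x \<in> seq_alg J S L" "y \<in> seq_alg J S L"
    for x y
    unfolding seq_alg_def
  proof (intro CollectI conjI impI allI)
    show "eventually_constant (\<lambda>i. x i \<odot> y i)"
      by (rule eventually_constant_map2) (use xy in \<open>auto simp: seq_alg_def\<close>)
    show "L (\<lambda>i. x i \<odot> y i)" if "\<forall>i\<in>J. x i \<odot> y i \<in> \<Sigma>"
      using that J mult_not_letter by blast
    show "S (\<lambda>i. x i \<odot> y i)" if *: "\<forall>i\<in>J. x i \<odot> y i \<in> Q"
    proof -
      have "x i \<in> Q \<and> y i \<in> \<Sigma>" if "i \<in> J" for i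
        using * that mult_nonzero[of "x i" "y i"] mult_state_iff[of "x i" "y i"] by simp
      then have "\<forall>i\<in>J. x i \<in> Q" "\<forall>i\<in>J. y i \<in> \<Sigma>" by simp_all
      then show ?thesis using xy * by (intro closed) (auto simp: seq_alg_def)
    qed
  qed simp
  show ?thesis
  proof (rule ghost_element[OF finite_univ inf, of "seq_alg J S L" w g, OF _ mult])
    fix \<phi> :: "(nat \<Rightarrow> 'a) \<Rightarrow> 'a" and n n' m m'
    assume *: "\<And>x y. x \<in> seq_alg J S L \<Longrightarrow> y \<in> seq_alg J S L \<Longrightarrow> \<phi> (\<lambda>i. x i \<odot> y i) = \<phi> x \<odot> \<phi> y"
      "n \<noteq> n'" "m \<noteq> m'" "\<phi> (w n) = \<phi> (w n')" "\<phi> (w m) = \<phi> (w m')"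
    show "\<phi> (w n) = \<phi> (w m)"
    proof (rule ccontr)
      assume "\<phi> (w n) \<noteq> \<phi> (w m)"
      moreover have False if "\<phi> (w m) \<noteq> z"
        by (rule homs[of \<phi> n n' m m'])
          (use \<open>\<phi> (w n) \<noteq> \<phi> (w m)\<close> * that in \<open>simp_all add: mult\<close>)
      moreover have False if "\<phi> (w n) \<noteq> z"
        by (rule homs[of \<phi> m m' n n'])
          (use \<open>\<phi> (w n) \<noteq> \<phi> (w m)\<close> * that in \<open>simp_all add: mult\<close>)
      ultimately show False by metis
    qed
  qed (use w g lim in \<open>auto simp: seq_alg_def\<close>)
qed

section \<open>The ghost elements of the six automata\<close>

lemma two_states_eq: "x \<in> Q \<Longrightarrow> y \<in> Q \<Longrightarrow> t \<in> Q \<Longrightarrow> x \<noteq> t \<Longrightarrow> y \<noteq> t \<Longrightarrow> x = y"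
  using card_Q by (auto simp: card_2_iff)

lemma state_props: "x \<in> Q \<Longrightarrow> x \<in> univ M \<and> x \<notin> \<Sigma> \<and> x \<noteq> z"
  "a \<in> \<Sigma> \<Longrightarrow> a \<in> univ M \<and> a \<notin> Q \<and> a \<noteq> z"
  "z \<in> univ M \<and> z \<notin> Q \<and> z \<notin> \<Sigma>"
  using zero_fresh disjoint unfolding univ_eq by auto

text \<open>In all coordinates but \<open>0\<close> the elements \<open>w n\<close> below tend to \<open>z\<close>; coordinate \<open>0\<close>
  distinguishes the ghost element from zero.\<close>

lemma not_dualizable_N0:
  assumes inf: "infinite (UNIV :: 'b set)" and Q: "Q = {q, r}" "q \<noteq> r" and ab: "a \<in> \<Sigma>"
    and a: "q \<odot> a = r" "r \<odot> a = z"
  shows "\<not> dualizable TYPE('b) M"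
proof -
  \<comment> \<open>A letter sequence satisfying \<open>L\<close> may spoil one coordinate other
    than \<open>0\<close>. Of two coordinates with \<open>q\<close> at least one survives and
    becomes the \<open>r\<close> that the second clause demands; the ghost element has no such
    \<open>r\<close>.\<close>
  define S where "S = (\<lambda>x::nat\<Rightarrow>'a.
    (x 0 = q \<longrightarrow> (\<exists>i j. i \<noteq> j \<and> x (Suc i) = q \<and> x (Suc j) = q)) \<and>
    (x 0 = r \<longrightarrow> (\<exists>i. x (Suc i) = r)))"
  define L where "L = (\<lambda>y::nat\<Rightarrow>'a. y 0 = a \<and> (\<exists>k. \<forall>i. i \<noteq> k \<longrightarrow> y (Suc i) = a))"
  let ?B = "seq_alg {0} S L"
  define u where "u n m = (\<lambda>_. z)(0 := q, Suc n := q, Suc m := q)" for n m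
  define v where "v m = (\<lambda>_. a)(Suc m := z)" for m
  define w where "w n = (\<lambda>_. z)(0 := r, Suc n := r)" for n
  have qr: "q \<in> Q" "r \<in> Q" using Q by auto
  note mem = state_props(1)[OF qr(1)] state_props(1)[OF qr(2)] state_props(3) qr
    state_props(2)[OF ab] ab
  have u: "u n m \<in> ?B" if "n \<noteq> m" for n m
    using mem that Q(2) by (auto simp: seq_alg_def u_def S_def)
  have v: "v m \<in> ?B" for m using mem by (auto simp: seq_alg_def v_def L_def)
  have w: "w n \<in> ?B" for n using mem Q(2) by (auto simp: seq_alg_def w_def S_def)
  show ?thesis
  proof (rule ghost_state[OF inf, of "{0}" S L w "(\<lambda>_. z)(0 := r)"])
    show "S (\<lambda>i. x i \<odot> y i)"
      if sl: "S x" "L y"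
        "\<forall>i\<in>{0}. x i \<in> Q" "\<forall>i\<in>{0}. y i \<in> \<Sigma>" "\<forall>i\<in>{0}. x i \<odot> y i \<in> Q"
      for x y
    proof -
      obtain k where k: "y 0 = a" "\<And>i. i \<noteq> k \<Longrightarrow> y (Suc i) = a" using sl(2) by (auto simp: L_def)
      then have "x 0 = q" using sl(3,5) Q a mem by auto
      then obtain i j where ij: "i \<noteq> j" "x (Suc i) = q" "x (Suc j) = q"
        using sl(1) by (auto simp: S_def)
      then have "x (Suc i) \<odot> y (Suc i) = r \<or> x (Suc j) \<odot> y (Suc j) = r"
        using k(2) a by (cases "i = k") auto
      then show ?thesis using \<open>x 0 = q\<close> k(1) a Q(2) by (auto simp: S_def)
    qed
    show "\<not> S ((\<lambda>_. z)(0 := r))" using Q(2) mem by (auto simp: S_def)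
    show "finite {n. w n i \<noteq> ((\<lambda>_. z)(0 := r)) i}" for i
      by (rule finite_subset[of _ "{i - 1}"]) (auto simp: w_def)
    fix \<phi> n n' m m'
    assume h0: "\<And>x y. x \<in> ?B \<Longrightarrow> y \<in> ?B \<Longrightarrow>
        (\<lambda>i. x i \<odot> y i) \<in> ?B \<and> \<phi> (\<lambda>i. x i \<odot> y i) = \<phi> x \<odot> \<phi> y"
      and nm: "n \<noteq> n'" "m \<noteq> m'" "\<phi> (w n) = \<phi> (w n')" "\<phi> (w m) = \<phi> (w m')"
        "\<phi> (w m) \<noteq> z" "\<phi> (w n) \<noteq> \<phi> (w m)"
    have h: "\<phi> (\<lambda>i. x i \<odot> y i) = \<phi> x \<odot> \<phi> y" if "x \<in> ?B" "y \<in> ?B" for x y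
      using h0[OF that] by simp
    have ne: "n \<noteq> m" "n \<noteq> m'" "n' \<noteq> m" "n' \<noteq> m'" using nm by auto
    have uv1: "\<phi> (u i j) \<odot> \<phi> (v j) = \<phi> (w i)" if "i \<noteq> j" for i j
    proof -
      have "(\<lambda>k. u i j k \<odot> v j k) = w i"
        using that a Q(2) by (auto simp: fun_eq_iff u_def v_def w_def)
      then show ?thesis using h[OF u[OF that] v] by metis
    qed
    have uv2: "\<phi> (u i j) \<odot> \<phi> (v i) = \<phi> (w j)" if "i \<noteq> j" for i j
    proof -
      have "(\<lambda>k. u i j k \<odot> v i k) = w j"
        using that a Q(2) by (auto simp: fun_eq_iff u_def v_def w_def)
      then show ?thesis using h[OF u[OF that] v] by metis
    qed
    \<comment> \<open>The zero sequence is a square, so every homomorphism maps it to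
      \<open>z\<close>. Consequently a state that some \<open>v k\<close> maps to a nonzero value is
      not a value at any \<open>w i\<close>.\<close>
    have wv: "\<phi> (w i) \<odot> \<phi> (v k) = z" for i k
    proof -
      have "(\<lambda>s. w i s \<odot> v k s) = (\<lambda>s. w i s \<odot> w i s)"
        using a by (auto simp: fun_eq_iff w_def v_def)
      then show ?thesis using h[OF w v] h[OF w w] by (metis mult_self)
    qed
    let ?t = "\<phi> (w m)" and ?x = "\<phi> (u m m')" and ?y = "\<phi> (u m n)"
    have t: "?t \<in> Q" using uv1[of m m'] nm mult_nonzero by metis
    have x: "?x \<odot> \<phi> (v m') = ?t" "?x \<odot> \<phi> (v m) = ?t" using uv1[of m m'] uv2[of m m'] nm by auto
    then have x': "?x \<in> Q" "?x \<noteq> ?t" using nm wv mult_nonzero by metis+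
    show False
    proof (cases "\<phi> (w n) = z")
      case True
      have y: "?y \<odot> \<phi> (v n) = ?t" "?y \<odot> \<phi> (v m) = z" using uv1[of m n] uv2[of m n] ne True by auto
      then have "?y \<in> Q" "?y \<noteq> ?t" using nm wv mult_nonzero by metis+
      then have "?y = ?x" using two_states_eq t x' by metis
      then show False using x y nm by metis
    next
      case False
      then have "\<phi> (w n) \<in> Q" using uv1[of n n'] nm mult_nonzero by metis
      then have "\<phi> (w n) = ?x" using two_states_eq t x' nm by metis
      then show False using wv x nm by metis
    qed
  qed (use w Q in \<open>auto simp: fun_upd_def\<close>)
qed

text \<open>A letter sequence with at most one entry other than \<open>b\<close> can rescue only one
  of two entries \<open>q\<close>, so no product of admissible sequences consists of states
  throughout, and the constant sequence \<open>r\<close> stays outside. The product of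
  \<open>u i j\<close> with \<open>v j\<close> keeps the zero at \<open>i\<close>, with
  \<open>v i\<close> the zero at \<open>j\<close>.\<close>

lemma not_dualizable_N1:
  assumes inf: "infinite (UNIV :: 'b set)" and Q: "Q = {q, r}" "q \<noteq> r" and ab: "a \<in> \<Sigma>" "b \<in> \<Sigma>"
    and a: "q \<odot> a = r" "r \<odot> a = r" and b: "q \<odot> b = z" "r \<odot> b = r"
  shows "\<not> dualizable TYPE('b) M"
proof -
  define S where "S = (\<lambda>x::nat\<Rightarrow>'a. \<exists>i j. i \<noteq> j \<and> x i = q \<and> x j = q)"
  define L where "L = (\<lambda>y::nat\<Rightarrow>'a. \<exists>k. \<forall>i. i \<noteq> k \<longrightarrow> y i = b)"
  let ?B = "seq_alg UNIV S L"
  define u where "u n m = (\<lambda>_. r)(n := q, m := q)" for n m :: nat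
  define v where "v m = (\<lambda>_. b)(m := a)" for m :: nat
  define w where "w n = (\<lambda>_. r)(n := z)" for n :: nat
  have qr: "q \<in> Q" "r \<in> Q" using Q by auto
  note mem = state_props(1)[OF qr(1)] state_props(1)[OF qr(2)] state_props(3) qr
    state_props(2)[OF ab(1)] state_props(2)[OF ab(2)] ab
  have u: "u n m \<in> ?B" if "n \<noteq> m" for n m
    using mem that by (auto simp: seq_alg_def u_def S_def)
  have v: "v m \<in> ?B" for m using mem by (auto simp: seq_alg_def v_def L_def)
  have w: "w n \<in> ?B" for n using mem by (auto simp: seq_alg_def w_def split: if_splits)
  show ?thesis
  proof (rule ghost_state[OF inf, of UNIV S L w "\<lambda>_. r"])
    show "S (\<lambda>i. x i \<odot> y i)"
      if sl: "S x" "L y"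
        "\<forall>i\<in>UNIV. x i \<in> Q" "\<forall>i\<in>UNIV. y i \<in> \<Sigma>" "\<forall>i\<in>UNIV. x i \<odot> y i \<in> Q"
      for x y
    proof -
      obtain i j k where *: "i \<noteq> j" "x i = q" "x j = q" "\<And>i. i \<noteq> k \<Longrightarrow> y i = b"
        using sl(1,2) by (auto simp: S_def L_def)
      then have "x i \<odot> y i = z \<or> x j \<odot> y j = z" using b by (cases "i = k") auto
      then show ?thesis using sl(5) mem by (metis UNIV_I)
    qed
    show "\<not> S (\<lambda>_. r)" using Q(2) mem by (auto simp: S_def)
    show "finite {n. w n i \<noteq> (\<lambda>_. r) i}" for i
      by (rule finite_subset[of _ "{i}"]) (auto simp: w_def)
    fix \<phi> n n' m m'
    assume h0: "\<And>x y. x \<in> ?B \<Longrightarrow> y \<in> ?B \<Longrightarrow>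
        (\<lambda>i. x i \<odot> y i) \<in> ?B \<and> \<phi> (\<lambda>i. x i \<odot> y i) = \<phi> x \<odot> \<phi> y"
      and nm: "n \<noteq> n'" "m \<noteq> m'" "\<phi> (w n) = \<phi> (w n')" "\<phi> (w m) = \<phi> (w m')"
        "\<phi> (w m) \<noteq> z" "\<phi> (w n) \<noteq> \<phi> (w m)"
    have h: "\<phi> (\<lambda>i. x i \<odot> y i) = \<phi> x \<odot> \<phi> y" if "x \<in> ?B" "y \<in> ?B" for x y
      using h0[OF that] by simp
    have ne: "n \<noteq> m" "n \<noteq> m'" "n' \<noteq> m" "n' \<noteq> m'" using nm by auto
    have uv1: "\<phi> (u i j) \<odot> \<phi> (v j) = \<phi> (w i)" if "i \<noteq> j" for i j
    proof -
      have "(\<lambda>k. u i j k \<odot> v j k) = w i"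
        using that a b Q(2) by (auto simp: fun_eq_iff u_def v_def w_def)
      then show ?thesis using h[OF u[OF that] v] by metis
    qed
    have uv2: "\<phi> (u i j) \<odot> \<phi> (v i) = \<phi> (w j)" if "i \<noteq> j" for i j
    proof -
      have "(\<lambda>k. u i j k \<odot> v i k) = w j"
        using that a b Q(2) by (auto simp: fun_eq_iff u_def v_def w_def)
      then show ?thesis using h[OF u[OF that] v] by metis
    qed
    have uvk: "\<phi> (u i j) \<odot> \<phi> (v k) = \<phi> (u i j) \<odot> \<phi> (v l)"
      if "i \<noteq> j" "k \<noteq> i" "k \<noteq> j" "l \<noteq> i" "l \<noteq> j" for i j k l
    proof -
      have "(\<lambda>s. u i j s \<odot> v k s) = (\<lambda>s. u i j s \<odot> v l s)"
        using that a b Q(2) by (auto simp: fun_eq_iff u_def v_def)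
      then show ?thesis using h[OF u[OF that(1)] v] by metis
    qed
    have wv: "\<phi> (w i) \<odot> \<phi> (v k) = \<phi> (w i)" for i k
    proof -
      have "(\<lambda>s. w i s \<odot> v k s) = w i" using a b Q(2) by (auto simp: fun_eq_iff w_def v_def)
      then show ?thesis using h[OF w v] by metis
    qed
    let ?t = "\<phi> (w m)"
    have t: "?t \<in> Q" using uv1[of m m'] nm mult_nonzero by metis
    show False
    proof (cases "\<phi> (w n) = z")
      case True
      have *: "\<phi> (u i j) \<in> Q" "\<phi> (u i j) \<noteq> ?t" "\<phi> (u i j) \<odot> \<phi> (v j) = ?t" "\<phi> (u i j) \<odot> \<phi> (v i) = z"
        if "i \<noteq> j" "\<phi> (w i) = ?t" "\<phi> (w j) = z" for i j
      proof -
        show 1: "\<phi> (u i j) \<odot> \<phi> (v j) = ?t" "\<phi> (u i j) \<odot> \<phi> (v i) = z"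
          using uv1[OF that(1)] uv2[OF that(1)] that by auto
        show "\<phi> (u i j) \<in> Q" using 1 nm mult_nonzero by metis
        show "\<phi> (u i j) \<noteq> ?t" using 1 wv[of m i] nm by metis
      qed
      note 1 = *[of m n] and 2 = *[of m' n] and 3 = *[of m n']
      \<comment> \<open>All three are the state other than \<open>?t\<close>. But
        \<open>v m'\<close> and \<open>v n'\<close> act alike on the first, while
        \<open>v m'\<close> sends the second to \<open>z\<close> and \<open>v n'\<close> sends the
        third to \<open>?t\<close>.\<close>
      have "\<phi> (u m n) = \<phi> (u m' n)" "\<phi> (u m n) = \<phi> (u m n')"
        using 1 2 3 ne nm True t two_states_eq by metis+
      then show False using uvk[of m n m' n'] 2 3 ne nm True by metis
    next
      case False
      have t': "\<phi> (w n) \<in> Q" using uv1[of n n'] nm False mult_nonzero by metis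
      \<comment> \<open>Both states now occur as values at some \<open>w i\<close>, so every
        \<open>v k\<close> fixes all states; then \<open>u n m\<close> would have to equal both
        values.\<close>
      have fx: "x \<odot> \<phi> (v k) = x" if "x \<in> Q" for x k
        using two_states_eq[OF that t' t] wv nm by metis
      have "\<phi> (u n m) \<in> Q" using uv1[of n m] ne False mult_nonzero by metis
      then show False using uv1[of n m] uv2[of n m] fx ne nm by metis
    qed
  qed (use w Q in \<open>auto simp: fun_upd_def\<close>)
qed

text \<open>The sequences are those used for \<open>N1\<close>. Since \<open>a\<close> now swaps the
  states, \<open>v k\<close> no longer fixes \<open>w i\<close>, and the weaker relations
  \<open>wvv\<close>, \<open>wvc\<close>, \<open>uvv\<close> and \<open>uvvv\<close> take the place
  of that fact.\<close>

lemma not_dualizable_N2: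
  assumes inf: "infinite (UNIV :: 'b set)" and Q: "Q = {q, r}" "q \<noteq> r" and ab: "a \<in> \<Sigma>" "b \<in> \<Sigma>"
    and a: "q \<odot> a = r" "r \<odot> a = q" and b: "q \<odot> b = z" "r \<odot> b = r"
  shows "\<not> dualizable TYPE('b) M"
proof -
  define S where "S = (\<lambda>x::nat\<Rightarrow>'a. \<exists>i j. i \<noteq> j \<and> x i = q \<and> x j = q)"
  define L where "L = (\<lambda>y::nat\<Rightarrow>'a. \<exists>k. \<forall>i. i \<noteq> k \<longrightarrow> y i = b)"
  let ?B = "seq_alg UNIV S L"
  define u where "u n m = (\<lambda>_. r)(n := q, m := q)" for n m :: nat
  define v where "v m = (\<lambda>_. b)(m := a)" for m :: nat
  define w where "w n = (\<lambda>_. r)(n := z)" for n :: nat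
  have qr: "q \<in> Q" "r \<in> Q" using Q by auto
  note mem = state_props(1)[OF qr(1)] state_props(1)[OF qr(2)] state_props(3) qr
    state_props(2)[OF ab(1)] state_props(2)[OF ab(2)] ab
  have u: "u n m \<in> ?B" if "n \<noteq> m" for n m
    using mem that by (auto simp: seq_alg_def u_def S_def)
  have v: "v m \<in> ?B" for m using mem by (auto simp: seq_alg_def v_def L_def)
  have w: "w n \<in> ?B" for n using mem by (auto simp: seq_alg_def w_def split: if_splits)
  show ?thesis
  proof (rule ghost_state[OF inf, of UNIV S L w "\<lambda>_. r"])
    show "S (\<lambda>i. x i \<odot> y i)"
      if sl: "S x" "L y"
        "\<forall>i\<in>UNIV. x i \<in> Q" "\<forall>i\<in>UNIV. y i \<in> \<Sigma>" "\<forall>i\<in>UNIV. x i \<odot> y i \<in> Q"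
      for x y
    proof -
      obtain i j k where *: "i \<noteq> j" "x i = q" "x j = q" "\<And>i. i \<noteq> k \<Longrightarrow> y i = b"
        using sl(1,2) by (auto simp: S_def L_def)
      then have "x i \<odot> y i = z \<or> x j \<odot> y j = z" using b by (cases "i = k") auto
      then show ?thesis using sl(5) mem by (metis UNIV_I)
    qed
    show "\<not> S (\<lambda>_. r)" using Q(2) mem by (auto simp: S_def)
    show "finite {n. w n i \<noteq> (\<lambda>_. r) i}" for i
      by (rule finite_subset[of _ "{i}"]) (auto simp: w_def)
    fix \<phi> n n' m m'
    assume h0: "\<And>x y. x \<in> ?B \<Longrightarrow> y \<in> ?B \<Longrightarrow>
        (\<lambda>i. x i \<odot> y i) \<in> ?B \<and> \<phi> (\<lambda>i. x i \<odot> y i) = \<phi> x \<odot> \<phi> y"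
      and nm: "n \<noteq> n'" "m \<noteq> m'" "\<phi> (w n) = \<phi> (w n')" "\<phi> (w m) = \<phi> (w m')"
        "\<phi> (w m) \<noteq> z" "\<phi> (w n) \<noteq> \<phi> (w m)"
    have h: "\<phi> (\<lambda>i. x i \<odot> y i) = \<phi> x \<odot> \<phi> y" and hB: "(\<lambda>i. x i \<odot> y i) \<in> ?B"
      if "x \<in> ?B" "y \<in> ?B" for x y using h0[OF that] by auto
    have ne: "n \<noteq> m" "n \<noteq> m'" "n' \<noteq> m" "n' \<noteq> m'" using nm by auto
    have uv1: "\<phi> (u i j) \<odot> \<phi> (v j) = \<phi> (w i)" if "i \<noteq> j" for i j
    proof -
      have "(\<lambda>k. u i j k \<odot> v j k) = w i"
        using that a b Q(2) by (auto simp: fun_eq_iff u_def v_def w_def)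
      then show ?thesis using h[OF u[OF that] v] by metis
    qed
    have uv2: "\<phi> (u i j) \<odot> \<phi> (v i) = \<phi> (w j)" if "i \<noteq> j" for i j
    proof -
      have "(\<lambda>k. u i j k \<odot> v i k) = w j"
        using that a b Q(2) by (auto simp: fun_eq_iff u_def v_def w_def)
      then show ?thesis using h[OF u[OF that] v] by metis
    qed
    have wv: "\<phi> (w i) \<odot> \<phi> (v i) = \<phi> (w i)" for i
    proof -
      have "(\<lambda>s. w i s \<odot> v i s) = w i" using a b Q(2) by (auto simp: fun_eq_iff w_def v_def)
      then show ?thesis using h[OF w v] by metis
    qed
    have wvv: "\<phi> (w i) \<odot> \<phi> (v k) \<odot> \<phi> (v k) = \<phi> (w i)" for i k
    proof -
      have "(\<lambda>s. ((w i s \<odot> v k s) \<odot> v k s)) = (\<lambda>s. w i s)"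
        using a b Q(2) by (auto simp: fun_eq_iff u_def v_def w_def)
      then show ?thesis using w v by (simp add: hB flip: h)
    qed
    have wvc: "\<phi> (w i) \<odot> \<phi> (v k) \<odot> \<phi> (v i) = \<phi> (w k) \<odot> \<phi> (v i) \<odot> \<phi> (v k)" for i k
    proof -
      have "(\<lambda>s. ((w i s \<odot> v k s) \<odot> v i s)) = (\<lambda>s. ((w k s \<odot> v i s) \<odot> v k s))"
        using a b Q(2) by (auto simp: fun_eq_iff u_def v_def w_def)
      then show ?thesis using w v by (simp add: hB flip: h)
    qed
    have uvv: "\<phi> (u i j) \<odot> \<phi> (v k) \<odot> \<phi> (v i) = \<phi> (u i j) \<odot> \<phi> (v k) \<odot> \<phi> (v j)"
      if "i \<noteq> j" "k \<noteq> i" "k \<noteq> j" for i j k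
    proof -
      have "(\<lambda>s. ((u i j s \<odot> v k s) \<odot> v i s)) = (\<lambda>s. ((u i j s \<odot> v k s) \<odot> v j s))"
        using that a b Q(2) by (auto simp: fun_eq_iff u_def v_def w_def)
      then show ?thesis using u[OF that(1)] v by (simp add: hB flip: h)
    qed
    have uvvv: "\<phi> (u i j) \<odot> \<phi> (v k) \<odot> \<phi> (v l) \<odot> \<phi> (v k) = \<phi> (u i j) \<odot> \<phi> (v l) \<odot> \<phi> (v k) \<odot> \<phi> (v l)"
      if "i \<noteq> j" "k \<noteq> i" "k \<noteq> j" "l \<noteq> i" "l \<noteq> j" "k \<noteq> l" for i j k l
    proof -
      have "(\<lambda>s. (((u i j s \<odot> v k s) \<odot> v l s) \<odot> v k s)) =
          (\<lambda>s. (((u i j s \<odot> v l s) \<odot> v k s) \<odot> v l s))"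
        using that a b Q(2) by (auto simp: fun_eq_iff u_def v_def w_def)
      then show ?thesis using u[OF that(1)] v by (simp add: hB flip: h)
    qed
    let ?t = "\<phi> (w m)"
    have t: "?t \<in> Q" using uv1[of m m'] nm mult_nonzero by metis
    show False
    proof (cases "\<phi> (w n) = z")
      case True
      have *: "\<phi> (u i j) \<in> Q" "\<phi> (u i j) \<noteq> ?t" "\<phi> (u i j) \<odot> \<phi> (v j) = ?t" "\<phi> (u i j) \<odot> \<phi> (v i) = z"
        if "i \<noteq> j" "\<phi> (w i) = ?t" "\<phi> (w j) = z" for i j
      proof -
        show 1: "\<phi> (u i j) \<odot> \<phi> (v j) = ?t" "\<phi> (u i j) \<odot> \<phi> (v i) = z"
          using uv1[OF that(1)] uv2[OF that(1)] that by auto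
        show "\<phi> (u i j) \<in> Q" using 1 nm mult_nonzero by metis
        show "\<phi> (u i j) \<noteq> ?t" using 1 wv[of i] that nm by metis
      qed
      note 1 = *[of m n] and 2 = *[of m' n] and 3 = *[of m n']
      have eq: "\<phi> (u m n) = \<phi> (u m' n)" "\<phi> (u m n) = \<phi> (u m n')"
        using 1 2 3 ne nm True t two_states_eq by metis+
      have tm: "?t \<odot> \<phi> (v m) = ?t" "?t \<odot> \<phi> (v m') = ?t" using wv[of m] wv[of m'] nm by auto
      have x: "\<phi> (u m n) \<odot> \<phi> (v n') = ?t" "\<phi> (u m n) \<odot> \<phi> (v m') = z"
        using 2 3 eq ne nm True by metis+
      have "\<phi> (u m n') \<odot> \<phi> (v n) = ?t" using 1 eq ne nm True by metis
      then have tn: "?t \<odot> \<phi> (v n') = ?t" using uvv[of m n' n] tm ne nm by metis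
      \<comment> \<open>By \<open>uvvv\<close> the same element arises with \<open>v m'\<close>
        applied first, which already gives \<open>z\<close>.\<close>
      have "\<phi> (u m n) \<odot> \<phi> (v n') \<odot> \<phi> (v m') \<odot> \<phi> (v n') = ?t" using x tm tn by simp
      then show False using uvvv[of m n n' m'] x ne nm by auto
    next
      case False
      have t': "\<phi> (w n) \<in> Q" using uv1[of n n'] nm False mult_nonzero by metis
      have fx: "\<phi> (w i) \<odot> \<phi> (v j) = \<phi> (w i)"
        if ij: "\<phi> (w i) \<in> Q" "\<phi> (w j) \<in> Q" "\<phi> (w i) \<noteq> \<phi> (w j)" for i j
      proof -
        \<comment> \<open>Applying \<open>v j\<close> twice restores the value at
          \<open>w i\<close>. So one application gives a state, and not the value at
          \<open>w j\<close>, since \<open>v j\<close> fixes that one; only the value at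
          \<open>w i\<close> is left.\<close>
        have "\<phi> (w i) \<odot> \<phi> (v j) \<in> Q"
          using wvv[of i j] ij(1) mult_nonzero state_props(1) by metis
        moreover have "\<phi> (w i) \<odot> \<phi> (v j) \<noteq> \<phi> (w j)" using wvv[of i j] wv[of j] ij(3) by metis
        ultimately show ?thesis using two_states_eq ij by metis
      qed
      show False using wvc[of n m] fx[OF t' t] fx[OF t t'] wv nm by metis
    qed
  qed (use w Q in \<open>auto simp: fun_upd_def\<close>)
qed

text \<open>A product stays among the states only if the single \<open>b\<close> meets the single
  \<open>q\<close>, which then survives; so exactly one \<open>q\<close> is an invariant that the
  constant sequence \<open>r\<close> violates. A \<open>b\<close> at any other place produces the
  zero of some \<open>w j\<close>.\<close>

lemma not_dualizable_N3:
  assumes inf: "infinite (UNIV :: 'b set)" and Q: "Q = {q, r}" "q \<noteq> r" and ab: "a \<in> \<Sigma>" "b \<in> \<Sigma>"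
    and a: "q \<odot> a = r" "r \<odot> a = r" and b: "q \<odot> b = q" "r \<odot> b = z"
  shows "\<not> dualizable TYPE('b) M"
proof -
  define S where "S = (\<lambda>x::nat\<Rightarrow>'a. \<exists>k. \<forall>i. x i = q \<longleftrightarrow> i = k)"
  define L where "L = (\<lambda>y::nat\<Rightarrow>'a. \<exists>k. \<forall>i. y i = (if i = k then b else a))"
  let ?B = "seq_alg UNIV S L"
  define u where "u n = (\<lambda>_. r)(n := q)" for n :: nat
  define v where "v n = (\<lambda>_. a)(n := b)" for n :: nat
  define w where "w n = (\<lambda>_. r)(n := z)" for n :: nat
  have qr: "q \<in> Q" "r \<in> Q" using Q by auto
  note mem = state_props(1)[OF qr(1)] state_props(1)[OF qr(2)] state_props(3) qr
    state_props(2)[OF ab(1)] state_props(2)[OF ab(2)] ab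
  have u: "u n \<in> ?B" for n using mem Q(2) by (auto simp: seq_alg_def u_def S_def)
  have v: "v m \<in> ?B" for m using mem by (auto simp: seq_alg_def v_def L_def)
  have w: "w n \<in> ?B" for n using mem by (auto simp: seq_alg_def w_def split: if_splits)
  show ?thesis
  proof (rule ghost_state[OF inf, of UNIV S L w "\<lambda>_. r"])
    show "S (\<lambda>i. x i \<odot> y i)"
      if sl: "S x" "L y"
        "\<forall>i\<in>UNIV. x i \<in> Q" "\<forall>i\<in>UNIV. y i \<in> \<Sigma>" "\<forall>i\<in>UNIV. x i \<odot> y i \<in> Q"
      for x y
    proof -
      obtain k l where *: "\<And>i. x i = q \<longleftrightarrow> i = k" "\<And>i. y i = (if i = l then b else a)"
        using sl(1,2) by (auto simp: S_def L_def)
      have "x l \<odot> y l \<in> Q" using sl(5) by simp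
      moreover have "x l = q \<or> x l = r" using sl(3) Q by auto
      ultimately have "x l = q" using *(2)[of l] b mem by auto
      then have kl: "l = k" using *(1) by simp
      have "x i \<odot> y i = q \<longleftrightarrow> i = k" for i
      proof (cases "i = k")
        case True
        then have "x i = q" "y i = b" using * kl by auto
        then show ?thesis using True b by simp
      next
        case False
        then have "x i = r" using *(1) sl(3) Q by auto
        then show ?thesis using False * kl a Q(2) by auto
      qed
      then show ?thesis unfolding S_def by blast
    qed
    show "\<not> S (\<lambda>_. r)" using Q(2) mem by (auto simp: S_def)
    show "finite {n. w n i \<noteq> (\<lambda>_. r) i}" for i
      by (rule finite_subset[of _ "{i}"]) (auto simp: w_def)
    fix \<phi> n n' m m'
    assume h0: "\<And>x y. x \<in> ?B \<Longrightarrow> y \<in> ?B \<Longrightarrow>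
        (\<lambda>i. x i \<odot> y i) \<in> ?B \<and> \<phi> (\<lambda>i. x i \<odot> y i) = \<phi> x \<odot> \<phi> y"
      and nm: "n \<noteq> n'" "m \<noteq> m'" "\<phi> (w n) = \<phi> (w n')" "\<phi> (w m) = \<phi> (w m')"
        "\<phi> (w m) \<noteq> z" "\<phi> (w n) \<noteq> \<phi> (w m)"
    have h: "\<phi> (\<lambda>i. x i \<odot> y i) = \<phi> x \<odot> \<phi> y" if "x \<in> ?B" "y \<in> ?B" for x y
      using h0[OF that] by simp
    have ne: "n \<noteq> m" "n \<noteq> m'" "n' \<noteq> m" "n' \<noteq> m'" using nm by auto
    have uv1: "\<phi> (u i) \<odot> \<phi> (v i) = \<phi> (u i)" for i
    proof -
      have "(\<lambda>k. u i k \<odot> v i k) = u i" using a b Q(2) by (auto simp: fun_eq_iff u_def v_def w_def)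
      then show ?thesis using h[OF u v] by metis
    qed
    have uv2: "\<phi> (u i) \<odot> \<phi> (v j) = \<phi> (w j)" if "i \<noteq> j" for i j
    proof -
      have "(\<lambda>k. u i k \<odot> v j k) = w j"
        using that a b Q(2) by (auto simp: fun_eq_iff u_def v_def w_def)
      then show ?thesis using h[OF u v] by metis
    qed
    have wv: "\<phi> (w i) \<odot> \<phi> (v j) = \<phi> (w j) \<odot> \<phi> (v i)" for i j
    proof -
      have "(\<lambda>k. w i k \<odot> v j k) = (\<lambda>k. w j k \<odot> v i k)"
        using a b Q(2) by (auto simp: fun_eq_iff u_def v_def w_def)
      then show ?thesis using h[OF w v] by metis
    qed
    let ?t = "\<phi> (w m)"
    have uQ: "\<phi> (u k) \<in> Q" for k
      using uv2[of k m] uv2[of k m'] nm mult_nonzero by metis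
    show False
    proof (cases "\<phi> (w n) = z")
      case True
      \<comment> \<open>\<open>v i\<close> fixes the second value and sends the first to
        \<open>z\<close>. This yields three different states.\<close>
      have "\<phi> (u k) \<noteq> \<phi> (u i)" if "k \<noteq> i" "\<phi> (w i) = z" for k i
        using uv1[of i] uv2[OF that(1)] that uQ[of i] state_props(1) by metis
      then have "\<phi> (u m) \<noteq> \<phi> (u n)" "\<phi> (u m) \<noteq> \<phi> (u n')" "\<phi> (u n) \<noteq> \<phi> (u n')"
        using ne nm True by metis+
      then show False using two_states_eq uQ by metis
    next
      case False
      have t: "\<phi> (w k) \<in> Q" if "\<phi> (w k) \<noteq> z" for k
        using uv2[of "Suc k" k] that mult_nonzero by (metis n_not_Suc_n)
      have *: "\<phi> (u i) = \<phi> (w i)"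
        if ij: "i \<noteq> i'" "j \<noteq> j'" "\<phi> (w i) = \<phi> (w i')" "\<phi> (w j) = \<phi> (w j')"
          "\<phi> (w i) \<noteq> \<phi> (w j)" "\<phi> (w i) \<noteq> z" "\<phi> (w j) \<noteq> z" for i i' j j'
      proof (rule ccontr)
        assume c: "\<phi> (u i) \<noteq> \<phi> (w i)"
        have "\<phi> (u k) = \<phi> (w i)" if "k \<noteq> i" for k
          using uv1[of i] uv2[OF that] c two_states_eq[of "\<phi> (u k)" "\<phi> (u i)" "\<phi> (w i)"]
            uQ t[OF ij(6)] by metis
        moreover have "j \<noteq> i" "j' \<noteq> i" using ij by auto
        ultimately show False using uv1[of j] uv2[of j' j] ij by metis
      qed
      \<comment> \<open>With the values at \<open>u\<close> and \<open>w\<close> identified, the two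
        products that \<open>wv\<close> equates are the two values assumed to be different.\<close>
      have "\<phi> (w n) \<odot> \<phi> (v m) = \<phi> (w m)"
        using *[of n n' m m'] uv2[of n m] nm ne False by metis
      moreover have "\<phi> (w m) \<odot> \<phi> (v n) = \<phi> (w n)"
        using *[of m m' n n'] uv2[of m n] nm ne False by metis
      ultimately show False using wv[of n m] nm by metis
    qed
  qed (use w Q in \<open>auto simp: fun_upd_def\<close>)
qed

text \<open>An entry \<open>a\<close> always produces an \<open>r\<close>, so having an
  \<open>r\<close> somewhere is invariant, and the constant sequence \<open>q\<close> lacks it. One
  of the two repeated values equals the value at \<open>e\<close>; then \<open>v i'\<close> and
  \<open>v j\<close> would act alike on \<open>e\<close>, by \<open>wvv\<close>, although one fixes
  its value and the other does not.\<close>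

lemma not_dualizable_N4:
  assumes inf: "infinite (UNIV :: 'b set)" and Q: "Q = {q, r}" "q \<noteq> r" and ab: "a \<in> \<Sigma>" "b \<in> \<Sigma>"
    and a: "q \<odot> a = r" "r \<odot> a = r" and b: "q \<odot> b = r" "r \<odot> b = q"
  shows "\<not> dualizable TYPE('b) M"
proof -
  define S where "S = (\<lambda>x::nat\<Rightarrow>'a. \<exists>i. x i = r)"
  define L where "L = (\<lambda>y::nat\<Rightarrow>'a. \<exists>i. y i = a)"
  let ?B = "seq_alg UNIV S L"
  define e where "e = (\<lambda>_::nat. r)"
  define v where "v m = (\<lambda>_. b)(m := a)" for m :: nat
  define w where "w m = (\<lambda>_. q)(m := r)" for m :: nat
  have qr: "q \<in> Q" "r \<in> Q" using Q by auto
  note mem = state_props(1)[OF qr(1)] state_props(1)[OF qr(2)] state_props(3) qr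
    state_props(2)[OF ab(1)] state_props(2)[OF ab(2)] ab
  have e: "e \<in> ?B" using mem by (auto simp: seq_alg_def e_def S_def)
  have v: "v m \<in> ?B" for m using mem by (auto simp: seq_alg_def v_def L_def)
  have w: "w m \<in> ?B" for m using mem by (auto simp: seq_alg_def w_def S_def)
  show ?thesis
  proof (rule ghost_state[OF inf, of UNIV S L w "\<lambda>_. q"])
    show "S (\<lambda>i. x i \<odot> y i)"
      if sl: "S x" "L y"
        "\<forall>i\<in>UNIV. x i \<in> Q" "\<forall>i\<in>UNIV. y i \<in> \<Sigma>" "\<forall>i\<in>UNIV. x i \<odot> y i \<in> Q"
      for x y
    proof -
      obtain i where "y i = a" using sl(2) by (auto simp: L_def)
      moreover have "x i = q \<or> x i = r" using sl(3) Q by auto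
      ultimately show ?thesis unfolding S_def using a by metis
    qed
    show "\<not> S (\<lambda>_. q)" using Q(2) mem by (auto simp: S_def)
    show "finite {n. w n i \<noteq> (\<lambda>_. q) i}" for i
      by (rule finite_subset[of _ "{i}"]) (auto simp: w_def)
    fix \<phi> n n' m m'
    assume h0: "\<And>x y. x \<in> ?B \<Longrightarrow> y \<in> ?B \<Longrightarrow>
        (\<lambda>i. x i \<odot> y i) \<in> ?B \<and> \<phi> (\<lambda>i. x i \<odot> y i) = \<phi> x \<odot> \<phi> y"
      and nm: "n \<noteq> n'" "m \<noteq> m'" "\<phi> (w n) = \<phi> (w n')" "\<phi> (w m) = \<phi> (w m')"
        "\<phi> (w m) \<noteq> z" "\<phi> (w n) \<noteq> \<phi> (w m)"
    have h: "\<phi> (\<lambda>i. x i \<odot> y i) = \<phi> x \<odot> \<phi> y" if "x \<in> ?B" "y \<in> ?B" for x y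
      using h0[OF that] by simp
    have ne: "n \<noteq> m" "n \<noteq> m'" "n' \<noteq> m" "n' \<noteq> m'" using nm by auto
    have ev: "\<phi> e \<odot> \<phi> (v i) = \<phi> (w i)" for i
    proof -
      have "(\<lambda>k. e k \<odot> v i k) = w i" using a b Q(2) by (auto simp: fun_eq_iff e_def v_def w_def)
      then show ?thesis using h[OF e v] by metis
    qed
    have wv: "\<phi> (w i) \<odot> \<phi> (v i) = \<phi> e" for i
    proof -
      have "(\<lambda>k. w i k \<odot> v i k) = e" using a b Q(2) by (auto simp: fun_eq_iff e_def v_def w_def)
      then show ?thesis using h[OF w v] by metis
    qed
    have wvv: "\<phi> (w i) \<odot> \<phi> (v j) = \<phi> (w i) \<odot> \<phi> (v k)" if "i \<noteq> j" "i \<noteq> k" for i j k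
    proof -
      have "(\<lambda>s. w i s \<odot> v j s) = (\<lambda>s. w i s \<odot> v k s)"
        using that a b Q(2) by (auto simp: fun_eq_iff e_def v_def w_def)
      then show ?thesis using h[OF w v] by metis
    qed
    have eQ: "\<phi> e \<in> Q" using ev nm mult_nonzero by metis
    then have wQ: "\<phi> (w i) \<in> Q" for i using wv state_props(1) mult_nonzero by metis
    have *: False if "i \<noteq> i'" "\<phi> (w i) = \<phi> e" "\<phi> (w i') = \<phi> e" "\<phi> (w j) \<noteq> \<phi> e" for i i' j
      using wvv[of i i' j] ev[of i'] ev[of j] that by metis
    have "\<phi> (w n) = \<phi> e \<or> \<phi> (w m) = \<phi> e" using two_states_eq wQ eQ nm by metis
    then show False using *[of n n' m] *[of m m' n] nm by metis
  qed (use w Q in \<open>auto simp: fun_upd_def\<close>)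
qed

text \<open>An entry \<open>b\<close> always produces a \<open>q\<close>, so the constant sequence
  \<open>r\<close> is excluded. The letter \<open>c\<close> permits \<open>v n m\<close> to move the
  \<open>q\<close> from \<open>n\<close> to \<open>m\<close> without touching other coordinates. The
  contradiction is \<open>wv3\<close>: both sides are the sequence with \<open>q\<close> at
  \<open>n'\<close> and \<open>m\<close>, but one side takes the value at \<open>w m\<close> and the
  other that at \<open>w n'\<close>.\<close>

lemma not_dualizable_N5:
  assumes inf: "infinite (UNIV :: 'b set)" and Q: "Q = {q, r}" "q \<noteq> r"
    and ab: "a \<in> \<Sigma>" "b \<in> \<Sigma>" "c \<in> \<Sigma>"
    and a: "q \<odot> a = r" "r \<odot> a = r" and b: "q \<odot> b = q" "r \<odot> b = q"
    and c: "q \<odot> c = q" "r \<odot> c = r"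
  shows "\<not> dualizable TYPE('b) M"
proof -
  define S where "S = (\<lambda>x::nat\<Rightarrow>'a. \<exists>i. x i = q)"
  define L where "L = (\<lambda>y::nat\<Rightarrow>'a. \<exists>i. y i = b)"
  let ?B = "seq_alg UNIV S L"
  define v where "v n m = (\<lambda>_. c)(n := a, m := b)" for n m :: nat
  define w where "w n = (\<lambda>_. r)(n := q)" for n :: nat
  have qr: "q \<in> Q" "r \<in> Q" using Q by auto
  note mem = state_props(1)[OF qr(1)] state_props(1)[OF qr(2)] state_props(3) qr
    state_props(2)[OF ab(1)] state_props(2)[OF ab(2)] ab state_props(2)[OF ab(3)]
  have v: "v n m \<in> ?B" for n m using mem by (auto simp: seq_alg_def v_def L_def)
  have w: "w n \<in> ?B" for n using mem by (auto simp: seq_alg_def w_def S_def)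
  show ?thesis
  proof (rule ghost_state[OF inf, of UNIV S L w "\<lambda>_. r"])
    show "S (\<lambda>i. x i \<odot> y i)"
      if sl: "S x" "L y"
        "\<forall>i\<in>UNIV. x i \<in> Q" "\<forall>i\<in>UNIV. y i \<in> \<Sigma>" "\<forall>i\<in>UNIV. x i \<odot> y i \<in> Q"
      for x y
    proof -
      obtain i where "y i = b" using sl(2) by (auto simp: L_def)
      moreover have "x i = q \<or> x i = r" using sl(3) Q by auto
      ultimately show ?thesis unfolding S_def using b by metis
    qed
    show "\<not> S (\<lambda>_. r)" using Q(2) mem by (auto simp: S_def)
    show "finite {n. w n i \<noteq> (\<lambda>_. r) i}" for i
      by (rule finite_subset[of _ "{i}"]) (auto simp: w_def)
    fix \<phi> n n' m m'
    assume h0: "\<And>x y. x \<in> ?B \<Longrightarrow> y \<in> ?B \<Longrightarrow>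
        (\<lambda>i. x i \<odot> y i) \<in> ?B \<and> \<phi> (\<lambda>i. x i \<odot> y i) = \<phi> x \<odot> \<phi> y"
      and nm: "n \<noteq> n'" "m \<noteq> m'" "\<phi> (w n) = \<phi> (w n')" "\<phi> (w m) = \<phi> (w m')"
        "\<phi> (w m) \<noteq> z" "\<phi> (w n) \<noteq> \<phi> (w m)"
    have h: "\<phi> (\<lambda>i. x i \<odot> y i) = \<phi> x \<odot> \<phi> y" if "x \<in> ?B" "y \<in> ?B" for x y
      using h0[OF that] by simp
    have ne: "n \<noteq> m" "n \<noteq> m'" "n' \<noteq> m" "n' \<noteq> m'" using nm by auto
    have wv1: "\<phi> (w i) \<odot> \<phi> (v i j) = \<phi> (w j)" if "i \<noteq> j" for i j
    proof -
      have "(\<lambda>k. w i k \<odot> v i j k) = w j"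
        using that a b c Q(2) by (auto simp: fun_eq_iff v_def w_def)
      then show ?thesis using h[OF w v] by metis
    qed
    have wv2: "\<phi> (w j) \<odot> \<phi> (v i j) = \<phi> (w j)" if "i \<noteq> j" for i j
    proof -
      have "(\<lambda>k. w j k \<odot> v i j k) = w j"
        using that a b c Q(2) by (auto simp: fun_eq_iff v_def w_def)
      then show ?thesis using h[OF w v] by metis
    qed
    have wv3: "\<phi> (w n') \<odot> \<phi> (v n m) = \<phi> (w m) \<odot> \<phi> (v m' n')"
    proof -
      have "(\<lambda>s. w n' s \<odot> v n m s) = (\<lambda>s. w m s \<odot> v m' n' s)"
        using ne nm(1,2) a b c Q(2) by (auto simp: fun_eq_iff v_def w_def)
      then show ?thesis using h[OF w v] by metis
    qed
    have wQ: "\<phi> (w i) \<in> Q" for i using wv1[of i m] wv1[of m m'] nm mult_nonzero by metis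
    show False using wv3 wv1[of n m] wv1[of m' n'] nm ne by metis
  qed (use w Q in \<open>auto simp: fun_upd_def\<close>)
qed

end

section \<open>Continuous maps that are locally evaluations at products\<close>

text \<open>Evaluating at products only ensures that the values of \<open>f\<close> are states or
  zero, never letters.\<close>

locale local_product = two_state M Q \<Sigma> z
  for M :: "'a magma" and Q \<Sigma> :: "'a set" and z :: 'a +
  fixes A :: "'b magma" and f :: "('b \<Rightarrow> 'a) \<Rightarrow> 'a" and F :: "'b set"
  assumes algebra_A: "algebra A"
    and separating: "\<And>a b. a \<in> univ A \<Longrightarrow> b \<in> univ A \<Longrightarrow> (\<And>x. x \<in> hom A M \<Longrightarrow> x a = x b) \<Longrightarrow> a = b"
    and finite_F: "finite F"
    and determined: "\<And>x y. x \<in> hom A M \<Longrightarrow> y \<in> hom A M \<Longrightarrow> (\<And>a. a \<in> F \<Longrightarrow> x a = y a) \<Longrightarrow> f x = f y"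
    and F_univ: "F \<subseteq> univ A"
    and local: "\<And>X. finite X \<Longrightarrow> X \<subseteq> hom A M \<Longrightarrow>
      \<exists>b\<in>univ A. \<exists>c\<in>univ A. \<forall>x\<in>X. f x = x (b \<cdot>\<^bsub>A\<^esub> c)"
begin

section \<open>Homomorphisms, pairs of preimages and gluing\<close>

abbreviation mult_A (infixl "\<star>" 70) where "a \<star> b \<equiv> a \<cdot>\<^bsub>A\<^esub> b"

abbreviation H where "H \<equiv> hom A M"

lemma mult_A_closed [simp]: "a \<in> univ A \<Longrightarrow> b \<in> univ A \<Longrightarrow> a \<star> b \<in> univ A"
  by (rule algebra_mult[OF algebra_A])

lemma hom_mult: "x \<in> H \<Longrightarrow> a \<in> univ A \<Longrightarrow> b \<in> univ A \<Longrightarrow> x (a \<star> b) = x a \<odot> x b"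
  by (simp add: mem_hom_iff)

lemma hom_mult_cases: "x \<in> H \<Longrightarrow> a \<in> univ A \<Longrightarrow> b \<in> univ A \<Longrightarrow> x (a \<star> b) \<in> Q \<or> x (a \<star> b) = z"
  by (simp add: hom_mult mult_state_iff)

lemma f_cases: "x \<in> H \<Longrightarrow> f x \<in> Q \<or> f x = z"
  using local[of "{x}"] hom_mult_cases by force

text \<open>What remains of a homomorphism when the values are forgotten: \<open>S\<close> plays the
  states and \<open>T\<close> the letters that keep them alive. Unlike homomorphisms, such pairs can
  be intersected, and \<open>glue\<close> turns a pair back into a homomorphism.\<close>

definition closed_pair :: "'b set \<Rightarrow> 'b set \<Rightarrow> bool" where
  "closed_pair S T \<longleftrightarrow> S \<subseteq> univ A \<and> T \<subseteq> univ A \<and> S \<inter> T = {} \<and>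
     (\<forall>b\<in>univ A. \<forall>c\<in>univ A. b \<star> c \<notin> T \<and> (b \<star> c \<in> S \<longleftrightarrow> b \<in> S \<and> c \<in> T))"

definition glue :: "('b \<Rightarrow> 'a) \<Rightarrow> 'b set \<Rightarrow> 'b set \<Rightarrow> 'b \<Rightarrow> 'a" where
  "glue h S T = (\<lambda>a\<in>univ A. if a \<in> S \<union> T then h a else z)"

lemma glue_hom:
  assumes "closed_pair S T" and h: "\<And>b. b \<in> S \<Longrightarrow> h b \<in> Q" "\<And>c. c \<in> T \<Longrightarrow> h c \<in> \<Sigma>"
    "\<And>b c. b \<in> S \<Longrightarrow> c \<in> T \<Longrightarrow> h (b \<star> c) = h b \<odot> h c"
  shows "glue h S T \<in> H"
proof -
  have "glue h S T (a \<star> b) = glue h S T a \<odot> glue h S T b" if ab: "a \<in> univ A" "b \<in> univ A" for a b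
  proof (cases "a \<in> S \<and> b \<in> T")
    case True
    then show ?thesis using assms ab by (auto simp: glue_def closed_pair_def)
  next
    case False
    then have "a \<star> b \<notin> S \<union> T" using assms(1) ab by (auto simp: closed_pair_def)
    moreover have "glue h S T a \<odot> glue h S T b = z"
    proof (rule ccontr)
      assume "glue h S T a \<odot> glue h S T b \<noteq> z"
      then have "glue h S T a \<in> Q" "glue h S T b \<in> \<Sigma>" using mult_nonzero by blast+
      moreover have "h a \<notin> \<Sigma>" if "a \<in> S" for a using h(1)[OF that] disjoint by blast
      moreover have "h a \<notin> Q" if "a \<in> T" for a using h(2)[OF that] disjoint by blast
      ultimately show False using False ab zero_fresh by (auto simp: glue_def split: if_splits)
    qed
    ultimately show ?thesis using ab by (simp add: glue_def)
  qed
  moreover have "glue h S T a \<in> univ M" if "a \<in> univ A" for a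
    using that h by (auto simp: glue_def univ_eq)
  ultimately show ?thesis by (auto simp: mem_hom_iff glue_def)
qed

lemma glue_simps:
  assumes "closed_pair S T"
  shows "a \<in> S \<Longrightarrow> glue h S T a = h a" "a \<in> T \<Longrightarrow> glue h S T a = h a"
  using assms by (auto simp: glue_def closed_pair_def)

lemma glue_state_iff:
  assumes "closed_pair S T" "\<And>b. b \<in> S \<Longrightarrow> h b \<in> Q" "\<And>c. c \<in> T \<Longrightarrow> h c \<in> \<Sigma>" "a \<in> univ A"
  shows "glue h S T a \<in> Q \<longleftrightarrow> a \<in> S"
proof -
  have "h a \<notin> Q" if "a \<in> T" for a using assms(3)[OF that] disjoint by blast
  then show ?thesis using assms(2,4) zero_fresh by (auto simp: glue_def)
qed

lemma glue_eqI:
  "(a \<in> S \<longleftrightarrow> a \<in> S') \<Longrightarrow> (a \<in> T \<longleftrightarrow> a \<in> T') \<Longrightarrow> (a \<in> S \<union> T \<Longrightarrow> h a = h' a) \<Longrightarrow>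
    glue h S T a = glue h' S' T' a"
  by (auto simp: glue_def)

lemma closed_pair_Inter:
  assumes "I \<noteq> {}" "\<And>i. i \<in> I \<Longrightarrow> closed_pair (S i) (T i)"
  shows "closed_pair (\<Inter>i\<in>I. S i) (\<Inter>i\<in>I. T i)"
proof -
  obtain i0 where i0: "i0 \<in> I" using assms(1) by blast
  have *: "b \<star> c \<notin> T i \<and> (b \<star> c \<in> S i \<longleftrightarrow> b \<in> S i \<and> c \<in> T i)"
    if "i \<in> I" "b \<in> univ A" "c \<in> univ A" for i b c
    using assms(2)[OF that(1)] that(2,3) by (simp add: closed_pair_def)
  have "S i0 \<subseteq> univ A" "T i0 \<subseteq> univ A" "S i0 \<inter> T i0 = {}"
    using assms(2)[OF i0] by (auto simp: closed_pair_def)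
  then show ?thesis unfolding closed_pair_def using i0 * by (intro conjI ballI) auto
qed

lemma closed_pair_Int:
  "closed_pair S T \<Longrightarrow> closed_pair S' T' \<Longrightarrow> closed_pair (S \<inter> S') (T \<inter> T')"
  using closed_pair_Inter[of "UNIV :: bool set" "\<lambda>i. if i then S else S'" "\<lambda>i. if i then T else T'"]
  by (simp add: UNIV_bool Int_commute)

lemma closed_pair_foldl:
  assumes "closed_pair S T" "b \<in> univ A" "set ds \<subseteq> univ A"
  shows "foldl (\<star>) b ds \<in> univ A \<and> (foldl (\<star>) b ds \<in> S \<longleftrightarrow> b \<in> S \<and> set ds \<subseteq> T)"
  using assms(2,3)
proof (induction ds arbitrary: b)
  case (Cons d ds)
  then show ?case using assms(1) Cons.IH[of "b \<star> d"] by (auto simp: closed_pair_def)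
qed simp

text \<open>The equivalence forbids entering \<open>K\<close> from outside; this is what makes the
  preimages of \<open>K\<close> and \<open>L\<close> a closed pair. It is applied with
  \<open>K\<close> the set of all states or a single state.\<close>

definition stable :: "'a set \<Rightarrow> 'a set \<Rightarrow> bool" where
  "stable K L \<longleftrightarrow> K \<subseteq> Q \<and> L \<subseteq> \<Sigma> \<and> (\<forall>s t. s \<odot> t \<in> K \<longleftrightarrow> s \<in> K \<and> t \<in> L)"

abbreviation pre :: "('b \<Rightarrow> 'a) \<Rightarrow> 'a set \<Rightarrow> 'b set" where
  "pre x K \<equiv> {a \<in> univ A. x a \<in> K}"

lemma closed_pair_pre:
  assumes "stable K L" "x \<in> H"
  shows "closed_pair (pre x K) (pre x L)"
proof -
  have "x (b \<star> c) \<notin> L \<and> (x (b \<star> c) \<in> K \<longleftrightarrow> x b \<in> K \<and> x c \<in> L)" if "b \<in> univ A" "c \<in> univ A" for b c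
    using hom_mult[OF assms(2) that] assms(1) mult_not_letter unfolding stable_def by auto
  then show ?thesis using assms(1) disjoint unfolding stable_def closed_pair_def by auto
qed

lemma glue_restrict_hom:
  assumes "closed_pair S T" "x \<in> H" "S \<subseteq> pre x Q" "T \<subseteq> pre x \<Sigma>"
  shows "glue x S T \<in> H"
  using assms hom_mult[OF assms(2)] by (intro glue_hom) (auto simp: closed_pair_def)

text \<open>The pairs \<open>(pre x K, pre x L)\<close> of the homomorphisms with \<open>f x \<in> K\<close> are closed under
  intersection; by continuity there is a smallest one, and by the local evaluations and once more
  by continuity it is generated by a single element \<open>w\<close>.\<close>

lemma support:
  assumes KL: "stable K L" and x1: "x1 \<in> H" "f x1 \<in> K"
  obtains x0 b c where "x0 \<in> H" "f x0 \<in> K" "b \<in> univ A" "c \<in> univ A"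
    "\<And>x. x \<in> H \<Longrightarrow> f x \<in> K \<longleftrightarrow> x (b \<star> c) \<in> K"
    "\<And>x. x \<in> H \<Longrightarrow> f x \<in> K \<Longrightarrow> pre x0 K \<subseteq> pre x K \<and> pre x0 L \<subseteq> pre x L"
proof -
  have K: "K \<subseteq> Q" and L: "L \<subseteq> \<Sigma>" using KL by (auto simp: stable_def)
  have KLz: "K \<inter> L = {}" "z \<notin> K" "z \<notin> L" using K L disjoint zero_fresh by auto
  define G where "G = {x \<in> H. f x \<in> K}"
  define S where "S = (\<Inter>x\<in>G. pre x K)"
  define T where "T = (\<Inter>x\<in>G. pre x L)"
  have x1G: "x1 \<in> G" using x1 by (simp add: G_def)
  have cp: "closed_pair (\<Inter>x\<in>X. pre x K) (\<Inter>x\<in>X. pre x L)" if "X \<subseteq> G" "X \<noteq> {}" for X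
    using that KL by (intro closed_pair_Inter closed_pair_pre) (auto simp: G_def)
  have ST: "closed_pair S T" unfolding S_def T_def using x1G by (intro cp) auto
  have S1: "S \<subseteq> pre x1 K" and T1: "T \<subseteq> pre x1 L" using x1G by (auto simp: S_def T_def)
  have gl: "glue x1 S' T' \<in> H" if "closed_pair S' T'" "S' \<subseteq> pre x1 K" "T' \<subseteq> pre x1 L" for S' T'
    using that K L x1(1) by (intro glue_restrict_hom) auto
  have gl_K: "glue x1 S' T' a \<in> K \<longleftrightarrow> a \<in> S'"
    if "closed_pair S' T'" "S' \<subseteq> pre x1 K" "T' \<subseteq> pre x1 L" "a \<in> univ A" for S' T' a
  proof -
    have "x1 a \<notin> K" if "a \<in> T'" for a using that \<open>T' \<subseteq> pre x1 L\<close> KLz(1) by blast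
    then show ?thesis using that KLz by (auto simp: glue_def)
  qed
  have gl_L: "glue x1 S' T' a \<in> L \<longleftrightarrow> a \<in> T'"
    if "closed_pair S' T'" "S' \<subseteq> pre x1 K" "T' \<subseteq> pre x1 L" "a \<in> univ A" for S' T' a
  proof -
    have "x1 a \<notin> L" if "a \<in> S'" for a using that \<open>S' \<subseteq> pre x1 K\<close> KLz(1) by blast
    then show ?thesis using that KLz by (auto simp: glue_def)
  qed
  define x0 where "x0 = glue x1 S T"
  have x0: "x0 \<in> H" unfolding x0_def by (rule gl[OF ST S1 T1])
  have "\<forall>a. \<exists>y\<in>G. a \<notin> S \<longrightarrow> a \<notin> pre y K" using x1G by (auto simp: S_def)
  then obtain y1 where y1: "\<And>a. y1 a \<in> G" "\<And>a. a \<notin> S \<Longrightarrow> a \<notin> pre (y1 a) K" by metis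
  have "\<forall>a. \<exists>y\<in>G. a \<notin> T \<longrightarrow> a \<notin> pre y L" using x1G by (auto simp: T_def)
  then obtain y2 where y2: "\<And>a. y2 a \<in> G" "\<And>a. a \<notin> T \<Longrightarrow> a \<notin> pre (y2 a) L" by metis
  \<comment> \<open>For each element of \<open>F\<close> outside \<open>S\<close> or outside
    \<open>T\<close> one witness that excludes it is enough, so the intersections over the finite
    set \<open>X\<close> agree on \<open>F\<close> with those over all of \<open>G\<close>.\<close>
  define X where "X = {x1} \<union> y1 ` F \<union> y2 ` F"
  have X: "finite X" "X \<subseteq> G" "x1 \<in> X" using finite_F x1G y1(1) y2(1) by (auto simp: X_def)
  let ?S = "\<Inter>x\<in>X. pre x K" and ?T = "\<Inter>x\<in>X. pre x L"
  have cpX: "closed_pair ?S ?T" "?S \<subseteq> pre x1 K" "?T \<subseteq> pre x1 L" using cp[OF X(2)] X(3) by blast+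
  have sub: "S \<subseteq> ?S" "T \<subseteq> ?T" using X(2) by (auto simp: S_def T_def)
  have inS: "a \<in> S" if "a \<in> F" "a \<in> ?S" for a
    using that y1(2)[of a] unfolding X_def by blast
  have inT: "a \<in> T" if "a \<in> F" "a \<in> ?T" for a
    using that y2(2)[of a] unfolding X_def by blast
  have F_iff: "a \<in> S \<longleftrightarrow> a \<in> ?S" "a \<in> T \<longleftrightarrow> a \<in> ?T" if "a \<in> F" for a
    by (rule iffI[OF subsetD[OF sub(1)] inS[OF that]]
      iffI[OF subsetD[OF sub(2)] inT[OF that]]; assumption)+
  have "x0 a = glue x1 ?S ?T a" if "a \<in> F" for a
    unfolding x0_def by (rule glue_eqI[OF F_iff[OF that] refl])
  then have "f x0 = f (glue x1 ?S ?T)" using x0 gl[OF cpX] by (intro determined)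
  moreover have "f (glue x1 ?S ?T) \<in> K"
  proof -
    \<comment> \<open>The common evaluating product lies in the preimage of \<open>K\<close> under
      every member of \<open>X\<close>, hence in \<open>?S\<close>, where the glued homomorphism
      keeps its values in \<open>K\<close>.\<close>
    obtain b c where bc: "b \<in> univ A" "c \<in> univ A" "\<forall>x\<in>insert (glue x1 ?S ?T) X. f x = x (b \<star> c)"
      using local[of "insert (glue x1 ?S ?T) X"] X gl[OF cpX] by (auto simp: G_def)
    have "b \<star> c \<in> ?S" using bc X(2) by (auto simp: G_def)
    then show ?thesis using bc gl_K[OF cpX] by simp
  qed
  ultimately have fx0: "f x0 \<in> K" by simp
  have pre0: "pre x0 K = S" "pre x0 L = T"
    using gl_K[OF ST S1 T1] gl_L[OF ST S1 T1] ST unfolding x0_def closed_pair_def by auto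
  have min: "S \<subseteq> pre x K \<and> T \<subseteq> pre x L" if "x \<in> H" "f x \<in> K" for x
    using that by (auto simp: S_def T_def G_def)
  \<comment> \<open>\<open>R s\<close> consists of the elements connected to \<open>s\<close> by multiplying and dividing by letters
    from \<open>T\<close>; its complement in \<open>S\<close> again gives a closed pair, contradicting minimality.\<close>
  define R where "R = (\<lambda>s. {b \<in> S. \<exists>D. finite D \<and> D \<subseteq> T \<and>
      (\<forall>S' T'. closed_pair S' T' \<longrightarrow> b \<in> S' \<longrightarrow> D \<subseteq> T' \<longrightarrow> s \<in> S')})"
  have R: "closed_pair (S - R s) T" for s
  proof -
    have "b \<star> c \<in> R s \<longleftrightarrow> b \<in> R s" if bc: "b \<in> S" "c \<in> T" for b c
    proof
      have A: "b \<in> univ A" "c \<in> univ A" using bc ST by (auto simp: closed_pair_def)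
      show "b \<star> c \<in> R s" if "b \<in> R s"
      proof -
        obtain D where D: "finite D" "D \<subseteq> T"
          "\<And>S' T'. closed_pair S' T' \<Longrightarrow> b \<in> S' \<Longrightarrow> D \<subseteq> T' \<Longrightarrow> s \<in> S'"
          using \<open>b \<in> R s\<close> unfolding R_def by blast
        have "s \<in> S'" if "closed_pair S' T'" "b \<star> c \<in> S'" "D \<subseteq> T'" for S' T'
          using that D(3)[of S' T'] A by (simp add: closed_pair_def)
        moreover have "b \<star> c \<in> S" using bc A ST by (simp add: closed_pair_def)
        ultimately show ?thesis using D(1,2) unfolding R_def
          by (intro CollectI conjI exI[of _ D]) auto
      qed
      show "b \<in> R s" if "b \<star> c \<in> R s"
      proof -
        obtain D where D: "finite D" "D \<subseteq> T"
          "\<And>S' T'. closed_pair S' T' \<Longrightarrow> b \<star> c \<in> S' \<Longrightarrow> D \<subseteq> T' \<Longrightarrow> s \<in> S'"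
          using \<open>b \<star> c \<in> R s\<close> unfolding R_def by blast
        have "s \<in> S'" if "closed_pair S' T'" "b \<in> S'" "insert c D \<subseteq> T'" for S' T'
          using that D(3)[of S' T'] A by (simp add: closed_pair_def)
        then show ?thesis using D(1,2) bc unfolding R_def
          by (intro CollectI conjI exI[of _ "insert c D"]) auto
      qed
    qed
    then have "b \<star> c \<in> S - R s \<longleftrightarrow> b \<in> S - R s \<and> c \<in> T" if "b \<in> univ A" "c \<in> univ A" for b c
      using ST that by (auto simp: closed_pair_def)
    then show ?thesis using ST unfolding closed_pair_def by (intro conjI ballI) auto
  qed
  \<comment> \<open>Deleting \<open>R s\<close> deletes \<open>s\<close> itself from
    \<open>S\<close>, so by minimality \<open>f\<close> does not map \<open>y s\<close> into
    \<open>K\<close>.\<close>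
  define y where "y = (\<lambda>s. glue x1 (S - R s) T)"
  have subR: "S - R s \<subseteq> pre x1 K" for s using S1 by auto
  have yH: "y s \<in> H" for s unfolding y_def by (rule gl[OF R subR T1])
  have fy: "f (y s) \<notin> K" if "s \<in> S" for s
  proof
    assume "f (y s) \<in> K"
    then have "s \<in> pre (y s) K" using min[OF yH] that by auto
    then have "s \<in> S - R s" using gl_K[OF R subR T1, of s s] by (auto simp: y_def)
    moreover have "s \<in> R s" using that unfolding R_def by (auto intro!: exI[of _ "{}"])
    ultimately show False by simp
  qed
  \<comment> \<open>A product evaluating \<open>f\<close> at \<open>x0\<close> and at all these
    \<open>y s\<close> lies in \<open>S\<close> but not in \<open>S - R s\<close>; so it is
    connected to every \<open>s\<close> in \<open>F \<inter> S\<close>.\<close>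
  obtain b c where bc: "b \<in> univ A" "c \<in> univ A" "\<forall>x\<in>insert x0 (y ` (F \<inter> S)). f x = x (b \<star> c)"
    using local[of "insert x0 (y ` (F \<inter> S))"] finite_F x0 yH by blast
  have bcS: "b \<star> c \<in> S" using bc fx0 pre0(1) by auto
  have "b \<star> c \<in> R s" if "s \<in> F \<inter> S" for s
  proof (rule ccontr)
    assume "b \<star> c \<notin> R s"
    then have "y s (b \<star> c) \<in> K" using bcS bc gl_K[OF R subR T1, of "b \<star> c" s] by (auto simp: y_def)
    then show False using fy[of s] bc that by auto
  qed
  then have "\<forall>s\<in>F \<inter> S. \<exists>D. finite D \<and> D \<subseteq> T \<and>
      (\<forall>S' T'. closed_pair S' T' \<longrightarrow> b \<star> c \<in> S' \<longrightarrow> D \<subseteq> T' \<longrightarrow> s \<in> S')"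
    unfolding R_def by blast
  then obtain D where D: "\<forall>s\<in>F \<inter> S. finite (D s) \<and> D s \<subseteq> T \<and>
      (\<forall>S' T'. closed_pair S' T' \<longrightarrow> b \<star> c \<in> S' \<longrightarrow> D s \<subseteq> T' \<longrightarrow> s \<in> S')"
    by (elim bchoice[elim_format] exE)
  have D1: "finite (D s) \<and> D s \<subseteq> T" if "s \<in> F \<inter> S" for s
    using bspec[OF D that] by (elim conjE) (rule conjI)
  have D2: "s \<in> S'" if "s \<in> F \<inter> S" "closed_pair S' T'" "b \<star> c \<in> S'" "D s \<subseteq> T'" for s S' T'
    using bspec[OF D that(1)] that(2-4) by blast
  \<comment> \<open>Multiplication by the letters of \<open>E\<close> yields \<open>w\<close>. A
    closed pair whose state part contains \<open>w\<close> contains \<open>b \<star> c\<close> and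
    \<open>E\<close>; through the sets \<open>D s\<close> it then contains
    \<open>F \<inter> S\<close> and \<open>F \<inter> T\<close>.\<close>
  define E where "E = (\<Union>s\<in>F \<inter> S. D s) \<union> (F \<inter> T)"
  have "finite E" "E \<subseteq> T" using D1 finite_F by (auto simp: E_def)
  then obtain ds where ds: "set ds = E" "set ds \<subseteq> T" using finite_list by metis
  have dsA: "set ds \<subseteq> univ A" using ds(2) ST by (auto simp: closed_pair_def)
  define w where "w = foldl (\<star>) (b \<star> c) ds"
  have w_iff: "w \<in> S' \<longleftrightarrow> b \<star> c \<in> S' \<and> E \<subseteq> T'" if "closed_pair S' T'" for S' T'
    using closed_pair_foldl[OF that _ dsA, of "b \<star> c"] bc ds(1) by (simp add: w_def)
  have wS: "w \<in> S" using w_iff[OF ST] bcS ds by simp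
  have wA: "w \<in> univ A" using wS ST by (auto simp: closed_pair_def)
  have "\<exists>b'\<in>univ A. \<exists>c'\<in>univ A. w = b' \<star> c'"
  proof (cases ds rule: rev_cases)
    case Nil
    then show ?thesis using bc by (auto simp: w_def)
  next
    case (snoc es d)
    then show ?thesis using dsA bc closed_pair_foldl[OF ST, of "b \<star> c" es] by (auto simp: w_def)
  qed
  then obtain b' c' where w: "b' \<in> univ A" "c' \<in> univ A" "w = b' \<star> c'" by blast
  have iff: "f x \<in> K \<longleftrightarrow> x w \<in> K" if x: "x \<in> H" for x
  proof
    show "x w \<in> K" if "f x \<in> K" using min[OF x that] wS by auto
    assume "x w \<in> K"
    then have "w \<in> pre x K" using wA by simp
    then have *: "b \<star> c \<in> pre x K" "E \<subseteq> pre x L" using w_iff[OF closed_pair_pre[OF KL x]] by auto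
    \<comment> \<open>Intersecting with the pair of \<open>x\<close> loses nothing on
      \<open>F\<close>, so \<open>f\<close> maps the glued homomorphism into \<open>K\<close>; a
      product evaluating \<open>f\<close> there and at \<open>x\<close> carries this over to
      \<open>x\<close>.\<close>
    let ?S = "pre x K \<inter> S" and ?T = "pre x L \<inter> T"
    have cpx: "closed_pair ?S ?T" "?S \<subseteq> pre x1 K" "?T \<subseteq> pre x1 L"
      using closed_pair_Int[OF closed_pair_pre[OF KL x] ST] S1 T1 by auto
    have inS: "a \<in> pre x K" if "a \<in> F \<inter> S" for a
    proof (rule D2[OF that closed_pair_pre[OF KL x] *(1)])
      show "D a \<subseteq> pre x L" using *(2) that by (auto simp: E_def)
    qed
    have inT: "a \<in> pre x L" if "a \<in> F \<inter> T" for a using *(2) that by (auto simp: E_def)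
    have F_iff: "a \<in> S \<longleftrightarrow> a \<in> ?S" "a \<in> T \<longleftrightarrow> a \<in> ?T" if "a \<in> F" for a
      using inS inT that by (meson IntD2 IntI)+
    have "x0 a = glue x1 ?S ?T a" if "a \<in> F" for a
      unfolding x0_def by (rule glue_eqI[OF F_iff[OF that] refl])
    then have "f x0 = f (glue x1 ?S ?T)" using x0 gl[OF cpx] by (intro determined)
    then have fg: "f (glue x1 ?S ?T) \<in> K" using fx0 by simp
    obtain b c where bc: "b \<in> univ A" "c \<in> univ A" "\<forall>y\<in>{x, glue x1 ?S ?T}. f y = y (b \<star> c)"
      using local[of "{x, glue x1 ?S ?T}"] x gl[OF cpx] by blast
    have "b \<star> c \<in> ?S" using gl_K[OF cpx, of "b \<star> c"] fg bc by simp
    then show "f x \<in> K" using bc by simp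
  qed
  show ?thesis
    by (rule that[OF x0 fx0 w(1,2)]) (use iff w min pre0 in auto)
qed

section \<open>Evaluating elements for the different kinds of letters\<close>

lemma closed_pair_mult:
  assumes "closed_pair S T" "b \<in> S" "c \<in> T"
  shows "b \<in> univ A" "c \<in> univ A" "b \<star> c \<in> S"
proof -
  show *: "b \<in> univ A" "c \<in> univ A" using assms unfolding closed_pair_def by blast+
  then show "b \<star> c \<in> S" using assms unfolding closed_pair_def by simp
qed

text \<open>The zero map is evaluation at any square, as no element is both a state and a
  letter.\<close>

lemma evaluation_zero:
  assumes "\<And>x. x \<in> H \<Longrightarrow> f x \<notin> Q"
  shows "is_evaluation A M f"
proof -
  obtain b where b: "b \<in> univ A" using local[of "{}"] by auto
  have "f x = x (b \<star> b)" if "x \<in> H" for x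
    using assms[OF that] f_cases[OF that] hom_mult[OF that b b] by simp
  then show ?thesis using b unfolding is_evaluation_def by (intro bexI[of _ "b \<star> b"]) auto
qed

text \<open>One product evaluates \<open>f\<close> at both \<open>x\<close> and \<open>y\<close>.
  Statements about the values of \<open>f\<close> in \<open>K\<close> thereby become statements
  about values in \<open>Q\<close> at a homomorphism whose states \<open>h\<close> may be
  chosen.\<close>

lemma glue_pre:
  fixes h :: "'b \<Rightarrow> 'a"
  assumes KL: "stable K L" and x: "x \<in> H"
    and h: "\<And>b. b \<in> pre x K \<Longrightarrow> h b \<in> Q" "\<And>c. c \<in> pre x L \<Longrightarrow> h c \<in> \<Sigma>"
      "\<And>b c. b \<in> pre x K \<Longrightarrow> c \<in> pre x L \<Longrightarrow> h (b \<star> c) = h b \<odot> h c"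
  defines "y \<equiv> glue h (pre x K) (pre x L)"
  shows "y \<in> H" "\<And>a. a \<in> univ A \<Longrightarrow> y a \<in> Q \<longleftrightarrow> x a \<in> K" "\<And>a. a \<in> univ A \<Longrightarrow> x a \<in> K \<Longrightarrow> y a = h a"
    "f y \<in> Q \<longleftrightarrow> f x \<in> K" "f y \<in> Q \<Longrightarrow> \<exists>a\<in>pre x K. f y = h a"
proof -
  have cp: "closed_pair (pre x K) (pre x L)" by (rule closed_pair_pre[OF KL x])
  show y: "y \<in> H" unfolding y_def by (rule glue_hom[OF cp h])
  show yQ: "y a \<in> Q \<longleftrightarrow> x a \<in> K" if "a \<in> univ A" for a
    unfolding y_def using glue_state_iff[OF cp h(1,2) that] that by simp
  show yh: "y a = h a" if "a \<in> univ A" "x a \<in> K" for a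
    unfolding y_def by (rule glue_simps(1)[OF cp]) (use that in simp)
  obtain b c where bc: "b \<in> univ A" "c \<in> univ A" "\<forall>u\<in>{x, y}. f u = u (b \<star> c)"
    using local[of "{x, y}"] x y by blast
  have bcA: "b \<star> c \<in> univ A" using bc by simp
  show iff: "f y \<in> Q \<longleftrightarrow> f x \<in> K" using yQ[OF bcA] bc(3) by simp
  show "\<exists>a\<in>pre x K. f y = h a" if "f y \<in> Q"
    using that iff yh[OF bcA] bc(3) bcA by (intro bexI[of _ "b \<star> c"]) auto
qed

lemma f_eqI:
  assumes "w \<in> univ A" "\<And>x. x \<in> H \<Longrightarrow> f x = x w"
  shows "is_evaluation A M f"
  using assms unfolding is_evaluation_def by blast

lemma support_element:
  assumes "stable K L" "x1 \<in> H" "f x1 \<in> K"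
  obtains b c where "b \<in> univ A" "c \<in> univ A" "\<And>x. x \<in> H \<Longrightarrow> f x \<in> K \<longleftrightarrow> x (b \<star> c) \<in> K"
  by (rule support[OF assms], rule that)

lemma stable_Q:
  assumes "\<And>c s. c \<in> \<Sigma> \<Longrightarrow> s \<in> Q \<Longrightarrow> s \<odot> c = z \<longleftrightarrow> p \<odot> c = z"
  shows "stable Q {c \<in> \<Sigma>. p \<odot> c \<noteq> z}"
proof -
  have *: "s \<odot> c \<in> Q \<longleftrightarrow> s \<in> Q \<and> c \<in> {c \<in> \<Sigma>. p \<odot> c \<noteq> z}" for s c
  proof (cases "s \<in> Q \<and> c \<in> \<Sigma>")
    case True
    then show ?thesis using assms[of c s] by (simp add: mult_state_iff)
  next
    case False
    then have "s \<odot> c = z" using mult_nonzero by blast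
    then show ?thesis using False zero_fresh by auto
  qed
  show ?thesis unfolding stable_def by (intro conjI allI *) auto
qed

lemma stable_fixed:
  assumes "p \<in> Q" "\<And>c s. c \<in> \<Sigma> \<Longrightarrow> s \<in> Q \<Longrightarrow> s \<odot> c = p \<Longrightarrow> s = p"
  shows "stable {p} {c \<in> \<Sigma>. p \<odot> c = p}"
proof -
  have *: "s \<odot> c = p \<longleftrightarrow> s = p \<and> c \<in> \<Sigma> \<and> p \<odot> c = p" for s c
  proof
    assume sc: "s \<odot> c = p"
    then have "s \<in> Q" "c \<in> \<Sigma>" using mult_nonzero[of s c] assms(1) zero_fresh by auto
    moreover from this have "s = p" using assms(2) sc by simp
    ultimately show "s = p \<and> c \<in> \<Sigma> \<and> p \<odot> c = p" using sc by simp
  qed simp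
  show ?thesis unfolding stable_def singleton_iff mem_Collect_eq
    by (intro conjI allI *) (use assms(1) in auto)
qed

text \<open>The support element \<open>b \<star> c\<close> for the state \<open>p\<close> also
  serves for \<open>t\<close>: replacing the value \<open>t\<close> of \<open>x\<close> by
  \<open>p\<close>, and the letters fixing \<open>t\<close> by one letter fixing \<open>p\<close>,
  gives a homomorphism for which the criterion for \<open>p\<close> decides whether
  \<open>f x\<close> is \<open>t\<close>.\<close>

lemma evaluation_partial_identities:
  assumes Q: "Q = {p, t}" and letters: "\<And>c s. c \<in> \<Sigma> \<Longrightarrow> s \<in> Q \<Longrightarrow> s \<odot> c = s \<or> s \<odot> c = z"
    and x1: "x1 \<in> H" "f x1 = p"
  shows "is_evaluation A M f"
proof -
  have pt: "p \<in> Q" "t \<in> Q" using Q by auto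
  have fixed: "s' = s" if "c \<in> \<Sigma>" "s' \<in> Q" "s' \<odot> c = s" "s \<in> Q" for s s' c
    using letters[OF that(1,2)] that(3,4) zero_fresh by auto
  have st: "stable {s} {c \<in> \<Sigma>. s \<odot> c = s}" if "s \<in> Q" for s
    using that fixed by (intro stable_fixed) auto
  have fx1: "f x1 \<in> {p}" using x1 by simp
  obtain b c where bc: "b \<in> univ A" "c \<in> univ A"
    and w: "\<And>x. x \<in> H \<Longrightarrow> f x \<in> {p} \<longleftrightarrow> x (b \<star> c) \<in> {p}"
    by (rule support_element[OF st[OF pt(1)] x1(1) fx1], rule that)
  \<comment> \<open>A letter fixing \<open>p\<close> exists because \<open>p\<close> is the value of
    \<open>f\<close> at \<open>x1\<close> and hence a product.\<close>
  obtain b' c' where b'c': "b' \<in> univ A" "c' \<in> univ A" "f x1 = x1 (b' \<star> c')"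
    using local[of "{x1}"] x1(1) by auto
  define d where "d = x1 c'"
  have d1: "x1 b' \<odot> d = p" using b'c' x1 hom_mult by (simp add: d_def)
  then have d2: "x1 b' \<in> Q" "d \<in> \<Sigma>" using mult_nonzero[of "x1 b'" d] pt zero_fresh by auto
  then have "x1 b' = p" using fixed d1 pt(1) by blast
  then have d: "d \<in> \<Sigma>" "p \<odot> d = p" using d1 d2 by auto
  have "f x = x (b \<star> c)" if x: "x \<in> H" for x
  proof -
    let ?K = "{t}" and ?L = "{c \<in> \<Sigma>. t \<odot> c = t}"
    let ?h = "\<lambda>a. if a \<in> pre x ?K then p else d"
    let ?y = "glue ?h (pre x ?K) (pre x ?L)"
    have cp: "closed_pair (pre x ?K) (pre x ?L)" by (rule closed_pair_pre[OF st[OF pt(2)] x])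
    have h: "\<And>b. b \<in> pre x ?K \<Longrightarrow> ?h b \<in> Q" "\<And>c. c \<in> pre x ?L \<Longrightarrow> ?h c \<in> \<Sigma>"
      "\<And>b c. b \<in> pre x ?K \<Longrightarrow> c \<in> pre x ?L \<Longrightarrow> ?h (b \<star> c) = ?h b \<odot> ?h c"
      using pt d cp disjoint hom_mult[OF x] by auto
    note y = glue_pre[OF st[OF pt(2)] x, of ?h, OF h]
    have "f ?y \<in> Q \<longleftrightarrow> f ?y = p" using y(5) pt by auto
    moreover have "?y (b \<star> c) \<in> Q \<longleftrightarrow> ?y (b \<star> c) = p"
      using y(2)[of "b \<star> c"] y(3)[of "b \<star> c"] bc pt by auto
    ultimately have "f x = t \<longleftrightarrow> x (b \<star> c) = t"
      using y(2)[of "b \<star> c"] y(4) w[OF y(1)] bc by simp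
    moreover have "f x = p \<longleftrightarrow> x (b \<star> c) = p" using w[OF x] by simp
    ultimately show ?thesis
      using f_cases[OF x] hom_mult_cases[OF x bc] Q by auto
  qed
  then show ?thesis using bc by (intro f_eqI[of "b \<star> c"]) auto
qed

lemma evaluation_one_constant:
  assumes Q: "Q = {p, t}" "p \<noteq> t"
    and letters: "\<And>c. c \<in> \<Sigma> \<Longrightarrow>
      p \<odot> c = z \<and> t \<odot> c = z \<or> p \<odot> c = p \<and> t \<odot> c = t \<or> p \<odot> c = t \<and> t \<odot> c = t"
    and x1: "x1 \<in> H" "f x1 \<in> Q"
  shows "is_evaluation A M f"
proof -
  have pt: "p \<noteq> z" "t \<noteq> z" "p \<in> Q" using Q zero_fresh by auto
  have 1: "stable Q {c \<in> \<Sigma>. p \<odot> c \<noteq> z}" using letters pt Q by (intro stable_Q) fastforce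
  have 2: "stable {p} {c \<in> \<Sigma>. p \<odot> c = p}" using letters pt Q by (intro stable_fixed) fastforce+
  obtain b c where bc: "b \<in> univ A" "c \<in> univ A"
    and w: "\<And>x. x \<in> H \<Longrightarrow> f x \<in> Q \<longleftrightarrow> x (b \<star> c) \<in> Q"
    by (rule support_element[OF 1 x1], rule that)
  have "f x = x (b \<star> c)" if x: "x \<in> H" for x
  proof -
    have h: "\<And>b. b \<in> pre x {p} \<Longrightarrow> x b \<in> Q" "\<And>c'. c' \<in> pre x {c \<in> \<Sigma>. p \<odot> c = p} \<Longrightarrow> x c' \<in> \<Sigma>"
      "\<And>b c'. b \<in> pre x {p} \<Longrightarrow> c' \<in> pre x {c \<in> \<Sigma>. p \<odot> c = p} \<Longrightarrow> x (b \<star> c') = x b \<odot> x c'"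
      using pt hom_mult[OF x] by auto
    note y = glue_pre[OF 2 x, of x, OF h]
    have "f x = p \<longleftrightarrow> x (b \<star> c) = p" using y(2)[of "b \<star> c"] y(4) w[OF y(1)] bc by simp
    then show ?thesis using w[OF x] f_cases[OF x] hom_mult_cases[OF x bc] Q(1) by auto
  qed
  then show ?thesis using bc by (intro f_eqI[of "b \<star> c"]) auto
qed

text \<open>A nonzero product depends only on its last letter, so the left factor may be replaced by
  the support element \<open>w\<close>. The candidates are therefore the elements
  \<open>w \<star> d\<close> with \<open>d\<close> in \<open>T\<close>.\<close>

lemma evaluation_constants:
  assumes Q: "Q = {p, t}" "p \<noteq> t" and letters: "\<And>c. c \<in> \<Sigma> \<Longrightarrow> p \<odot> c = t \<odot> c"
    and x1: "x1 \<in> H" "f x1 \<in> Q"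
  shows "is_evaluation A M f"
proof -
  let ?L = "{c \<in> \<Sigma>. p \<odot> c \<noteq> z}"
  have pt: "p \<noteq> z" "t \<noteq> z" "p \<in> Q" "t \<in> Q" using Q zero_fresh by auto
  have act: "s \<odot> c = p \<odot> c" if "s \<in> Q" "c \<in> \<Sigma>" for s c using that letters Q by auto
  have KL: "stable Q ?L" using act by (intro stable_Q) simp
  obtain x0 b c where x0: "x0 \<in> H" "f x0 \<in> Q" and bc: "b \<in> univ A" "c \<in> univ A"
    and w': "\<And>x. x \<in> H \<Longrightarrow> f x \<in> Q \<longleftrightarrow> x (b \<star> c) \<in> Q"
    and min: "\<And>x. x \<in> H \<Longrightarrow> f x \<in> Q \<Longrightarrow> pre x0 Q \<subseteq> pre x Q \<and> pre x0 ?L \<subseteq> pre x ?L"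
    by (rule support[OF KL x1], rule that)
  define w where "w = b \<star> c"
  have wA: "w \<in> univ A" using bc by (simp add: w_def)
  have w: "f x \<in> Q \<longleftrightarrow> x w \<in> Q" if "x \<in> H" for x using w'[OF that] by (simp add: w_def)
  have wz: "x w = z" if "x \<in> H" "f x \<notin> Q" for x
    using hom_mult_cases[OF that(1) bc] w[OF that(1)] that(2) by (simp add: w_def)
  define S where "S = pre x0 Q"
  define T where "T = pre x0 ?L"
  have cp: "closed_pair S T" unfolding S_def T_def by (rule closed_pair_pre[OF KL x0(1)])
  have wS: "w \<in> S" using w[OF x0(1)] x0(2) wA by (simp add: S_def)
  have TA: "T \<subseteq> univ A" by (auto simp: T_def)
  have S: "x a \<in> Q" if "x \<in> H" "f x \<in> Q" "a \<in> S" for x a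
    using min[OF that(1,2)] that(3) by (auto simp: S_def)
  have T: "x a \<in> ?L" if "x \<in> H" "f x \<in> Q" "a \<in> T" for x a
    using min[OF that(1,2)] that(3) by (auto simp: T_def)
  have prod: "d \<in> T \<and> (\<forall>x\<in>H. f x \<in> Q \<longrightarrow> x (e \<star> d) = x (w \<star> d))"
    if "e \<in> univ A" "d \<in> univ A" "e \<star> d \<in> S" for e d
  proof -
    have ed: "e \<in> S" "d \<in> T" using cp that by (auto simp: closed_pair_def)
    have "x (e \<star> d) = x (w \<star> d)" if "x \<in> H" "f x \<in> Q" for x
      using act[OF S[OF that ed(1)]] act[OF S[OF that wS]] T[OF that ed(2)]
        hom_mult[OF that(1)] \<open>e \<in> univ A\<close> \<open>d \<in> univ A\<close> wA by simp
    then show ?thesis using ed by blast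
  qed
  define C where "C = (\<lambda>d. w \<star> d) ` T"
  have CA: "C \<subseteq> univ A" using wA TA by (auto simp: C_def)
  have C_zero: "x (w \<star> d) = z" if "x \<in> H" "f x \<notin> Q" "d \<in> T" for x d
    using wz[OF that(1,2)] hom_mult[OF that(1) wA, of d] that(3) TA by auto
  have loc: "\<exists>a\<in>C. \<forall>x\<in>X. f x = x a" if X: "finite X" "X \<subseteq> H" for X
  proof -
    obtain e d where ed: "e \<in> univ A" "d \<in> univ A" "\<forall>x\<in>insert x0 X. f x = x (e \<star> d)"
      using local[of "insert x0 X"] X x0(1) by auto
    then have "e \<star> d \<in> S" using x0(2) by (simp add: S_def)
    note p = prod[OF ed(1,2) this]
    have "f x = x (w \<star> d)" if "x \<in> X" for x
    proof (cases "f x \<in> Q")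
      case True
      then show ?thesis using p ed(3) X(2) that by auto
    next
      case False
      then show ?thesis using C_zero[of x d] p f_cases[of x] X(2) that by auto
    qed
    then show ?thesis using p by (auto simp: C_def)
  qed
  have C_eqI: "w \<star> d = w \<star> d'"
    if "d \<in> T" "d' \<in> T" "\<And>x. x \<in> H \<Longrightarrow> f x \<in> Q \<Longrightarrow> x (w \<star> d) = x (w \<star> d')" for d d'
  proof (rule separating)
    show "w \<star> d \<in> univ A" "w \<star> d' \<in> univ A" using that(1,2) wA TA by auto
    show "x (w \<star> d) = x (w \<star> d')" if "x \<in> H" for x
      using that C_zero[OF that] \<open>d \<in> T\<close> \<open>d' \<in> T\<close> \<open>\<And>x. x \<in> H \<Longrightarrow> f x \<in> Q \<Longrightarrow> x (w \<star> d) = x (w \<star> d')\<close>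
      by (cases "f x \<in> Q") auto
  qed
  \<comment> \<open>Different factorisations of one element of \<open>S\<close> lead to the same
    candidate. This makes values prescribed on candidates well defined on all products in
    \<open>S\<close>.\<close>
  have prod_eq: "w \<star> d = w \<star> d'"
    if ed: "e \<in> univ A" "d \<in> univ A" "e' \<in> univ A" "d' \<in> univ A" "e \<star> d = e' \<star> d'" "e \<star> d \<in> S"
    for e d e' d'
  proof (rule C_eqI)
    note 1 = prod[OF ed(1,2,6)] and 2 = prod[OF ed(3,4) ed(6)[unfolded ed(5)]]
    show "d \<in> T" "d' \<in> T" using 1 2 by blast+
    fix x assume x: "x \<in> H" "f x \<in> Q"
    have "x (e \<star> d) = x (w \<star> d)" "x (e' \<star> d') = x (w \<star> d')" using 1 2 x by blast+
    then show "x (w \<star> d) = x (w \<star> d')" using ed(5) by simp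
  qed
  show ?thesis
  proof (cases "\<exists>cp\<in>\<Sigma>. \<exists>ct\<in>\<Sigma>. p \<odot> cp = p \<and> p \<odot> ct = t")
    case False
    have L_eq: "p \<odot> c = p \<odot> c'" if "c \<in> ?L" "c' \<in> ?L" for c c'
      using that False mult_state_iff[of p c] mult_state_iff[of p c'] Q(1) by auto
    have C_one: "w \<star> d = w \<star> d'" if d: "d \<in> T" "d' \<in> T" for d d'
    proof (rule C_eqI[OF d])
      fix x assume x: "x \<in> H" "f x \<in> Q"
      have "x (w \<star> e) = p \<odot> x e" if "e \<in> T" for e
      proof -
        have "x (w \<star> e) = x w \<odot> x e" using that TA by (intro hom_mult[OF x(1) wA]) auto
        also have "\<dots> = p \<odot> x e" by (rule act) (use S[OF x wS] T[OF x that] in auto)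
        finally show ?thesis .
      qed
      then show "x (w \<star> d) = x (w \<star> d')" using L_eq[OF T[OF x d(1)] T[OF x d(2)]] d by simp
    qed
    have "finite C"
    proof (cases "T = {}")
      case True
      then show ?thesis by (simp add: C_def)
    next
      case False
      then obtain d0 where d0: "d0 \<in> T" by blast
      have "C \<subseteq> {w \<star> d0}" unfolding C_def using C_one[OF _ d0] by blast
      then show ?thesis by (rule finite_subset) simp
    qed
    then show ?thesis by (intro evaluation_if_finite_candidates[where X = "{}"
      and E = C, OF CA loc]) auto
  next
    case True
    then obtain cp ct where cpt: "cp \<in> \<Sigma>" "ct \<in> \<Sigma>" "p \<odot> cp = p" "p \<odot> ct = t" by blast
    \<comment> \<open>The values of a homomorphism at the elements \<open>w \<star> d\<close> of \<open>C\<close> can be prescribed freely; by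
      continuity \<open>f\<close> depends on finitely many of them only, so it is one of these coordinates.\<close>
    define h where "h = (\<lambda>W a. if a \<in> T then (if w \<star> a \<in> W then cp else ct)
      else (if \<exists>e\<in>univ A. \<exists>d\<in>univ A. a = e \<star> d \<and> w \<star> d \<in> W then p else t))"
    have ST: "a \<notin> T" if "a \<in> S" for a using that cp by (auto simp: closed_pair_def)
    have h_prod: "h W (e \<star> d) = (if w \<star> d \<in> W then p else t)"
      if ed: "e \<star> d \<in> S" "e \<in> univ A" "d \<in> univ A" for W e d
    proof -
      have "(\<exists>e'\<in>univ A. \<exists>d'\<in>univ A. e \<star> d = e' \<star> d' \<and> w \<star> d' \<in> W) \<longleftrightarrow> w \<star> d \<in> W"
      proof
        assume "\<exists>e'\<in>univ A. \<exists>d'\<in>univ A. e \<star> d = e' \<star> d' \<and> w \<star> d' \<in> W"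
        then obtain e' d' where *: "e' \<in> univ A" "d' \<in> univ A" "e \<star> d = e' \<star> d'" "w \<star> d' \<in> W"
          by blast
        then show "w \<star> d \<in> W" using prod_eq[OF ed(2,3) *(1-3) ed(1)] by simp
      qed (use ed in blast)
      then show ?thesis unfolding h_def
        using ST[OF ed(1)] by (simp only: if_False if_True simp_thms)
    qed
    have hS: "h W e \<in> Q" if "e \<in> S" for W e using ST[OF that] pt by (simp add: h_def)
    have hT: "h W d \<in> \<Sigma>" if "d \<in> T" for W d using that cpt by (simp add: h_def)
    have hm: "h W (e \<star> d) = h W e \<odot> h W d" if ed: "e \<in> S" "d \<in> T" for W e d
    proof -
      note A = closed_pair_mult[OF cp ed]
      have "h W d = (if w \<star> d \<in> W then cp else ct)" using ed(2) by (simp add: h_def)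
      then show ?thesis
        using h_prod[OF A(3,1,2)] act[OF hS[OF ed(1)] hT[OF ed(2)], of W W] cpt by simp
    qed
    have y: "glue (h W) S T \<in> H" for W by (rule glue_hom[OF cp hS hT hm])
    have y_prod: "glue (h W) S T (w \<star> d) = (if w \<star> d \<in> W then p else t)" if "d \<in> T" for W d
    proof -
      note d = closed_pair_mult(2,3)[OF cp wS that]
      show ?thesis using h_prod[OF d(2) wA d(1)] glue_simps(1)[OF cp d(2)] by simp
    qed
    define last_letter where "last_letter = (\<lambda>a. SOME d. \<exists>e. a = e \<star> d \<and> e \<in> univ A \<and> d \<in> univ A)"
    \<comment> \<open>The finitely many candidates visible on \<open>F\<close>. Shrinking the set of
      candidates with value \<open>p\<close> from everything to \<open>W\<close> is not noticed on
      \<open>F\<close>, so \<open>f\<close> keeps the value \<open>p\<close>, and the evaluating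
      candidate must lie in \<open>W\<close>.\<close>
    define W where "W = (\<lambda>d. w \<star> d) ` (F \<inter> T) \<union> (\<lambda>a. w \<star> last_letter a) ` (F \<inter> S)"
    have "finite W" using finite_F by (simp add: W_def)
    have W_prod: "w \<star> d \<in> W" if "e \<star> d \<in> F \<inter> S" "e \<in> univ A" "d \<in> univ A" for e d
    proof -
      have "\<exists>e'. e \<star> d = e' \<star> last_letter (e \<star> d) \<and> e' \<in> univ A \<and> last_letter (e \<star> d) \<in> univ A"
        unfolding last_letter_def by (rule someI[of _ d]) (use that in blast)
      then obtain e' where e': "e \<star> d = e' \<star> last_letter (e \<star> d)" "e' \<in> univ A"
        "last_letter (e \<star> d) \<in> univ A"
        by blast
      have "w \<star> d = w \<star> last_letter (e \<star> d)"
        by (rule prod_eq[OF that(2,3) e'(2,3,1)]) (use that(1) in blast)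
      then show ?thesis using that(1) by (auto simp: W_def)
    qed
    have "glue (h W) S T a = glue (h UNIV) S T a" if a: "a \<in> F" for a
    proof (rule glue_eqI)
      assume "a \<in> S \<union> T"
      then consider "a \<in> T" | "a \<in> S" "\<exists>e\<in>univ A. \<exists>d\<in>univ A. a = e \<star> d"
        | "a \<notin> T" "\<not> (\<exists>e\<in>univ A. \<exists>d\<in>univ A. a = e \<star> d)" using ST by blast
      then show "h W a = h UNIV a"
      proof cases
        case 1
        then have "w \<star> a \<in> W" using a by (auto simp: W_def)
        then show ?thesis using 1 by (simp add: h_def)
      next
        case 2
        then obtain e d where ed: "e \<in> univ A" "d \<in> univ A" "a = e \<star> d" by blast
        then have "e \<star> d \<in> F \<inter> S" using 2(1) a by simp
        then show ?thesis using W_prod[OF _ ed(1,2)] h_prod[OF _ ed(1,2)] ed(3) by simp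
      next
        case 3
        then have "\<not> (\<exists>e\<in>univ A. \<exists>d\<in>univ A. a = e \<star> d \<and> w \<star> d \<in> W')" for W' by blast
        then show ?thesis using 3(1) unfolding h_def by (simp only: if_False)
      qed
    qed auto
    then have "f (glue (h W) S T) = f (glue (h UNIV) S T)" by (intro determined y)
    moreover have "f (glue (h UNIV) S T) = p"
      using loc[of "{glue (h UNIV) S T}"] y[of UNIV] y_prod[of _ UNIV] by (auto simp: C_def)
    ultimately have fW: "f (glue (h W) S T) = p" by simp
    show ?thesis
    proof (rule evaluation_if_finite_candidates[where X = "{glue (h W) S T}" and E = W, OF CA loc])
      fix a assume a: "a \<in> C" "\<forall>x\<in>{glue (h W) S T}. f x = x a"
      then obtain d where d: "d \<in> T" "a = w \<star> d" by (auto simp: C_def)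
      have "glue (h W) S T (w \<star> d) = p" using a(2) fW d(2) by simp
      then have "w \<star> d \<in> W" using y_prod[OF d(1), of W] Q(2) by (simp split: if_splits)
      then show "a \<in> W" using d(2) by simp
    qed (use y \<open>finite W\<close> in simp_all)
  qed
qed

end

text \<open>A linear functional over the field with two elements that vanishes where finitely many
  coordinates \<open>e _ c\<close> vanish is a sum of these coordinates.\<close>

lemma xor_functional_sum:
  assumes "finite D" "D \<subseteq> T"
    and add: "\<And>x y. x \<in> X \<Longrightarrow> y \<in> X \<Longrightarrow>
      \<exists>u\<in>X. (\<forall>c\<in>T. e u c \<longleftrightarrow> e x c \<noteq> e y c) \<and> (h u \<longleftrightarrow> h x \<noteq> h y)"
    and "\<And>x. x \<in> X \<Longrightarrow> \<forall>c\<in>D. \<not> e x c \<Longrightarrow> \<not> h x"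
  shows "\<exists>ds. set ds \<subseteq> D \<and> (\<forall>x\<in>X. h x \<longleftrightarrow> odd (length (filter (e x) ds)))"
  using assms
proof (induction D arbitrary: h rule: finite_induct)
  case empty
  then show ?case by (intro exI[of _ "[]"]) auto
next
  case (insert d D)
  show ?case
  proof (cases "\<exists>v\<in>X. (\<forall>c\<in>D. \<not> e v c) \<and> h v")
    case True
    then obtain v where v: "v \<in> X" "\<forall>c\<in>D. \<not> e v c" "h v" by blast
    then have "e v d" using insert.prems(3)[of v] by auto
    \<comment> \<open>Coordinate \<open>d\<close> is subtracted from \<open>h\<close>. If
      \<open>x\<close> vanishes on \<open>D\<close> but not at \<open>d\<close>, then the sum of
      \<open>x\<close> and \<open>v\<close> vanishes on \<open>insert d D\<close>, so
      \<open>h\<close> takes the same value at \<open>x\<close> as at \<open>v\<close>.\<close>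
    let ?h = "\<lambda>x. h x \<noteq> e x d"
    have "\<exists>ds. set ds \<subseteq> D \<and> (\<forall>x\<in>X. ?h x \<longleftrightarrow> odd (length (filter (e x) ds)))"
    proof (rule insert.IH)
      show "D \<subseteq> T" using insert.prems(1) by simp
      fix x y assume xy: "x \<in> X" "y \<in> X"
      obtain u where "u \<in> X" "\<forall>c\<in>T. e u c \<longleftrightarrow> e x c \<noteq> e y c" "h u \<longleftrightarrow> h x \<noteq> h y"
        using insert.prems(2)[OF xy] by blast
      then show "\<exists>u\<in>X. (\<forall>c\<in>T. e u c \<longleftrightarrow> e x c \<noteq> e y c) \<and> (?h u \<longleftrightarrow> ?h x \<noteq> ?h y)"
        using insert.prems(1) by (intro bexI[of _ u]) auto
    next
      fix x assume x: "x \<in> X" "\<forall>c\<in>D. \<not> e x c"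
      obtain u where u: "u \<in> X" "\<forall>c\<in>T. e u c \<longleftrightarrow> e x c \<noteq> e v c" "h u \<longleftrightarrow> h x \<noteq> h v"
        using insert.prems(2)[OF x(1) v(1)] by blast
      show "\<not> ?h x"
      proof (cases "e x d")
        case True
        have "\<forall>c\<in>insert d D. \<not> e u c" using u(2) True \<open>e v d\<close> x(2) v(2) insert.prems(1) by auto
        then show ?thesis using insert.prems(3)[OF u(1)] u(3) v(3) True by simp
      next
        case False
        then show ?thesis using insert.prems(3)[OF x(1)] x(2) by simp
      qed
    qed
    then obtain ds where ds: "set ds \<subseteq> D" "\<forall>x\<in>X. ?h x \<longleftrightarrow> odd (length (filter (e x) ds))" by blast
    then show ?thesis by (intro exI[of _ "d # ds"]) auto
  next
    case False
    then have "\<exists>ds. set ds \<subseteq> D \<and> (\<forall>x\<in>X. h x \<longleftrightarrow> odd (length (filter (e x) ds)))"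
      using insert.prems(1,2) by (intro insert.IH) auto
    then show ?thesis by blast
  qed
qed

section \<open>Letters acting by permutations\<close>

context local_product
begin

text \<open>The support element \<open>w\<close> decides where \<open>f\<close> is nonzero; the
  remaining error is whether \<open>f x\<close> is the other state than \<open>x w\<close>.
  Multiplying \<open>w\<close> by a word of letters changes its value according to the parity of the
  flips, so a word with the right parity for all \<open>x\<close> is sought.\<close>

lemma evaluation_permutations:
  assumes Q: "Q = {p, t}" "p \<noteq> t"
    and letters: "\<And>c. c \<in> \<Sigma> \<Longrightarrow>
      p \<odot> c = z \<and> t \<odot> c = z \<or> p \<odot> c = p \<and> t \<odot> c = t \<or> p \<odot> c = t \<and> t \<odot> c = p"
    and x1: "x1 \<in> H" "f x1 \<in> Q"
  shows "is_evaluation A M f"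
proof -
  let ?L = "{c \<in> \<Sigma>. p \<odot> c \<noteq> z}"
  have pt: "p \<noteq> z" "t \<noteq> z" "p \<in> Q" "t \<in> Q" using Q zero_fresh by auto
  define other where "other = (\<lambda>s. if s = p then t else p)"
  have act: "s \<odot> c = (if p \<odot> c = t then other s else s)" if "s \<in> Q" "c \<in> ?L" for s c
    using that letters[of c] Q by (auto simp: other_def)
  have other: "other s \<in> Q" "other (other s) = s" "other s \<noteq> s" if "s \<in> Q" for s
    using that Q by (auto simp: other_def)
  have other_unique: "s = s' \<or> s = other s'" if "s \<in> Q" "s' \<in> Q" for s s'
    using that Q by (auto simp: other_def)
  have KL: "stable Q ?L"
  proof (rule stable_Q)
    fix c s assume "c \<in> \<Sigma>" "s \<in> Q"
    then show "s \<odot> c = z \<longleftrightarrow> p \<odot> c = z" using letters[of c] Q(1) pt by auto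
  qed
  obtain x0 b c where x0: "x0 \<in> H" "f x0 \<in> Q" and bc: "b \<in> univ A" "c \<in> univ A"
    and w': "\<And>x. x \<in> H \<Longrightarrow> f x \<in> Q \<longleftrightarrow> x (b \<star> c) \<in> Q"
    and min: "\<And>x. x \<in> H \<Longrightarrow> f x \<in> Q \<Longrightarrow> pre x0 Q \<subseteq> pre x Q \<and> pre x0 ?L \<subseteq> pre x ?L"
    by (rule support[OF KL x1], rule that)
  define w where "w = b \<star> c"
  have wA: "w \<in> univ A" using bc by (simp add: w_def)
  have w: "f x \<in> Q \<longleftrightarrow> x w \<in> Q" if "x \<in> H" for x using w'[OF that] by (simp add: w_def)
  have wz: "x w = z" if "x \<in> H" "f x \<notin> Q" for x
    using hom_mult_cases[OF that(1) bc] w[OF that(1)] that(2) by (simp add: w_def)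
  define S where "S = pre x0 Q"
  define T where "T = pre x0 ?L"
  have cp: "closed_pair S T" unfolding S_def T_def by (rule closed_pair_pre[OF KL x0(1)])
  have wS: "w \<in> S" using w[OF x0(1)] x0(2) wA by (simp add: S_def)
  have SA: "S \<subseteq> univ A" and TA: "T \<subseteq> univ A" by (auto simp: S_def T_def)
  have S: "x a \<in> Q" if "x \<in> H" "f x \<in> Q" "a \<in> S" for x a
    using min[OF that(1,2)] that(3) by (auto simp: S_def)
  have T: "x a \<in> ?L" if "x \<in> H" "f x \<in> Q" "a \<in> T" for x a
    using min[OF that(1,2)] that(3) by (auto simp: T_def)
  define word where "word = foldl (\<star>) w"
  define flips where "flips = (\<lambda>(x :: 'b \<Rightarrow> 'a) ds. odd (length (filter (\<lambda>d. p \<odot> x d = t) ds)))"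
  have word: "word ds \<in> univ A" "word ds \<in> S" if "set ds \<subseteq> T" for ds
    using closed_pair_foldl[OF cp wA, of ds] that TA wS by (auto simp: word_def)
  have word_snoc: "word (ds @ [d]) = word ds \<star> d" for ds d by (simp add: word_def)
  have x_word: "x (word ds) = (if flips x ds then other (x w) else x w)"
    if x: "x \<in> H" "f x \<in> Q" and ds: "set ds \<subseteq> T" for x ds
    using ds
  proof (induction ds rule: rev_induct)
    case Nil
    then show ?case by (simp add: word_def flips_def)
  next
    case (snoc d ds)
    then have d: "d \<in> T" "d \<in> univ A" "set ds \<subseteq> T" using TA by auto
    have "x (word (ds @ [d])) = x (word ds) \<odot> x d"
      unfolding word_snoc by (rule hom_mult[OF x(1) word(1)[OF d(3)] d(2)])
    also have "\<dots> = (if p \<odot> x d = t then other (x (word ds)) else x (word ds))"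
      by (rule act[OF S[OF x word(2)[OF d(3)]] T[OF x d(1)]])
    finally show ?case
      using snoc.IH[OF d(3)] other[OF S[OF x wS]] by (simp add: flips_def)
  qed
  have z_word: "x (word ds) = z" if x: "x \<in> H" "f x \<notin> Q" and ds: "set ds \<subseteq> T" for x ds
    using ds
  proof (induction ds rule: rev_induct)
    case Nil
    then show ?case using wz[OF x] by (simp add: word_def)
  next
    case (snoc d ds)
    then have d: "d \<in> univ A" "set ds \<subseteq> T" using TA by auto
    then show ?case using snoc.IH hom_mult[OF x(1) word(1)[OF d(2)] d(1)] by (simp add: word_snoc)
  qed
  \<comment> \<open>\<open>S'\<close> consists of the elements that no homomorphism with
    \<open>f x\<close> in \<open>Q\<close> distinguishes from some word. Together with
    \<open>T\<close> it is a closed pair containing \<open>w\<close>, so minimality of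
    \<open>S\<close> gives \<open>S' = S\<close>.\<close>
  define S' where "S' = {b \<in> S. \<exists>ds. set ds \<subseteq> T \<and> (\<forall>x\<in>H. f x \<in> Q \<longrightarrow> x b = x (word ds))}"
  have word_step: "x (word (ds @ [c])) = x (word ds) \<odot> x c"
    if "x \<in> H" "set ds \<subseteq> T" "c \<in> T" for x ds c
    unfolding word_snoc using hom_mult[OF that(1) word(1)[OF that(2)]] that(3) TA by auto
  have S'_mult: "b \<star> c \<in> S' \<longleftrightarrow> b \<in> S'" if bc: "b \<in> S" "c \<in> T" for b c
  proof
    note A = closed_pair_mult[OF cp bc]
    show "b \<star> c \<in> S'" if b: "b \<in> S'"
    proof -
      obtain ds where ds: "set ds \<subseteq> T" "\<forall>x\<in>H. f x \<in> Q \<longrightarrow> x b = x (word ds)"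
        using b by (auto simp: S'_def)
      have "x (b \<star> c) = x (word (ds @ [c]))" if "x \<in> H" "f x \<in> Q" for x
      proof -
        have "x b = x (word ds)" using ds(2) that by blast
        then show ?thesis
          using hom_mult[OF that(1) A(1,2)] word_step[OF that(1) ds(1) bc(2)] by simp
      qed
      then show ?thesis using A(3) ds(1) bc(2) unfolding S'_def
        by (intro CollectI conjI exI[of _ "ds @ [c]"]) auto
    qed
    show "b \<in> S'" if b: "b \<star> c \<in> S'"
    proof -
      obtain ds where ds: "set ds \<subseteq> T" "\<forall>x\<in>H. f x \<in> Q \<longrightarrow> x (b \<star> c) = x (word ds)"
        using b by (auto simp: S'_def)
      \<comment> \<open>The letters in \<open>?L\<close> act as involutions or the identity, so
        multiplying by \<open>c\<close> once more undoes the multiplication.\<close>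
      have "x b = x (word (ds @ [c]))" if x: "x \<in> H" "f x \<in> Q" for x
      proof -
        have "x (b \<star> c) = x (word ds)" using ds(2) x by blast
        then have "x (word (ds @ [c])) = x b \<odot> x c \<odot> x c"
          using hom_mult[OF x(1) A(1,2)] word_step[OF x(1) ds(1) bc(2)] by simp
        moreover have "x b \<odot> x c \<in> Q" using S[OF x A(3)] hom_mult[OF x(1) A(1,2)] by simp
        ultimately show ?thesis
          using act[OF _ T[OF x bc(2)], of "x b"] act[OF _ T[OF x bc(2)], of "x b \<odot> x c"]
            S[OF x bc(1)] other by (simp split: if_splits)
      qed
      then show ?thesis using bc ds(1) unfolding S'_def
        by (intro CollectI conjI exI[of _ "ds @ [c]"]) auto
    qed
  qed
  have cp': "closed_pair S' T"
  proof -
    have "b \<star> c \<in> S' \<longleftrightarrow> b \<in> S' \<and> c \<in> T" if "b \<in> univ A" "c \<in> univ A" for b c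
    proof (cases "b \<in> S \<and> c \<in> T")
      case True
      then show ?thesis using S'_mult by simp
    next
      case False
      then have "b \<star> c \<notin> S" using cp that by (simp add: closed_pair_def)
      then show ?thesis using False by (auto simp: S'_def)
    qed
    moreover have "S' \<subseteq> S" by (auto simp: S'_def)
    ultimately show ?thesis using cp unfolding closed_pair_def by (intro conjI ballI) auto
  qed
  have S'S: "S' = S"
  proof
    show "S' \<subseteq> S" by (auto simp: S'_def)
    then have *: "S' \<subseteq> pre x0 Q" "T \<subseteq> pre x0 \<Sigma>" by (auto simp: S_def T_def)
    have y: "glue x0 S' T \<in> H" by (rule glue_restrict_hom[OF cp' x0(1) *])
    have yQ: "glue x0 S' T a \<in> Q \<longleftrightarrow> a \<in> S'" if "a \<in> univ A" for a
      by (rule glue_state_iff[OF cp']) (use * that in auto)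
    have "w \<in> S'" using wS unfolding S'_def
      by (intro CollectI conjI exI[of _ "[]"]) (auto simp: word_def)
    then have "f (glue x0 S' T) \<in> Q" using w[OF y] yQ[OF wA] by simp
    then have "S \<subseteq> pre (glue x0 S' T) Q" using min[OF y] by (simp add: S_def)
    then show "S \<subseteq> S'" using yQ by auto
  qed
  have S_word: "\<exists>ds. set ds \<subseteq> T \<and> (\<forall>x\<in>H. f x \<in> Q \<longrightarrow> x b = x (word ds))" if "b \<in> S" for b
  proof -
    have "b \<in> S'" using that by (simp only: S'S)
    then show ?thesis unfolding S'_def by (elim CollectE conjE)
  qed
  have loc: "\<exists>ds. set ds \<subseteq> T \<and> (\<forall>x\<in>X. f x = x (word ds))" if X: "finite X" "X \<subseteq> H" for X
  proof -
    obtain e d where ed: "e \<in> univ A" "d \<in> univ A" "\<forall>x\<in>insert x0 X. f x = x (e \<star> d)"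
      using local[of "insert x0 X"] X x0(1) by auto
    then have "e \<star> d \<in> S" using x0(2) by (simp add: S_def)
    then obtain ds where ds: "set ds \<subseteq> T" "\<forall>x\<in>H. f x \<in> Q \<longrightarrow> x (e \<star> d) = x (word ds)"
      using S_word by blast
    have "f x = x (word ds)" if "x \<in> X" for x
    proof (cases "f x \<in> Q")
      case True
      then show ?thesis using ds(2) ed(3) X(2) that by auto
    next
      case False
      then show ?thesis using z_word[of x, OF _ _ ds(1)] f_cases[of x] X(2) that by auto
    qed
    then show ?thesis using ds(1) by blast
  qed
  have eval: "is_evaluation A M f"
    if ds: "set ds \<subseteq> T" "\<And>x. x \<in> H \<Longrightarrow> f x \<in> Q \<Longrightarrow> f x \<noteq> x w \<longleftrightarrow> flips x ds" for ds
  proof (rule f_eqI[OF word(1)[OF ds(1)]])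
    fix x assume x: "x \<in> H"
    show "f x = x (word ds)"
    proof (cases "f x \<in> Q")
      case True
      then show ?thesis
        using x_word[OF x True ds(1)] ds(2)[OF x True] other_unique[OF True S[OF x True wS]] by auto
    next
      case False
      then show ?thesis using z_word[OF x False ds(1)] f_cases[OF x] by simp
    qed
  qed
  show ?thesis
  proof (cases "\<exists>c1\<in>\<Sigma>. \<exists>cs\<in>\<Sigma>. p \<odot> c1 = p \<and> p \<odot> cs = t")
    case False
    have same: "p \<odot> c = t \<longleftrightarrow> p \<odot> c' = t" if "c \<in> ?L" "c' \<in> ?L" for c c'
      using that False letters[of c] letters[of c'] by auto
    \<comment> \<open>All letters with nonempty action act alike, so either no letter from
      \<open>T\<close> ever flips or all do, and the flips depend only on the length of the word. A
      word that is right for \<open>x0\<close> is then right for every \<open>x\<close>.\<close>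
    let ?g = "\<lambda>ds. (\<exists>d\<in>T. p \<odot> x0 d = t) \<and> odd (length ds)"
    have flips_eq: "flips x ds \<longleftrightarrow> ?g ds" if x: "x \<in> H" "f x \<in> Q" and ds: "set ds \<subseteq> T" for x ds
    proof (cases "\<exists>d\<in>T. p \<odot> x0 d = t")
      case True
      then have "p \<odot> x d = t" if "d \<in> T" for d
        using same[OF T[OF x that]] T[OF x0] by blast
      then have "filter (\<lambda>d. p \<odot> x d = t) ds = ds" using ds by (intro filter_True) auto
      then show ?thesis using True by (simp add: flips_def)
    next
      case F: False
      have "p \<odot> x d \<noteq> t" if "d \<in> T" for d
        using same[OF T[OF x that] T[OF x0 that]] F that by blast
      then have "filter (\<lambda>d. p \<odot> x d = t) ds = []" using ds by (intro filter_False) auto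
      then show ?thesis using F by (simp add: flips_def)
    qed
    obtain ds where ds: "set ds \<subseteq> T" "f x0 = x0 (word ds)" using loc[of "{x0}"] x0(1) by auto
    show ?thesis
    proof (rule eval[OF ds(1)])
      fix x assume x: "x \<in> H" "f x \<in> Q"
      obtain es where es: "set es \<subseteq> T" "f x = x (word es)" "f x0 = x0 (word es)"
        using loc[of "{x, x0}"] x0(1) x(1) by auto
      have "x0 (word es) = x0 (word ds)" using es(3) ds(2) by simp
      then have "flips x0 es = flips x0 ds"
        using x_word[OF x0 es(1)] x_word[OF x0 ds(1)] other(3)[OF S[OF x0 wS]]
        by (metis (full_types))
      then have "flips x es = flips x ds" using flips_eq x x0 es(1) ds(1) by metis
      then show "f x \<noteq> x w \<longleftrightarrow> flips x ds"
        using es(2) x_word[OF x es(1)] other(3)[OF S[OF x wS]] by auto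
    qed
  next
    case True
    then obtain c1 cs where c: "c1 \<in> \<Sigma>" "cs \<in> \<Sigma>" "p \<odot> c1 = p" "p \<odot> cs = t" by blast
    then have cL: "c1 \<in> ?L" "cs \<in> ?L" using pt by auto
    \<comment> \<open>The flips of the homomorphisms in \<open>X\<close> form a vector space over the field with two elements,
      on which \<open>f x \<noteq> x w\<close> is a continuous linear functional of the coordinates in \<open>T\<close>.\<close>
    define X where "X = {x \<in> H. f x \<in> Q}"
    have ST: "a \<notin> T" if "a \<in> S" for a using that cp by (auto simp: closed_pair_def)
    \<comment> \<open>Any assignment \<open>g\<close> of states obeying a prescribed set
      \<open>e\<close> of flipping letters extends to a homomorphism in \<open>X\<close>;
      \<open>cs\<close> realises a flip and \<open>c1\<close> none.\<close>
    have mk: "glue (\<lambda>a. if a \<in> S then g a else if e a then cs else c1) S T \<in> X"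
        (is "?y \<in> X")
      and mk_S: "\<And>a. a \<in> S \<Longrightarrow> glue (\<lambda>a. if a \<in> S then g a else if e a then cs else c1) S T a = g a"
      and mk_T:
        "\<And>d. d \<in> T \<Longrightarrow> p \<odot> glue (\<lambda>a. if a \<in> S then g a else if e a then cs else c1) S T d = t \<longleftrightarrow> e d"
      if g: "\<And>a. a \<in> S \<Longrightarrow> g a \<in> Q"
        "\<And>a d. a \<in> S \<Longrightarrow> d \<in> T \<Longrightarrow> g (a \<star> d) = (if e d then other (g a) else g a)" for g e
    proof -
      have "d \<notin> S" if "d \<in> T" for d using ST that by blast
      then have y: "?y \<in> H"
        using g c act[OF g(1) cL(1)] act[OF g(1) cL(2)] closed_pair_mult(3)[OF cp] Q(2)
        by (intro glue_hom[OF cp]) auto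
      show S: "?y a = g a" if "a \<in> S" for a using glue_simps(1)[OF cp that] that by simp
      show "?y \<in> X" using y w[OF y] S[OF wS] g(1)[OF wS] by (simp add: X_def)
      show "p \<odot> ?y d = t \<longleftrightarrow> e d" if "d \<in> T" for d
        using glue_simps(2)[OF cp that] \<open>\<And>d. d \<in> T \<Longrightarrow> d \<notin> S\<close> that c Q(2) by simp
    qed
    have step: "x (a \<star> d) = (if p \<odot> x d = t then other (x a) else x a)"
      if "x \<in> X" "a \<in> S" "d \<in> T" for x a d
      using act[OF S T, of x a x d] hom_mult[of x a d] closed_pair_mult[OF cp that(2,3)] that
      by (simp add: X_def)
    have add: "\<exists>u\<in>X. (\<forall>c\<in>T. p \<odot> u c = t \<longleftrightarrow> (p \<odot> x c = t) \<noteq> (p \<odot> y c = t)) \<and>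
        (f u \<noteq> u w \<longleftrightarrow> (f x \<noteq> x w) \<noteq> (f y \<noteq> y w))" if xy: "x \<in> X" "y \<in> X" for x y
    proof -
      \<comment> \<open>The sum of \<open>x\<close> and \<open>y\<close>: \<open>p\<close> marks
        agreement and \<open>t\<close> disagreement, so the flips add modulo two. A word evaluating
        \<open>f\<close> at all three homomorphisms shows that \<open>f\<close> is additive.\<close>
      let ?g = "\<lambda>a. if x a = y a then p else t"
      let ?e = "\<lambda>d. (p \<odot> x d = t) \<noteq> (p \<odot> y d = t)"
      let ?u = "glue (\<lambda>a. if a \<in> S then ?g a else if ?e a then cs else c1) S T"
      have xyQ: "x a \<in> Q" "y a \<in> Q" if "a \<in> S" for a using S that xy by (auto simp: X_def)
      have g: "?g (a \<star> d) = (if ?e d then other (?g a) else ?g a)" if "a \<in> S" "d \<in> T" for a d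
        using step[OF xy(1) that] step[OF xy(2) that] xyQ[OF that(1)] Q
        by (auto simp: other_def)
      have u: "?u \<in> X" by (rule mk) (use g pt in auto)
      have uT: "p \<odot> ?u d = t \<longleftrightarrow> ?e d" if "d \<in> T" for d by (rule mk_T) (use g pt that in auto)
      obtain ds where ds: "set ds \<subseteq> T" "\<forall>v\<in>{x, y, ?u}. f v = v (word ds)"
        using loc[of "{x, y, ?u}"] xy u unfolding X_def by blast
      have fl: "f v \<noteq> v w \<longleftrightarrow> flips v ds" if v: "v \<in> X" "f v = v (word ds)" for v
      proof -
        have vH: "v \<in> H" "f v \<in> Q" using v(1) by (simp_all add: X_def)
        show ?thesis unfolding v(2) x_word[OF vH ds(1)] using other(3)[OF S[OF vH wS]] by simp
      qed
      have "flips ?u es \<longleftrightarrow> flips x es \<noteq> flips y es" if "set es \<subseteq> T" for es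
        using that
      proof (induction es)
        case (Cons d es)
        then show ?case using uT[of d] by (auto simp: flips_def)
      qed (simp add: flips_def)
      then have "f ?u \<noteq> ?u w \<longleftrightarrow> (f x \<noteq> x w) \<noteq> (f y \<noteq> y w)"
        using fl[OF xy(1)] fl[OF xy(2)] fl[OF u] ds by simp
      then show ?thesis using u uT by blast
    qed
    have "\<forall>b\<in>F \<inter> S. \<exists>ds. set ds \<subseteq> T \<and> (\<forall>x\<in>H. f x \<in> Q \<longrightarrow> x b = x (word ds))"
      using S_word by blast
    then obtain W where W: "\<forall>b\<in>F \<inter> S. set (W b) \<subseteq> T \<and> (\<forall>x\<in>H. f x \<in> Q \<longrightarrow> x b = x (word (W b)))"
      by (elim bchoice[elim_format] exE)
    \<comment> \<open>Besides the letters in \<open>F\<close>, the letters of words representing the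
      elements of \<open>F \<inter> S\<close>; the flips on \<open>D\<close> together with
      \<open>x w\<close> determine \<open>x\<close> on \<open>F \<inter> S\<close>.\<close>
    define D where "D = (F \<inter> T) \<union> (\<Union>b\<in>F \<inter> S. set (W b))"
    have D: "finite D" "D \<subseteq> T" using finite_F W by (auto simp: D_def)
    have van: "f x = x w" if x: "x \<in> X" and xD: "\<forall>d\<in>D. p \<odot> x d \<noteq> t" for x
    proof -
      have xS: "x a \<in> Q" if "a \<in> S" for a using S that x by (auto simp: X_def)
      \<comment> \<open>\<open>?y\<close> is \<open>x\<close> on \<open>S\<close> with the letters
        normalised to \<open>cs\<close> and \<open>c1\<close>; \<open>?v\<close> is constantly
        \<open>x w\<close> on \<open>S\<close> with no flipping letter. Without flips on
        \<open>D\<close> they agree on \<open>F\<close>, hence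
        \<open>f x = f ?y = f ?v = x w\<close>.\<close>
      let ?e = "\<lambda>d. p \<odot> x d = t"
      let ?y = "glue (\<lambda>a. if a \<in> S then x a else if ?e a then cs else c1) S T"
      let ?v = "glue (\<lambda>a. if a \<in> S then x w else if False then cs else c1) S T"
      have y: "?y \<in> X" by (rule mk) (use xS step[OF x] in auto)
      have yS: "?y a = x a" if "a \<in> S" for a by (rule mk_S) (use xS step[OF x] that in auto)
      have v: "?v \<in> X" by (rule mk) (use xS wS in auto)
      have vS: "?v a = x w" if "a \<in> S" for a by (rule mk_S) (use xS wS that in auto)
      have vT: "p \<odot> ?v d \<noteq> t" if "d \<in> T" for d
        using mk_T[of "\<lambda>_. x w" "\<lambda>_. False" d] xS wS that by simp
      have "?y a = ?v a" if a: "a \<in> F" for a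
      proof (rule glue_eqI)
        assume "a \<in> S \<union> T"
        then consider "a \<in> S" | "a \<in> T" "a \<notin> S" by blast
        then show "(if a \<in> S then x a else if ?e a then cs else c1) =
            (if a \<in> S then x w else if False then cs else c1)"
        proof cases
          case 1
          have "set (W a) \<subseteq> T" "x a = x (word (W a))"
            using bspec[OF W, of a] 1 a x by (auto simp: X_def)
          moreover have "\<not> flips x (W a)"
          proof -
            have "filter (\<lambda>d. p \<odot> x d = t) (W a) = []"
              using xD 1 a by (intro filter_False) (auto simp: D_def)
            then show ?thesis by (simp add: flips_def)
          qed
          ultimately show ?thesis using x_word[of x "W a"] x 1 by (simp add: X_def)
        next
          case 2
          then show ?thesis using xD a by (auto simp: D_def)
        qed
      qed auto
      then have "f ?y = f ?v" using y v by (intro determined) (auto simp: X_def)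
      moreover have "f ?v = x w"
      proof -
        obtain ds where ds: "set ds \<subseteq> T" "f ?v = ?v (word ds)"
          using loc[of "{?v}"] v by (auto simp: X_def)
        then show ?thesis using vS[OF word(2)[OF ds(1)]] by simp
      qed
      moreover have "f ?y = f x"
      proof -
        obtain ds where ds: "set ds \<subseteq> T" "f ?y = ?y (word ds)" "f x = x (word ds)"
          using loc[of "{?y, x}"] y x by (auto simp: X_def)
        then show ?thesis using yS[OF word(2)[OF ds(1)]] by simp
      qed
      ultimately show ?thesis by simp
    qed
    have "\<exists>ds. set ds \<subseteq> D \<and> (\<forall>x\<in>X. f x \<noteq> x w \<longleftrightarrow> odd (length (filter (\<lambda>d. p \<odot> x d = t) ds)))"
      by (rule xor_functional_sum[OF D add]) (use van in auto)
    then obtain ds where "set ds \<subseteq> D"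
      "\<forall>x\<in>X. f x \<noteq> x w \<longleftrightarrow> odd (length (filter (\<lambda>d. p \<odot> x d = t) ds))" by blast
    then show ?thesis using D(2) by (intro eval[of ds]) (auto simp: X_def flips_def)
  qed
qed

end

section \<open>The six forbidden automata\<close>

lemma satisfies_equations_if_embeds:
  assumes "embeds A M" "algebra A" "satisfies_equations M"
  shows "satisfies_equations A"
proof -
  obtain h where h: "h \<in> hom A M" "inj_on h (univ A)" using assms(1) by (auto simp: embeds_def)
  have hM: "h x \<in> univ M" if "x \<in> univ A" for x using h(1) that by (auto simp: mem_hom_iff)
  have mult: "x \<cdot>\<^bsub>A\<^esub> y \<in> univ A" "h (x \<cdot>\<^bsub>A\<^esub> y) = h x \<cdot>\<^bsub>M\<^esub> h y" if "x \<in> univ A" "y \<in> univ A" for x y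
    using algebra_mult[OF assms(2) that] h(1) that by (auto simp: mem_hom_iff)
  show ?thesis unfolding satisfies_equations_def
  proof (intro conjI ballI)
    fix x y assume "x \<in> univ A" "y \<in> univ A"
    then show "x \<cdot>\<^bsub>A\<^esub> y = x \<cdot>\<^bsub>A\<^esub> y \<cdot>\<^bsub>A\<^esub> y \<cdot>\<^bsub>A\<^esub> y"
      using assms(3) hM by (intro inj_onD[OF h(2)]) (simp_all add: mult satisfies_equations_def)
  next
    fix w x y z assume "w \<in> univ A" "x \<in> univ A" "y \<in> univ A" "z \<in> univ A"
    then show "w \<cdot>\<^bsub>A\<^esub> x \<cdot>\<^bsub>A\<^esub> y \<cdot>\<^bsub>A\<^esub> z = w \<cdot>\<^bsub>A\<^esub> y \<cdot>\<^bsub>A\<^esub> x \<cdot>\<^bsub>A\<^esub> z"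
      using assms(3) hM by (intro inj_onD[OF h(2)]) (simp_all add: mult satisfies_equations_def)
  qed
qed

lemmas N_defs = N0_def N1_def N2_def N3_def N4_def N5_def

lemma algebra_N: "algebra N0" "algebra N1" "algebra N2" "algebra N3" "algebra N4" "algebra N5"
  by (simp_all add: N_defs automatic_algebra_def algebra_def subuniverse_def)

lemma not_satisfies_equations_N:
  "\<not> satisfies_equations N0" "\<not> satisfies_equations N1" "\<not> satisfies_equations N2"
  "\<not> satisfies_equations N3" "\<not> satisfies_equations N4" "\<not> satisfies_equations N5"
  by (simp_all add: N_defs automatic_algebra_def satisfies_equations_def)

section \<open>From the equations and the forbidden automata to the kinds of letters\<close>

context two_state
begin

lemma mult_eq_zero: "x \<notin> Q \<or> y \<notin> \<Sigma> \<Longrightarrow> x \<odot> y = z"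
  using mult_nonzero by blast

lemma embeds_automatic_algebraI:
  assumes N: "N = automatic_algebra P L o' d" "algebra N"
    and h: "inj_on h (P \<union> L \<union> {o'})" "h ` P \<subseteq> Q" "h ` L \<subseteq> \<Sigma>" "h o' = z"
    and mult: "\<And>s l. s \<in> P \<Longrightarrow> l \<in> L \<Longrightarrow> h s \<odot> h l = h (case d l s of None \<Rightarrow> o' | Some r \<Rightarrow> r)"
  shows "embeds N M"
proof -
  have uN: "univ N = P \<union> L \<union> {o'}" by (simp add: N(1) automatic_algebra_def)
  have "h (x \<cdot>\<^bsub>N\<^esub> y) = h x \<odot> h y" if xy: "x \<in> univ N" "y \<in> univ N" for x y
  proof (cases "x \<in> P \<and> y \<in> L")
    case True
    then show ?thesis using mult by (simp add: N(1) automatic_algebra_def)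
  next
    case False
    have "h x \<notin> Q \<or> h y \<notin> \<Sigma>" using False xy h(2-4) uN zero_fresh disjoint by blast
    then show ?thesis using False h(4) mult_eq_zero by (auto simp: N(1) automatic_algebra_def)
  qed
  moreover have "h x \<in> univ M" if "x \<in> univ N" for x using that h(2-4) uN univ_eq by auto
  ultimately have "(\<lambda>x\<in>univ N. h x) \<in> hom N M"
    using algebra_mult[OF N(2)] by (simp add: mem_hom_iff)
  moreover have "inj_on (\<lambda>x\<in>univ N. h x) (univ N)" using h(1) by (simp add: uN inj_on_def)
  ultimately show ?thesis unfolding embeds_def by blast
qed

lemma embeds_N:
  assumes qr: "Q = {q, r}" "q \<noteq> r"
  shows "a \<in> \<Sigma> \<Longrightarrow> q \<odot> a = r \<Longrightarrow> r \<odot> a = z \<Longrightarrow> embeds N0 M"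
    and "a \<in> \<Sigma> \<Longrightarrow> b \<in> \<Sigma> \<Longrightarrow> q \<odot> a = r \<Longrightarrow> r \<odot> a = r \<Longrightarrow> q \<odot> b = z \<Longrightarrow> r \<odot> b = r \<Longrightarrow> embeds N1 M"
    and "a \<in> \<Sigma> \<Longrightarrow> b \<in> \<Sigma> \<Longrightarrow> q \<odot> a = r \<Longrightarrow> r \<odot> a = q \<Longrightarrow> q \<odot> b = z \<Longrightarrow> r \<odot> b = r \<Longrightarrow> embeds N2 M"
    and "a \<in> \<Sigma> \<Longrightarrow> b \<in> \<Sigma> \<Longrightarrow> q \<odot> a = r \<Longrightarrow> r \<odot> a = r \<Longrightarrow> q \<odot> b = q \<Longrightarrow> r \<odot> b = z \<Longrightarrow> embeds N3 M"
    and "a \<in> \<Sigma> \<Longrightarrow> b \<in> \<Sigma> \<Longrightarrow> q \<odot> a = r \<Longrightarrow> r \<odot> a = r \<Longrightarrow> q \<odot> b = r \<Longrightarrow> r \<odot> b = q \<Longrightarrow> embeds N4 M"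
    and "a \<in> \<Sigma> \<Longrightarrow> b \<in> \<Sigma> \<Longrightarrow> c \<in> \<Sigma> \<Longrightarrow> q \<odot> a = r \<Longrightarrow> r \<odot> a = r \<Longrightarrow> q \<odot> b = q \<Longrightarrow> r \<odot> b = q \<Longrightarrow>
      q \<odot> c = q \<Longrightarrow> r \<odot> c = r \<Longrightarrow> embeds N5 M"
proof -
  \<comment> \<open>Constructors that are not letters of the automaton in question receive an
    arbitrary image, as injectivity matters on its universe only.\<close>
  let ?h = "\<lambda>a b c. case_nelem z q r a b c"
  have Q: "q \<in> Q" "r \<in> Q" using qr by auto
  note st = state_props(1)[OF Q(1)] state_props(1)[OF Q(2)] state_props(3) qr(2) Q
  {
    assume *: "a \<in> \<Sigma>" "q \<odot> a = r" "r \<odot> a = z"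
    show "embeds N0 M" using st * state_props(2)[OF *(1)]
      by (intro embeds_automatic_algebraI[OF N0_def algebra_N(1), of "?h a a a"]) auto
  }
  {
    assume *: "a \<in> \<Sigma>" "b \<in> \<Sigma>" "q \<odot> a = r" "r \<odot> a = r" "q \<odot> b = z" "r \<odot> b = r"
    have "a \<noteq> b" using st *(3-) by auto
    then show "embeds N1 M" using st * state_props(2)[OF *(1)] state_props(2)[OF *(2)]
      by (intro embeds_automatic_algebraI[OF N1_def algebra_N(2), of "?h a b a"]) auto
  }
  {
    assume *: "a \<in> \<Sigma>" "b \<in> \<Sigma>" "q \<odot> a = r" "r \<odot> a = q" "q \<odot> b = z" "r \<odot> b = r"
    have "a \<noteq> b" using st *(3-) by auto
    then show "embeds N2 M" using st * state_props(2)[OF *(1)] state_props(2)[OF *(2)]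
      by (intro embeds_automatic_algebraI[OF N2_def algebra_N(3), of "?h a b a"]) auto
  }
  {
    assume *: "a \<in> \<Sigma>" "b \<in> \<Sigma>" "q \<odot> a = r" "r \<odot> a = r" "q \<odot> b = q" "r \<odot> b = z"
    have "a \<noteq> b" using st *(3-) by auto
    then show "embeds N3 M" using st * state_props(2)[OF *(1)] state_props(2)[OF *(2)]
      by (intro embeds_automatic_algebraI[OF N3_def algebra_N(4), of "?h a b a"]) auto
  }
  {
    assume *: "a \<in> \<Sigma>" "b \<in> \<Sigma>" "q \<odot> a = r" "r \<odot> a = r" "q \<odot> b = r" "r \<odot> b = q"
    have "a \<noteq> b" using st *(3-) by auto
    then show "embeds N4 M" using st * state_props(2)[OF *(1)] state_props(2)[OF *(2)]
      by (intro embeds_automatic_algebraI[OF N4_def algebra_N(5), of "?h a b a"]) auto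
  }
  {
    assume *: "a \<in> \<Sigma>" "b \<in> \<Sigma>" "c \<in> \<Sigma>" "q \<odot> a = r" "r \<odot> a = r" "q \<odot> b = q" "r \<odot> b = q" "q \<odot> c = q"
      "r \<odot> c = r"
    have "a \<noteq> b" "a \<noteq> c" "b \<noteq> c" using st *(4-) by auto
    then show "embeds N5 M"
      using st * state_props(2)[OF *(1)] state_props(2)[OF *(2)] state_props(2)[OF *(3)]
      by (intro embeds_automatic_algebraI[OF N5_def algebra_N(6), of "?h a b c"]) auto
  }
qed

text \<open>\<open>bad_letters q r\<close>: restricted to some letters, the automaton is one of the six forbidden
  automata with these names of the states.\<close>

definition bad_letters :: "'a \<Rightarrow> 'a \<Rightarrow> bool" where
  "bad_letters q r \<longleftrightarrow>
     (\<exists>a\<in>\<Sigma>. q \<odot> a = r \<and> r \<odot> a = z) \<or>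
     (\<exists>a\<in>\<Sigma>. \<exists>b\<in>\<Sigma>. q \<odot> a = r \<and> r \<odot> a = r \<and> q \<odot> b = z \<and> r \<odot> b = r) \<or>
     (\<exists>a\<in>\<Sigma>. \<exists>b\<in>\<Sigma>. q \<odot> a = r \<and> r \<odot> a = q \<and> q \<odot> b = z \<and> r \<odot> b = r) \<or>
     (\<exists>a\<in>\<Sigma>. \<exists>b\<in>\<Sigma>. q \<odot> a = r \<and> r \<odot> a = r \<and> q \<odot> b = q \<and> r \<odot> b = z) \<or>
     (\<exists>a\<in>\<Sigma>. \<exists>b\<in>\<Sigma>. q \<odot> a = r \<and> r \<odot> a = r \<and> q \<odot> b = r \<and> r \<odot> b = q) \<or>
     (\<exists>a\<in>\<Sigma>. \<exists>b\<in>\<Sigma>. \<exists>c\<in>\<Sigma>. q \<odot> a = r \<and> r \<odot> a = r \<and> q \<odot> b = q \<and> r \<odot> b = q \<and>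
       q \<odot> c = q \<and> r \<odot> c = r)"

lemma bad_letters_embeds:
  assumes "Q = {q, r}" "q \<noteq> r" "bad_letters q r"
  shows "embeds N0 M \<or> embeds N1 M \<or> embeds N2 M \<or> embeds N3 M \<or> embeds N4 M \<or> embeds N5 M"
  using assms(3) embeds_N[OF assms(1,2)] unfolding bad_letters_def by meson

lemma bad_letters_not_dualizable:
  assumes "Q = {q, r}" "q \<noteq> r" "bad_letters q r" "infinite (UNIV :: 'b set)"
  shows "\<not> dualizable TYPE('b) M"
  using assms(3) unfolding bad_letters_def
  by (elim disjE bexE conjE)
    (rule not_dualizable_N0[OF assms(4,1,2)] not_dualizable_N1[OF assms(4,1,2)]
      not_dualizable_N2[OF assms(4,1,2)] not_dualizable_N3[OF assms(4,1,2)]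
      not_dualizable_N4[OF assms(4,1,2)] not_dualizable_N5[OF assms(4,1,2)]; assumption)+

text \<open>The fourth kind, the identity with one fixed constant map, appears twice because the
  constant may be either state.\<close>

definition good_letters :: "'a \<Rightarrow> 'a \<Rightarrow> bool" where
  "good_letters p t \<longleftrightarrow>
     (\<forall>c\<in>\<Sigma>. p \<odot> c = z \<and> t \<odot> c = z \<or> p \<odot> c = p \<and> t \<odot> c = t \<or> p \<odot> c = t \<and> t \<odot> c = p) \<or>
     (\<forall>c\<in>\<Sigma>. (p \<odot> c = p \<or> p \<odot> c = z) \<and> (t \<odot> c = t \<or> t \<odot> c = z)) \<or>
     (\<forall>c\<in>\<Sigma>. p \<odot> c = t \<odot> c) \<or>
     (\<forall>c\<in>\<Sigma>. p \<odot> c = z \<and> t \<odot> c = z \<or> p \<odot> c = p \<and> t \<odot> c = t \<or> p \<odot> c = t \<and> t \<odot> c = t) \<or>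
     (\<forall>c\<in>\<Sigma>. p \<odot> c = z \<and> t \<odot> c = z \<or> p \<odot> c = p \<and> t \<odot> c = t \<or> p \<odot> c = p \<and> t \<odot> c = p)"

lemma not_bad_lettersD:
  assumes "\<not> bad_letters q r"
  shows "a \<in> \<Sigma> \<Longrightarrow> q \<odot> a = r \<Longrightarrow> r \<odot> a \<noteq> z"
    and "a \<in> \<Sigma> \<Longrightarrow> q \<odot> a = r \<Longrightarrow> r \<odot> a = r \<Longrightarrow> b \<in> \<Sigma> \<Longrightarrow>
      \<not> (q \<odot> b = z \<and> r \<odot> b = r) \<and> \<not> (q \<odot> b = q \<and> r \<odot> b = z) \<and> \<not> (q \<odot> b = r \<and> r \<odot> b = q)"
    and "a \<in> \<Sigma> \<Longrightarrow> q \<odot> a = r \<Longrightarrow> r \<odot> a = q \<Longrightarrow> b \<in> \<Sigma> \<Longrightarrow> \<not> (q \<odot> b = z \<and> r \<odot> b = r)"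
    and "a \<in> \<Sigma> \<Longrightarrow> q \<odot> a = r \<Longrightarrow> r \<odot> a = r \<Longrightarrow> b \<in> \<Sigma> \<Longrightarrow> c \<in> \<Sigma> \<Longrightarrow>
      q \<odot> c = q \<Longrightarrow> r \<odot> c = r \<Longrightarrow> \<not> (q \<odot> b = q \<and> r \<odot> b = q)"
proof -
  note nb = assms[unfolded bad_letters_def de_Morgan_disj]
  show "a \<in> \<Sigma> \<Longrightarrow> q \<odot> a = r \<Longrightarrow> r \<odot> a \<noteq> z"
    using nb[THEN conjunct1] by (intro notI) (erule notE, intro bexI[of _ a] conjI)
  note nb = nb[THEN conjunct2]
  have 1: "a \<in> \<Sigma> \<Longrightarrow> q \<odot> a = r \<Longrightarrow> r \<odot> a = r \<Longrightarrow> b \<in> \<Sigma> \<Longrightarrow> \<not> (q \<odot> b = z \<and> r \<odot> b = r)"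
    using nb[THEN conjunct1]
      by (intro notI) (erule notE, intro bexI[of _ a] bexI[of _ b] conjI, simp_all)
  note nb = nb[THEN conjunct2]
  show "a \<in> \<Sigma> \<Longrightarrow> q \<odot> a = r \<Longrightarrow> r \<odot> a = q \<Longrightarrow> b \<in> \<Sigma> \<Longrightarrow> \<not> (q \<odot> b = z \<and> r \<odot> b = r)"
    using nb[THEN conjunct1]
      by (intro notI) (erule notE, intro bexI[of _ a] bexI[of _ b] conjI, simp_all)
  note nb = nb[THEN conjunct2]
  have 2: "a \<in> \<Sigma> \<Longrightarrow> q \<odot> a = r \<Longrightarrow> r \<odot> a = r \<Longrightarrow> b \<in> \<Sigma> \<Longrightarrow> \<not> (q \<odot> b = q \<and> r \<odot> b = z)"
    using nb[THEN conjunct1]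
      by (intro notI) (erule notE, intro bexI[of _ a] bexI[of _ b] conjI, simp_all)
  note nb = nb[THEN conjunct2]
  have 3: "a \<in> \<Sigma> \<Longrightarrow> q \<odot> a = r \<Longrightarrow> r \<odot> a = r \<Longrightarrow> b \<in> \<Sigma> \<Longrightarrow> \<not> (q \<odot> b = r \<and> r \<odot> b = q)"
    using nb[THEN conjunct1]
      by (intro notI) (erule notE, intro bexI[of _ a] bexI[of _ b] conjI, simp_all)
  note nb = nb[THEN conjunct2]
  show "a \<in> \<Sigma> \<Longrightarrow> q \<odot> a = r \<Longrightarrow> r \<odot> a = r \<Longrightarrow> b \<in> \<Sigma> \<Longrightarrow>
      \<not> (q \<odot> b = z \<and> r \<odot> b = r) \<and> \<not> (q \<odot> b = q \<and> r \<odot> b = z) \<and> \<not> (q \<odot> b = r \<and> r \<odot> b = q)"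
    using 1 2 3 by blast
  show "a \<in> \<Sigma> \<Longrightarrow> q \<odot> a = r \<Longrightarrow> r \<odot> a = r \<Longrightarrow> b \<in> \<Sigma> \<Longrightarrow> c \<in> \<Sigma> \<Longrightarrow>
      q \<odot> c = q \<Longrightarrow> r \<odot> c = r \<Longrightarrow> \<not> (q \<odot> b = q \<and> r \<odot> b = q)"
    using nb
      by (intro notI) (erule notE, intro bexI[of _ a] bexI[of _ b] bexI[of _ c] conjI, simp_all)
qed

text \<open>\<open>N0\<close> excludes letters that only move one state to the other. A total
  constant letter excludes one-state identities by \<open>N1\<close> and \<open>N3\<close> and the
  swap by \<open>N4\<close>; if the identity also occurs, \<open>N5\<close> excludes the other
  constant. Without total constants, a swap excludes one-state identities by \<open>N2\<close>, and
  without a swap only partial identities are left.\<close>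

lemma good_letters_if_not_bad:
  assumes Q: "Q = {p, t}" "p \<noteq> t" and nb: "\<not> bad_letters p t" "\<not> bad_letters t p"
  shows "good_letters p t"
proof -
  have pt: "p \<noteq> z" "t \<noteq> z" using Q zero_fresh by auto
  have val: "s \<odot> c = p \<or> s \<odot> c = t \<or> s \<odot> c = z" for s c
    using mult_nonzero[of s c] Q by auto
  have no_N0: "\<not> (p \<odot> c = t \<and> t \<odot> c = z)" "\<not> (t \<odot> c = p \<and> p \<odot> c = z)" if "c \<in> \<Sigma>" for c
    using not_bad_lettersD(1)[OF nb(1) that] not_bad_lettersD(1)[OF nb(2) that] by blast+
  consider (pp) a where "a \<in> \<Sigma>" "p \<odot> a = p" "t \<odot> a = p" | (tt) a where "a \<in> \<Sigma>" "p \<odot> a = t"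
    "t \<odot> a = t"
    | (none) "\<And>a. a \<in> \<Sigma> \<Longrightarrow> \<not> (p \<odot> a = p \<and> t \<odot> a = p)" "\<And>a. a \<in> \<Sigma> \<Longrightarrow> \<not> (p \<odot> a = t \<and> t \<odot> a = t)"
    by blast
  then show ?thesis
  proof cases
    case pp
    have c: "\<not> (t \<odot> b = z \<and> p \<odot> b = p) \<and> \<not> (t \<odot> b = t \<and> p \<odot> b = z) \<and> \<not> (t \<odot> b = p \<and> p \<odot> b = t)"
      if "b \<in> \<Sigma>" for b
      using not_bad_lettersD(2)[OF nb(2) pp(1,3,2) that] by blast
    have d: "\<not> (t \<odot> b = t \<and> p \<odot> b = t)" if "b \<in> \<Sigma>" "c \<in> \<Sigma>" "t \<odot> c = t" "p \<odot> c = p" for b c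
      using not_bad_lettersD(4)[OF nb(2) pp(1,3,2) that(1,2,3,4)] by blast
    show ?thesis
    proof (cases "\<exists>c\<in>\<Sigma>. t \<odot> c = t \<and> p \<odot> c = p")
      case True
      then show ?thesis using c d no_N0 val unfolding good_letters_def by metis
    next
      case False
      then have "p \<odot> b = t \<odot> b" if "b \<in> \<Sigma>" for b
        using c[OF that] no_N0[OF that] val[of p b] val[of t b] that by metis
      then show ?thesis unfolding good_letters_def by blast
    qed
  next
    case tt
    have c: "\<not> (p \<odot> b = z \<and> t \<odot> b = t) \<and> \<not> (p \<odot> b = p \<and> t \<odot> b = z) \<and> \<not> (p \<odot> b = t \<and> t \<odot> b = p)"
      if "b \<in> \<Sigma>" for b
      using not_bad_lettersD(2)[OF nb(1) tt that] by blast
    have d: "\<not> (p \<odot> b = p \<and> t \<odot> b = p)" if "b \<in> \<Sigma>" "c \<in> \<Sigma>" "p \<odot> c = p" "t \<odot> c = t" for b c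
      using not_bad_lettersD(4)[OF nb(1) tt that] by blast
    show ?thesis
    proof (cases "\<exists>c\<in>\<Sigma>. t \<odot> c = t \<and> p \<odot> c = p")
      case True
      then show ?thesis using c d no_N0 val unfolding good_letters_def by metis
    next
      case False
      then have "p \<odot> b = t \<odot> b" if "b \<in> \<Sigma>" for b
        using c[OF that] no_N0[OF that] val[of p b] val[of t b] that by metis
      then show ?thesis unfolding good_letters_def by blast
    qed
  next
    case none
    show ?thesis
    proof (cases "\<exists>a\<in>\<Sigma>. p \<odot> a = t \<and> t \<odot> a = p")
      case True
      then obtain a where a: "a \<in> \<Sigma>" "p \<odot> a = t" "t \<odot> a = p" by blast
      have "\<not> (p \<odot> b = z \<and> t \<odot> b = t) \<and> \<not> (p \<odot> b = p \<and> t \<odot> b = z)" if "b \<in> \<Sigma>" for b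
        using not_bad_lettersD(3)[OF nb(1) a that] not_bad_lettersD(3)[OF nb(2) a(1,3,2) that]
          by blast
      then have "p \<odot> c = z \<and> t \<odot> c = z \<or> p \<odot> c = p \<and> t \<odot> c = t \<or> p \<odot> c = t \<and> t \<odot> c = p"
        if "c \<in> \<Sigma>" for c
        using none[OF that] no_N0[OF that] val[of p c] val[of t c] that by metis
      then show ?thesis unfolding good_letters_def by blast
    next
      case False
      then have "(p \<odot> c = p \<or> p \<odot> c = z) \<and> (t \<odot> c = t \<or> t \<odot> c = z)" if "c \<in> \<Sigma>" for c
        using none[OF that] no_N0[OF that] val[of p c] val[of t c] that by metis
      then show ?thesis unfolding good_letters_def by blast
    qed
  qed
qed

lemma not_bad_if_satisfies_equations:
  assumes Q: "Q = {q, r}" "q \<noteq> r" and eqs: "satisfies_equations M"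
  shows "\<not> bad_letters q r"
proof
  have qr: "q \<in> univ M" "q \<noteq> z" "r \<noteq> z" using Q zero_fresh by (auto simp: univ_eq)
  have \<Sigma>: "a \<in> univ M" if "a \<in> \<Sigma>" for a using that by (simp add: univ_eq)
  have 1: "q \<odot> a = q \<odot> a \<odot> a \<odot> a" if "a \<in> \<Sigma>" for a
    using eqs qr(1) \<Sigma>[OF that] unfolding satisfies_equations_def by blast
  have 2: "q \<odot> a \<odot> b \<odot> c = q \<odot> b \<odot> a \<odot> c" if "a \<in> \<Sigma>" "b \<in> \<Sigma>" "c \<in> \<Sigma>" for a b c
    using eqs qr(1) \<Sigma>[OF that(1)] \<Sigma>[OF that(2)] \<Sigma>[OF that(3)]
    unfolding satisfies_equations_def by blast
  assume "bad_letters q r"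
  then show False
    unfolding bad_letters_def
  proof (elim disjE bexE conjE)
    fix a assume "a \<in> \<Sigma>" "q \<odot> a = r" "r \<odot> a = z"
    then show False using 1[of a] qr by simp
  next
    fix a b assume "a \<in> \<Sigma>" "b \<in> \<Sigma>" "q \<odot> a = r" "r \<odot> a = r" "q \<odot> b = z" "r \<odot> b = r"
    then show False using 2[of a b a] qr by simp
  next
    fix a b assume "a \<in> \<Sigma>" "b \<in> \<Sigma>" "q \<odot> a = r" "r \<odot> a = q" "q \<odot> b = z" "r \<odot> b = r"
    then show False using 2[of a b b] qr by simp
  next
    fix a b assume "a \<in> \<Sigma>" "b \<in> \<Sigma>" "q \<odot> a = r" "r \<odot> a = r" "q \<odot> b = q" "r \<odot> b = z"
    then show False using 2[of a b a] qr by simp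
  next
    fix a b assume "a \<in> \<Sigma>" "b \<in> \<Sigma>" "q \<odot> a = r" "r \<odot> a = r" "q \<odot> b = r" "r \<odot> b = q"
    then show False using 2[of a b b] Q(2) by simp
  next
    fix a b c assume "a \<in> \<Sigma>" "b \<in> \<Sigma>" "c \<in> \<Sigma>" "q \<odot> a = r" "r \<odot> a = r" "q \<odot> b = q" "r \<odot> b = q"
      "q \<odot> c = q" "r \<odot> c = r"
    then show False using 2[of a b c] Q(2) by simp
  qed
qed

lemma satisfies_equations_if_good:
  assumes Q: "Q = {p, t}" and good: "good_letters p t"
  shows "satisfies_equations M"
proof -
  have val: "p \<odot> c = p \<or> p \<odot> c = t \<or> p \<odot> c = z" for c
    using mult_nonzero[of p c] Q by auto
  have key: "s \<odot> c = s \<odot> c \<odot> c \<odot> c \<and> s \<odot> a \<odot> b \<odot> c = s \<odot> b \<odot> a \<odot> c"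
    if "s \<in> Q" and abc: "a \<in> \<Sigma>" "b \<in> \<Sigma>" "c \<in> \<Sigma>" for s a b c
  proof -
    have s: "s = p \<or> s = t" using \<open>s \<in> Q\<close> Q by simp
    from good show ?thesis
      unfolding good_letters_def
    proof (elim disjE)
      assume "\<forall>c\<in>\<Sigma>. p \<odot> c = z \<and> t \<odot> c = z \<or> p \<odot> c = p \<and> t \<odot> c = t \<or> p \<odot> c = t \<and> t \<odot> c = p"
      from s this[THEN bspec, OF abc(1)] this[THEN bspec, OF abc(2)] this[THEN bspec, OF abc(3)]
      show ?thesis by (elim disjE conjE) simp_all
    next
      assume "\<forall>c\<in>\<Sigma>. (p \<odot> c = p \<or> p \<odot> c = z) \<and> (t \<odot> c = t \<or> t \<odot> c = z)"
      from s this[THEN bspec, OF abc(1)] this[THEN bspec, OF abc(2)] this[THEN bspec, OF abc(3)]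
      show ?thesis by (elim disjE conjE) simp_all
    next
      assume "\<forall>c\<in>\<Sigma>. p \<odot> c = t \<odot> c"
      from s this[THEN bspec, OF abc(1), symmetric] this[THEN bspec, OF abc(2), symmetric]
        this[THEN bspec, OF abc(3), symmetric] val[of a] val[of b] val[of c]
      show ?thesis by (elim disjE) simp_all
    next
      assume "\<forall>c\<in>\<Sigma>. p \<odot> c = z \<and> t \<odot> c = z \<or> p \<odot> c = p \<and> t \<odot> c = t \<or> p \<odot> c = t \<and> t \<odot> c = t"
      from s this[THEN bspec, OF abc(1)] this[THEN bspec, OF abc(2)] this[THEN bspec, OF abc(3)]
      show ?thesis by (elim disjE conjE) simp_all
    next
      assume "\<forall>c\<in>\<Sigma>. p \<odot> c = z \<and> t \<odot> c = z \<or> p \<odot> c = p \<and> t \<odot> c = t \<or> p \<odot> c = p \<and> t \<odot> c = p"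
      from s this[THEN bspec, OF abc(1)] this[THEN bspec, OF abc(2)] this[THEN bspec, OF abc(3)]
      show ?thesis by (elim disjE conjE) simp_all
    qed
  qed
  show ?thesis unfolding satisfies_equations_def
  proof (intro conjI ballI)
    fix s c
    show "s \<odot> c = s \<odot> c \<odot> c \<odot> c"
    proof (cases "s \<in> Q \<and> c \<in> \<Sigma>")
      case True
      then show ?thesis by (intro key[of s c c c, THEN conjunct1]) simp_all
    next
      case False
      then show ?thesis using mult_eq_zero[of s c] by simp
    qed
  next
    fix s a b c
    show "s \<odot> a \<odot> b \<odot> c = s \<odot> b \<odot> a \<odot> c"
    proof (cases "s \<in> Q \<and> a \<in> \<Sigma> \<and> b \<in> \<Sigma> \<and> c \<in> \<Sigma>")
      case True
      then show ?thesis by (intro key[THEN conjunct2]) simp_all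
    next
      case False
      then show ?thesis
        using mult_eq_zero[of s a] mult_eq_zero[of s b] mult_eq_zero[of "s \<odot> a" b]
          mult_eq_zero[of "s \<odot> b" a] mult_eq_zero[of "s \<odot> a \<odot> b" c] mult_eq_zero[of "s \<odot> b \<odot> a" c]
        by (metis mult_zero(1))
    qed
  qed
qed

text \<open>The homomorphism \<open>\<chi> UNIV\<close> separates non-products from products. If
  \<open>f\<close> sends it to \<open>p\<close>, then only elements of \<open>F\<close> can evaluate
  \<open>f\<close>; otherwise including it in every finite set forces the evaluating elements to be
  products.\<close>

lemma dualizable_if_good:
  assumes Q: "Q = {p, t}" "p \<noteq> t" and good: "good_letters p t"
  shows "dualizable TYPE('b) M"
  unfolding dualizable_def
proof (intro allI impI, elim conjE)
  fix A :: "'b magma" and f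
  assume ISP: "in_ISP A M"
    and cont: "continuous_map (hom_topology A M) (discrete_topology (univ M)) f"
    and pres: "\<forall>k\<ge>1. \<forall>R. compatible_relation M k R \<longrightarrow> preserves A M k R f"
  have alg: "algebra A" by (rule in_ISP_algebra[OF ISP])
  obtain F where F: "finite F" "F \<subseteq> univ A"
    and F': "\<forall>x\<in>hom A M. \<forall>y\<in>hom A M. (\<forall>a\<in>F. x a = y a) \<longrightarrow> f x = f y"
    by (rule hom_finitely_determined[OF finite_univ alg cont], rule that)
  have pz: "p \<noteq> z" "p \<in> univ M" "z \<in> univ M" using Q zero_fresh by (auto simp: univ_eq)
  define P where "P = {a. \<exists>b\<in>univ A. \<exists>c\<in>univ A. a = b \<cdot>\<^bsub>A\<^esub> c}"
  \<comment> \<open>A homomorphism because all products are sent to \<open>z\<close> and the only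
    nonzero value \<open>p\<close> is a state, not a letter. The set \<open>E\<close> cuts it down
    to finitely many elements without changing it on \<open>F\<close>.\<close>
  define \<chi> where "\<chi> = (\<lambda>E. \<lambda>a\<in>univ A. if a \<in> E - P then p else z)"
  have \<chi>: "\<chi> E \<in> hom A M" for E
    using pz algebra_mult[OF alg] by (auto simp: mem_hom_iff \<chi>_def P_def)
  \<comment> \<open>Adding \<open>\<chi> {}\<close> covers the empty \<open>X\<close>, which
    relations of positive arity do not.\<close>
  have loc: "\<exists>a\<in>univ A. \<forall>x\<in>X. f x = x a" if "finite X" "X \<subseteq> hom A M" for X
    using preserves_imp_locally_evaluation[where f = f and M = M
      and X = "insert (\<chi> {}) X", OF _ alg] pres that \<chi> by auto
  show "is_evaluation A M f"
  proof (cases "f (\<chi> UNIV) = p")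
    case True
    have "\<forall>a\<in>F. \<chi> F a = \<chi> UNIV a" by (simp add: \<chi>_def restrict_def)
    then have "f (\<chi> F) = f (\<chi> UNIV)" using F' \<chi> by blast
    show ?thesis
    proof (rule evaluation_if_finite_candidates[where X = "{\<chi> F}" and E = F, OF subset_refl loc])
      fix a assume "a \<in> univ A" "\<forall>x\<in>{\<chi> F}. f x = x a"
      then have "\<chi> F a = p" using True \<open>f (\<chi> F) = f (\<chi> UNIV)\<close> by simp
      then show "a \<in> F" using \<open>a \<in> univ A\<close> pz by (auto simp: \<chi>_def split: if_splits)
    qed (use \<chi> F(1) in simp_all)
  next
    case False
    interpret local_product M Q \<Sigma> z A f F
    proof
      show "algebra A" "finite F" "F \<subseteq> univ A" by (fact alg F(1) F(2))+
      show "a = b" if "a \<in> univ A" "b \<in> univ A" "\<And>x. x \<in> hom A M \<Longrightarrow> x a = x b" for a b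
        by (rule in_ISP_separating[OF ISP that])
      show "f x = f y" if "x \<in> hom A M" "y \<in> hom A M" "\<And>a. a \<in> F \<Longrightarrow> x a = y a" for x y
        using F' that by blast
      fix X assume X: "finite X" "X \<subseteq> hom A M"
      obtain a where a: "a \<in> univ A" "\<forall>x\<in>insert (\<chi> UNIV) X. f x = x a"
        using loc[of "insert (\<chi> UNIV) X"] X \<chi> by auto
      then have "a \<in> P" using False by (auto simp: \<chi>_def split: if_splits)
      then show "\<exists>b\<in>univ A. \<exists>c\<in>univ A. \<forall>x\<in>X. f x = x (b \<cdot>\<^bsub>A\<^esub> c)" using a(2) by (auto simp: P_def)
    qed
    show ?thesis
    proof (cases "\<exists>x\<in>hom A M. f x \<in> Q")
      case False
      then show ?thesis by (intro evaluation_zero) blast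
    next
      case True
      then obtain x where x: "x \<in> hom A M" "f x \<in> Q" by blast
      have Q': "Q = {t, p}" "t \<noteq> p" using Q by auto
      from good show ?thesis unfolding good_letters_def
      proof (elim disjE)
        assume "\<forall>c\<in>\<Sigma>. p \<odot> c = z \<and> t \<odot> c = z \<or> p \<odot> c = p \<and> t \<odot> c = t \<or> p \<odot> c = t \<and> t \<odot> c = p"
        then show ?thesis by (intro evaluation_permutations[OF Q _ x]) blast
      next
        assume *: "\<forall>c\<in>\<Sigma>. (p \<odot> c = p \<or> p \<odot> c = z) \<and> (t \<odot> c = t \<or> t \<odot> c = z)"
        have "s \<odot> c = s \<or> s \<odot> c = z" if "c \<in> \<Sigma>" "s \<in> Q" for c s using * that Q by auto
        moreover have "f x = p \<or> f x = t" using x Q by auto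
        ultimately show ?thesis
          using evaluation_partial_identities[OF Q(1) _ x(1)]
            evaluation_partial_identities[OF Q'(1) _ x(1)] by blast
      next
        assume "\<forall>c\<in>\<Sigma>. p \<odot> c = t \<odot> c"
        then show ?thesis by (intro evaluation_constants[OF Q _ x]) blast
      next
        assume "\<forall>c\<in>\<Sigma>. p \<odot> c = z \<and> t \<odot> c = z \<or> p \<odot> c = p \<and> t \<odot> c = t \<or> p \<odot> c = t \<and> t \<odot> c = t"
        then show ?thesis by (intro evaluation_one_constant[OF Q _ x]) blast
      next
        assume "\<forall>c\<in>\<Sigma>. p \<odot> c = z \<and> t \<odot> c = z \<or> p \<odot> c = p \<and> t \<odot> c = t \<or> p \<odot> c = p \<and> t \<odot> c = p"
        then show ?thesis by (intro evaluation_one_constant[OF Q' _ x]) blast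
      qed
    qed
  qed
qed

end

theorem theorem6p5:
  fixes Q \<Sigma> :: "'a set" and z :: 'a and \<delta> :: "'a \<Rightarrow> 'a \<rightharpoonup> 'a" and M :: "'a magma"
  assumes "Q \<inter> \<Sigma> = {}" and "z \<notin> Q \<union> \<Sigma>" and "partial_automaton Q \<Sigma> \<delta>"
    and "M = automatic_algebra Q \<Sigma> z \<delta>"
    and "finite (univ M)" and "card Q = 2"
    and "infinite (UNIV :: 'b set)"
  shows "(dualizable TYPE('b) M \<longleftrightarrow> satisfies_equations M) \<and>
         (satisfies_equations M \<longleftrightarrow>
           \<not> embeds N0 M \<and> \<not> embeds N1 M \<and> \<not> embeds N2 M \<and>
           \<not> embeds N3 M \<and> \<not> embeds N4 M \<and> \<not> embeds N5 M)"
proof -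
  interpret two_state M Q \<Sigma> z
  proof
    show "univ M = Q \<union> \<Sigma> \<union> {z}" by (simp add: assms(4) automatic_algebra_def)
    show "x \<in> Q \<and> y \<in> \<Sigma> \<and> x \<cdot>\<^bsub>M\<^esub> y \<in> Q" if "x \<cdot>\<^bsub>M\<^esub> y \<noteq> z" for x y
      using that assms(3)
      by (auto simp: assms(4) automatic_algebra_def partial_automaton_def ran_def
          split: if_splits option.splits)
  qed (fact assms)+
  obtain p t where Q: "Q = {p, t}" "p \<noteq> t" using assms(6) by (auto simp: card_2_iff)
  then have Q': "Q = {t, p}" "t \<noteq> p" by auto
  \<comment> \<open>Each of the three conditions is shown equivalent to the absence of bad letters,
    for both ways of naming the two states.\<close>
  let ?bad = "bad_letters p t \<or> bad_letters t p"
  let ?emb = "embeds N0 M \<or> embeds N1 M \<or> embeds N2 M \<or> embeds N3 M \<or> embeds N4 M \<or> embeds N5 M"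
  have eqs_not_bad: "\<not> ?bad" if "satisfies_equations M"
    using not_bad_if_satisfies_equations[OF Q that] not_bad_if_satisfies_equations[OF Q' that]
      by blast
  have good: "satisfies_equations M \<and> dualizable TYPE('b) M" if "\<not> ?bad"
    using good_letters_if_not_bad[OF Q] that satisfies_equations_if_good[OF Q(1)]
      dualizable_if_good[OF Q, where ?'b = 'b] by blast
  have "\<not> dualizable TYPE('b) M" if ?bad
    using that bad_letters_not_dualizable[OF Q _ assms(7)]
      bad_letters_not_dualizable[OF Q' _ assms(7)]
    by blast
  moreover have ?emb if ?bad
    using that bad_letters_embeds[OF Q] bad_letters_embeds[OF Q'] by blast
  moreover have "\<not> ?emb" if "satisfies_equations M"
    using satisfies_equations_if_embeds[OF _ _ that] algebra_N not_satisfies_equations_N by blast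
  ultimately show ?thesis using eqs_not_bad good by blast
qed

end
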